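(* Let $\tau>1$, $\pi(v)=\tau v-\frac{\tau-1}{v}$, and let $A_0$ be a self-adjoint operator in $l^2_+=l^2(\mathbb Z_+)$ with cyclic vector $|0\rangle$ and spectrum in $[-1,1]$. Then the iterative procedure $$A_{n+1}=\pi^*(A_n),\qquad n\ge 0,$$ converges (weakly) to an operator $A=\lim_{n\to\infty}A_n$ whose spectral measure (with respect to $|0\rangle$) is the eigen-measure $\mu$ of the Ruelle operator, $\mathcal L^*\mu=\mu$. The operator $A$ is the (matrix of the) multiplication operator by the independent variable in $L^2_{d\mu}$ with respect to the following orthonormal basis $\{e_k\}_{k\ge 0}$: $$e_0(v)=1,\qquad e_{2k}(v)=e_k(\pi(v)),\qquad e_{2k+1}(v)=\Bigl(\tau v+\frac{\tau-1}{v}\Bigr)\sum_{j=0}^{k}c^k_j\,e_j(\pi(v)),$$ where the coefficients $c^k_j$, with $c^k_k>0$, are uniquely determined by the orthogonality conditions $\langle e_{2k+1},e_l\rangle=\delta_{2k+1,l}$, $l\le 2k+1$. Moreover, each $e_k$ is a rational function of $v$ such that $e_k(A)|0\rangle=|k\rangle$, and $$\begin{bmatrix}c^0_0&c^1_0&c^2_0&\dots\\ 0&c^1_1&c^2_1&\dots\\ &\ddots&\ddots&\ddots\end{bmatrix}=\Phi^{-1},$$ where $\Phi$ is the upper triangular matrix with positive diagonal entries such that $\Phi^*\Phi=A^2+4\tau(\tau-1)$.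
   Context: $\{|k\rangle\}_{k\ge0}$ is the standard basis of $l^2_+$. Transform $\pi^*$: for a self-adjoint operator $A$ in $l^2_+$ with cyclic vector $|0\rangle$ and spectrum in $[-1,1]$, let $\Phi$ be the upper triangular matrix (with respect to the standard basis) with positive diagonal entries such that $A^2+4\tau(\tau-1)=\Phi^*\Phi$, put $A_*:=\Phi A\Phi^{-1}$, let $U:l^2_+\to l^2_+\oplus l^2_+$ be the unitary operator $U|2k\rangle=|k\rangle\oplus 0$, $U|2k+1\rangle=0\oplus|k\rangle$, and set $$\pi^*(A):=\frac1{2\tau}\,U^*\begin{bmatrix}A&\Phi^*\\ \Phi&A_*\end{bmatrix}U:\ l^2_+\to l^2_+ .$$ Ruelle operator: $E_0=[-1,1]$, $E_1=\pi^{-1}([-1,1])=[-1,-1+\frac1\tau]\cup[1-\frac1\tau,1]$. For $f$ continuous on $E_1$, $(\mathcal Lf)(x)=\frac12\sum_{\pi(v)=x}f(v)$, $x\in E_0$; the adjoint $\mathcal L^*:C(E_0)^*\to C(E_1)^*$ acts on measures. The eigen-measure $\mu$ is the probability measure with $\mathcal L^*\mu=\mu$ (supported on the Julia set of $\pi$). The spectral measure $\nu$ of a self-adjoint operator $A$ in $l^2_+$ with cyclic vector $|0\rangle$ and spectrum in $[-1,1]$ is defined by $\int\frac{d\nu(x)}{x-z}=\langle 0|(A-z)^{-1}|0\rangle$. *)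

theory Defs
  imports "HOL-Probability.Probability_Measure" "HOL-Computational_Algebra.Polynomial"
begin

typedef ell2 = "{x :: nat \<Rightarrow> complex. summable (\<lambda>k. (cmod (x k))\<^sup>2)}"
  morphisms coord Abs_ell2
  by (rule exI[of _ "\<lambda>_. 0"]) simp

setup_lifting type_definition_ell2

lemma summable_coord: "summable (\<lambda>k. (cmod (coord x k))\<^sup>2)"
  using coord[of x] by simp

lemma ell2_eqI: "(\<And>k. coord x k = coord y k) \<Longrightarrow> x = y"
  by (metis coord_inject ext)

lemma summable_norm_sq_add:
  assumes "summable (\<lambda>k. (cmod (x k))\<^sup>2)" "summable (\<lambda>k. (cmod (y k))\<^sup>2)"
  shows "summable (\<lambda>k. (cmod (x k + y k))\<^sup>2)"
proof (rule summable_comparison_test')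
  show "summable (\<lambda>k. 2 * (cmod (x k))\<^sup>2 + 2 * (cmod (y k))\<^sup>2)"
    using assms by (intro summable_add summable_mult)
  fix k :: nat assume "k \<ge> 0"
  have "(cmod (x k + y k))\<^sup>2 \<le> (cmod (x k) + cmod (y k))\<^sup>2"
    by (intro power_mono norm_triangle_ineq) auto
  also have "\<dots> \<le> 2 * (cmod (x k))\<^sup>2 + 2 * (cmod (y k))\<^sup>2"
    using sum_squares_bound[of "cmod (x k)" "cmod (y k)"] by (simp add: power2_sum)
  finally show "norm ((cmod (x k + y k))\<^sup>2) \<le> 2 * (cmod (x k))\<^sup>2 + 2 * (cmod (y k))\<^sup>2"
    by simp
qed

lemma summable_norm_sq_scale:
  assumes "summable (\<lambda>k. (cmod (x k))\<^sup>2)"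
  shows "summable (\<lambda>k. (cmod (c * x k))\<^sup>2)"
  using summable_mult[OF assms, of "(cmod c)\<^sup>2"] by (simp add: norm_mult power_mult_distrib)

lift_definition ket :: "nat \<Rightarrow> ell2" is "\<lambda>j k. if k = j then 1 else 0"
proof -
  fix j :: nat
  show "summable (\<lambda>k. (cmod (if k = j then 1 else 0))\<^sup>2)"
    by (rule summable_finite[of "{j}"]) auto
qed

lift_definition scaleC :: "complex \<Rightarrow> ell2 \<Rightarrow> ell2" (infixr "*\<^sub>C" 75) is "\<lambda>c x k. c * x k"
  by (rule summable_norm_sq_scale)

text \<open>The inner product is conjugate linear in the first argument, so that
  \<open>cinner (ket j) (A (ket k))\<close> is the matrix entry of \<open>A\<close> in row \<open>j\<close>, column \<open>k\<close>.\<close>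

definition cinner :: "ell2 \<Rightarrow> ell2 \<Rightarrow> complex" where
  "cinner x y = (\<Sum>k. cnj (coord x k) * coord y k)"

lemma summable_cinner: "summable (\<lambda>k. cnj (coord x k) * coord y k)"
proof (rule summable_comparison_test')
  show "summable (\<lambda>k. (cmod (coord x k))\<^sup>2 + (cmod (coord y k))\<^sup>2)"
    by (intro summable_add summable_coord)
  fix k :: nat assume "k \<ge> 0"
  show "norm (cnj (coord x k) * coord y k) \<le> (cmod (coord x k))\<^sup>2 + (cmod (coord y k))\<^sup>2"
  proof -
    have "2 * (cmod (coord x k) * cmod (coord y k)) \<le> (cmod (coord x k))\<^sup>2 + (cmod (coord y k))\<^sup>2"
      using sum_squares_bound[of "cmod (coord x k)" "cmod (coord y k)"] by simp
    moreover have "0 \<le> cmod (coord x k) * cmod (coord y k)" by simp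
    ultimately show ?thesis unfolding norm_mult complex_mod_cnj by linarith
  qed
qed

text \<open>The norm and topology are those of the underlying real Hilbert space, whose inner
  product is the real part of \<^const>\<open>cinner\<close>.\<close>

instantiation ell2 :: real_inner
begin

lift_definition zero_ell2 :: ell2 is "\<lambda>_. 0" by simp
lift_definition plus_ell2 :: "ell2 \<Rightarrow> ell2 \<Rightarrow> ell2" is "\<lambda>x y k. x k + y k"
  by (rule summable_norm_sq_add)
lift_definition uminus_ell2 :: "ell2 \<Rightarrow> ell2" is "\<lambda>x k. - x k" by simp
lift_definition minus_ell2 :: "ell2 \<Rightarrow> ell2 \<Rightarrow> ell2" is "\<lambda>x y k. x k - y k"
proof -
  fix x y :: "nat \<Rightarrow> complex"
  assume "summable (\<lambda>k. (cmod (x k))\<^sup>2)" "summable (\<lambda>k. (cmod (y k))\<^sup>2)"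
  then show "summable (\<lambda>k. (cmod (x k - y k))\<^sup>2)"
    using summable_norm_sq_add[of x "\<lambda>k. - y k"] by simp
qed
definition scaleR_ell2 :: "real \<Rightarrow> ell2 \<Rightarrow> ell2" where
  "scaleR_ell2 r x = complex_of_real r *\<^sub>C x"
definition inner_ell2 :: "ell2 \<Rightarrow> ell2 \<Rightarrow> real" where
  "inner_ell2 x y = Re (cinner x y)"
definition norm_ell2 :: "ell2 \<Rightarrow> real" where
  "norm_ell2 x = sqrt (inner x x)"
definition dist_ell2 :: "ell2 \<Rightarrow> ell2 \<Rightarrow> real" where
  "dist_ell2 x y = norm (x - y)"
definition sgn_ell2 :: "ell2 \<Rightarrow> ell2" where
  "sgn_ell2 x = inverse (norm x) *\<^sub>R x"
definition uniformity_ell2 :: "(ell2 \<times> ell2) filter" where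
  "uniformity_ell2 = (INF e\<in>{0<..}. principal {(x, y). dist x y < e})"
definition open_ell2 :: "ell2 set \<Rightarrow> bool" where
  "open_ell2 S = (\<forall>x\<in>S. \<forall>\<^sub>F (x', y) in uniformity. x' = x \<longrightarrow> y \<in> S)"

lemmas coord_simps =
  zero_ell2.rep_eq plus_ell2.rep_eq uminus_ell2.rep_eq minus_ell2.rep_eq scaleC.rep_eq

lemma coord_scaleR: "coord (r *\<^sub>R x) k = complex_of_real r * coord x k"
  by (simp add: scaleR_ell2_def scaleC.rep_eq)

lemma inner_self_sums: "inner x x = (\<Sum>k. (cmod (coord x k))\<^sup>2)" for x :: ell2
proof -
  have "inner x x = (\<Sum>k. Re (cnj (coord x k) * coord x k))"
    unfolding inner_ell2_def cinner_def by (rule Re_suminf[OF summable_cinner])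
  also have "(\<lambda>k. Re (cnj (coord x k) * coord x k)) = (\<lambda>k. (cmod (coord x k))\<^sup>2)"
    by (auto simp: cmod_power2) (simp add: power2_eq_square)
  finally show ?thesis .
qed

instance
proof
  fix x y z :: ell2 and r s :: real and S :: "ell2 set"
  show "x + y + z = x + (y + z)" "x + y = y + x" "0 + x = x" "- x + x = 0" "x - y = x + - y"
    by (auto intro!: ell2_eqI simp: coord_simps)
  show "r *\<^sub>R (x + y) = r *\<^sub>R x + r *\<^sub>R y" "(r + s) *\<^sub>R x = r *\<^sub>R x + s *\<^sub>R x"
    "r *\<^sub>R s *\<^sub>R x = (r * s) *\<^sub>R x" "1 *\<^sub>R x = x"
    by (auto intro!: ell2_eqI simp: coord_simps coord_scaleR algebra_simps)
  show "dist x y = norm (x - y)" "sgn x = inverse (norm x) *\<^sub>R x" "norm x = sqrt (inner x x)"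
    "uniformity = (INF e\<in>{0<..}. principal {(x, y::ell2). dist x y < e})"
    "open S = (\<forall>x\<in>S. \<forall>\<^sub>F (x', y) in uniformity. x' = x \<longrightarrow> y \<in> S)"
    by (fact dist_ell2_def sgn_ell2_def norm_ell2_def uniformity_ell2_def open_ell2_def)+
  have "cinner y x = cnj (cinner x y)"
    using sums_cnj[THEN iffD2, OF summable_sums[OF summable_cinner[of x y]]]
    unfolding cinner_def by (intro sums_unique[symmetric]) (simp add: mult.commute)
  then show "inner x y = inner y x" by (simp add: inner_ell2_def)
  show "inner (x + y) z = inner x z + inner y z"
    unfolding inner_ell2_def cinner_def
    by (simp add: coord_simps ring_distribs suminf_add[symmetric] summable_cinner)
  show "inner (r *\<^sub>R x) y = r * inner x y"
    unfolding inner_ell2_def cinner_def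
    using suminf_mult[OF summable_cinner, of "complex_of_real r" x y]
    by (simp add: coord_scaleR mult.assoc)
  show "0 \<le> inner x x"
    unfolding inner_self_sums by (intro suminf_nonneg summable_coord) auto
  show "(inner x x = 0) = (x = 0)"
    unfolding inner_self_sums using suminf_eq_zero_iff[OF summable_coord, of x]
    by (auto intro!: ell2_eqI simp: coord_simps)
qed

end

definition bounded_clinear :: "(ell2 \<Rightarrow> ell2) \<Rightarrow> bool" where
  "bounded_clinear A \<longleftrightarrow> bounded_linear A \<and> (\<forall>c x. A (c *\<^sub>C x) = c *\<^sub>C A x)"

definition cadjoint :: "(ell2 \<Rightarrow> ell2) \<Rightarrow> ell2 \<Rightarrow> ell2" where
  "cadjoint A = (THE B. \<forall>x y. cinner (B x) y = cinner x (A y))"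

text \<open>Self-adjoint operators with spectrum in \<open>[-1,1]\<close> are bounded, so only bounded,
  everywhere defined operators are considered.\<close>

definition selfadjoint :: "(ell2 \<Rightarrow> ell2) \<Rightarrow> bool" where
  "selfadjoint A \<longleftrightarrow> bounded_clinear A \<and> (\<forall>x y. cinner (A x) y = cinner x (A y))"

definition op_spectrum :: "(ell2 \<Rightarrow> ell2) \<Rightarrow> complex set" where
  "op_spectrum A = {z. \<not> (\<exists>R. bounded_clinear R \<and>
     (\<forall>x. R (A x - z *\<^sub>C x) = x) \<and> (\<forall>x. A (R x) - z *\<^sub>C R x = x))}"

definition poly_op :: "complex poly \<Rightarrow> (ell2 \<Rightarrow> ell2) \<Rightarrow> ell2 \<Rightarrow> ell2" where
  "poly_op p A x = (\<Sum>i\<le>degree p. coeff p i *\<^sub>C (A ^^ i) x)"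

text \<open>The vectors \<open>p(A) x\<close> are exactly the linear combinations of \<open>x, A x, A\<^sup>2 x, \<dots>\<close>.\<close>

definition cyclic_vector :: "(ell2 \<Rightarrow> ell2) \<Rightarrow> ell2 \<Rightarrow> bool" where
  "cyclic_vector A x \<longleftrightarrow> closure (range (\<lambda>p. poly_op p A x)) = UNIV"

definition admissible :: "(ell2 \<Rightarrow> ell2) \<Rightarrow> bool" where
  "admissible A \<longleftrightarrow> selfadjoint A \<and> cyclic_vector A (ket 0) \<and>
     op_spectrum A \<subseteq> complex_of_real ` {-1..1}"

definition weakly_converges :: "(nat \<Rightarrow> ell2 \<Rightarrow> ell2) \<Rightarrow> (ell2 \<Rightarrow> ell2) \<Rightarrow> bool" where
  "weakly_converges A B \<longleftrightarrow>
     (\<forall>x y. (\<lambda>n. cinner x (A n y)) \<longlonglongrightarrow> cinner x (B y))"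

definition is_spectral_measure :: "(ell2 \<Rightarrow> ell2) \<Rightarrow> real measure \<Rightarrow> bool" where
  "is_spectral_measure A \<nu> \<longleftrightarrow> sets \<nu> = sets borel \<and> finite_measure \<nu> \<and>
     (\<forall>z. z \<notin> op_spectrum A \<longrightarrow>
        integrable \<nu> (\<lambda>x. 1 / (complex_of_real x - z)) \<and>
        (\<integral>x. 1 / (complex_of_real x - z) \<partial>\<nu>)
          = cinner (ket 0) (inv (\<lambda>x. A x - z *\<^sub>C x) (ket 0)))"

definition is_Phi :: "real \<Rightarrow> (ell2 \<Rightarrow> ell2) \<Rightarrow> (ell2 \<Rightarrow> ell2) \<Rightarrow> bool" where
  "is_Phi \<tau> A \<Phi> \<longleftrightarrow> bounded_clinear \<Phi> \<and>
     (\<forall>j k. k < j \<longrightarrow> cinner (ket j) (\<Phi> (ket k)) = 0) \<and>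
     (\<forall>k. \<exists>r>0. cinner (ket k) (\<Phi> (ket k)) = complex_of_real r) \<and>
     (\<forall>x. cadjoint \<Phi> (\<Phi> x) = A (A x) + (4 * \<tau> * (\<tau> - 1)) *\<^sub>R x)"

definition Phi :: "real \<Rightarrow> (ell2 \<Rightarrow> ell2) \<Rightarrow> ell2 \<Rightarrow> ell2" where
  "Phi \<tau> A = (THE \<Phi>. is_Phi \<tau> A \<Phi>)"

lift_definition even_part :: "ell2 \<Rightarrow> ell2" is "\<lambda>x k. x (2 * k)"
proof -
  fix x :: "nat \<Rightarrow> complex" assume "summable (\<lambda>k. (cmod (x k))\<^sup>2)"
  from summable_reindex[OF this, of "\<lambda>k. 2 * k"]
  show "summable (\<lambda>k. (cmod (x (2 * k)))\<^sup>2)" by (auto simp: inj_def o_def)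
qed

lift_definition odd_part :: "ell2 \<Rightarrow> ell2" is "\<lambda>x k. x (2 * k + 1)"
proof -
  fix x :: "nat \<Rightarrow> complex" assume "summable (\<lambda>k. (cmod (x k))\<^sup>2)"
  from summable_reindex[OF this, of "\<lambda>k. 2 * k + 1"]
  show "summable (\<lambda>k. (cmod (x (2 * k + 1)))\<^sup>2)" by (auto simp: inj_def o_def)
qed

definition U_op :: "ell2 \<Rightarrow> ell2 \<times> ell2" where
  "U_op x = (even_part x, odd_part x)"

lemma sums_interleave:
  fixes f g :: "nat \<Rightarrow> complex"
  assumes "f sums a" "g sums b"
  shows "(\<lambda>k. if even k then f (k div 2) else g (k div 2)) sums (a + b)"
proof -
  have eq: "P (if even k then f (k div 2) else g (k div 2)) =
      (if even k then P (f (k div 2)) else P (g ((k - 1) div 2)))" for k and P :: "complex \<Rightarrow> real"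
    by (auto elim!: oddE)
  show ?thesis
    unfolding sums_complex_iff eq
    using sums_if[OF sums_Re[OF assms(2)] sums_Re[OF assms(1)]]
      sums_if[OF sums_Im[OF assms(2)] sums_Im[OF assms(1)]]
    by (simp add: add.commute)
qed

text \<open>Adjoint and inverse of the unitary \<open>U_op\<close>; see \<open>U_adj_adjoint\<close> and
  \<open>U_adj_inverse\<close>.\<close>

lift_definition U_adj :: "ell2 \<times> ell2 \<Rightarrow> ell2" is
  "\<lambda>(y, z) k. if even k then y (k div 2) else z (k div 2)"
proof -
  fix p :: "(nat \<Rightarrow> complex) \<times> (nat \<Rightarrow> complex)"
  assume p: "pred_prod (\<lambda>x. summable (\<lambda>k. (cmod (x k))\<^sup>2)) (\<lambda>x. summable (\<lambda>k. (cmod (x k))\<^sup>2)) p"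
  obtain y z where [simp]: "p = (y, z)" by (cases p)
  have "summable (\<lambda>k. (cmod (y k))\<^sup>2)" "summable (\<lambda>k. (cmod (z k))\<^sup>2)"
    using p by auto
  from sums_if[OF this(2)[THEN summable_sums] this(1)[THEN summable_sums]]
  have "summable (\<lambda>k. if even k then (cmod (y (k div 2)))\<^sup>2 else (cmod (z ((k - 1) div 2)))\<^sup>2)"
    by (rule sums_summable)
  also have "(\<lambda>k. if even k then (cmod (y (k div 2)))\<^sup>2 else (cmod (z ((k - 1) div 2)))\<^sup>2) =
      (\<lambda>k. (cmod (if even k then y (k div 2) else z (k div 2)))\<^sup>2)"
    by (rule ext) (auto elim!: oddE)
  finally show "summable (\<lambda>k. (cmod ((case p of (y, z) \<Rightarrow>
      \<lambda>k. if even k then y (k div 2) else z (k div 2)) k))\<^sup>2)"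
    by simp
qed

lemma coord_U_adj:
  "coord (U_adj (y, z)) k = (if even k then coord y (k div 2) else coord z (k div 2))"
  by (simp add: U_adj.rep_eq)

lemma U_op_ket: "U_op (ket (2 * k)) = (ket k, 0)" "U_op (ket (2 * k + 1)) = (0, ket k)"
proof -
  have "even_part (ket (2 * k)) = ket k" "odd_part (ket (2 * k)) = 0"
    "even_part (ket (2 * k + 1)) = 0" "odd_part (ket (2 * k + 1)) = ket k"
    by (rule ell2_eqI; simp add: even_part.rep_eq odd_part.rep_eq ket.rep_eq coord_simps;
        presburger)+
  then show "U_op (ket (2 * k)) = (ket k, 0)" "U_op (ket (2 * k + 1)) = (0, ket k)"
    by (simp_all add: U_op_def)
qed

lemma U_adj_inverse: "U_adj (U_op x) = x" "U_op (U_adj p) = p"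
proof -
  show "U_adj (U_op x) = x"
    by (rule ell2_eqI)
      (auto simp: U_op_def coord_U_adj even_part.rep_eq odd_part.rep_eq elim!: evenE oddE)
  obtain y z where [simp]: "p = (y, z)" by (cases p)
  have "even_part (U_adj p) = y" "odd_part (U_adj p) = z"
    by (rule ell2_eqI; simp add: coord_U_adj even_part.rep_eq odd_part.rep_eq)+
  then show "U_op (U_adj p) = p" by (simp add: U_op_def)
qed

lemma U_adj_adjoint:
  "cinner (U_adj (y, z)) x = cinner y (fst (U_op x)) + cinner z (snd (U_op x))"
proof -
  have "(\<lambda>k. if even k then cnj (coord y (k div 2)) * coord (even_part x) (k div 2)
       else cnj (coord z (k div 2)) * coord (odd_part x) (k div 2))
     sums (cinner y (even_part x) + cinner z (odd_part x))"
    unfolding cinner_def by (intro sums_interleave summable_sums summable_cinner)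
  also have "(\<lambda>k. if even k then cnj (coord y (k div 2)) * coord (even_part x) (k div 2)
       else cnj (coord z (k div 2)) * coord (odd_part x) (k div 2)) =
     (\<lambda>k. cnj (coord (U_adj (y, z)) k) * coord x k)"
    by (auto simp: coord_U_adj even_part.rep_eq odd_part.rep_eq elim!: evenE oddE)
  finally show ?thesis
    unfolding cinner_def[of "U_adj (y, z)"] U_op_def by (simp add: sums_iff)
qed

definition A_star :: "real \<Rightarrow> (ell2 \<Rightarrow> ell2) \<Rightarrow> ell2 \<Rightarrow> ell2" where
  "A_star \<tau> A = Phi \<tau> A \<circ> A \<circ> inv (Phi \<tau> A)"

definition pi_star :: "real \<Rightarrow> (ell2 \<Rightarrow> ell2) \<Rightarrow> ell2 \<Rightarrow> ell2" where
  "pi_star \<tau> A x = (1 / (2 * \<tau>)) *\<^sub>R U_adj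
     (case U_op x of (y, z) \<Rightarrow>
        (A y + cadjoint (Phi \<tau> A) z, Phi \<tau> A y + A_star \<tau> A z))"

definition ratmap :: "real \<Rightarrow> real \<Rightarrow> real" where
  "ratmap \<tau> v = \<tau> * v - (\<tau> - 1) / v"

abbreviation E0 :: "real set" where
  "E0 \<equiv> {-1..1}"

text \<open>The pole \<open>v = 0\<close> is excluded explicitly, since \<open>ratmap \<tau> 0 = 0\<close> by the
  convention \<open>x / 0 = 0\<close>.\<close>

definition E1 :: "real \<Rightarrow> real set" where
  "E1 \<tau> = {v. v \<noteq> 0 \<and> ratmap \<tau> v \<in> E0}"

definition ruelle :: "real \<Rightarrow> (real \<Rightarrow> real) \<Rightarrow> real \<Rightarrow> real" where
  "ruelle \<tau> f x = (1 / 2) * (\<Sum>v | v \<noteq> 0 \<and> ratmap \<tau> v = x. f v)"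

lemma E1_eq:
  assumes "\<tau> > 1"
  shows "E1 \<tau> = {-1 .. -1 + 1 / \<tau>} \<union> {1 - 1 / \<tau> .. 1}"
proof -
  have pos: "v \<in> E1 \<tau> \<longleftrightarrow> v \<in> {1 - 1 / \<tau> .. 1}" if "v > 0" for v
  proof -
    have 1: "ratmap \<tau> v \<le> 1 \<longleftrightarrow> (v - 1) * (\<tau> * v + (\<tau> - 1)) \<le> 0"
      using that by (simp add: ratmap_def field_simps power2_eq_square)
    have 2: "-1 \<le> ratmap \<tau> v \<longleftrightarrow> 0 \<le> (v + 1) * (\<tau> * v - (\<tau> - 1))"
      using that by (simp add: ratmap_def field_simps power2_eq_square)
    have "\<tau> * v + (\<tau> - 1) > 0" "v + 1 > 0" using that assms by (auto intro: add_pos_pos)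
    then have "ratmap \<tau> v \<le> 1 \<longleftrightarrow> v \<le> 1" "-1 \<le> ratmap \<tau> v \<longleftrightarrow> \<tau> - 1 \<le> \<tau> * v"
      unfolding 1 2 by (auto simp: mult_le_0_iff zero_le_mult_iff)
    then show ?thesis using that assms by (auto simp: E1_def field_simps)
  qed
  have odd: "- v \<in> E1 \<tau> \<longleftrightarrow> v \<in> E1 \<tau>" for v
    by (auto simp: E1_def ratmap_def)
  have gap: "1 - 1 / \<tau> > 0" using assms by simp
  show ?thesis
  proof (intro set_eqI)
    fix v :: real
    consider "v > 0" | "v = 0" | "v < 0" by linarith
    then show "v \<in> E1 \<tau> \<longleftrightarrow> v \<in> {-1 .. -1 + 1 / \<tau>} \<union> {1 - 1 / \<tau> .. 1}"
    proof cases
      case 1 then show ?thesis using pos[of v] gap by auto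
    next
      case 2 then show ?thesis using gap by (auto simp: E1_def)
    next
      case 3 then show ?thesis using pos[of "- v"] odd[of v] gap by auto
    qed
  qed
qed

text \<open>\<open>\<L>\<^sup>*\<mu> = \<mu>\<close> for a probability measure: as a functional on \<open>C(E\<^sub>1)\<close>, \<open>\<mu>\<close> is
  concentrated on \<open>E\<^sub>1\<close> and satisfies \<open>\<integral> f d\<mu> = \<integral> \<L> f d\<mu>\<close>.\<close>

definition is_eigen_measure :: "real \<Rightarrow> real measure \<Rightarrow> bool" where
  "is_eigen_measure \<tau> \<mu> \<longleftrightarrow> sets \<mu> = sets borel \<and> prob_space \<mu> \<and> (AE v in \<mu>. v \<in> E1 \<tau>) \<and>
     (\<forall>f. continuous_on (E1 \<tau>) f \<longrightarrow>
        set_lebesgue_integral \<mu> (E1 \<tau>) f = set_lebesgue_integral \<mu> E0 (ruelle \<tau> f))"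

definition square_integrable :: "real measure \<Rightarrow> (real \<Rightarrow> complex) \<Rightarrow> bool" where
  "square_integrable \<mu> f \<longleftrightarrow> f \<in> borel_measurable \<mu> \<and> integrable \<mu> (\<lambda>v. (cmod (f v))\<^sup>2)"

definition L2_inner :: "real measure \<Rightarrow> (real \<Rightarrow> complex) \<Rightarrow> (real \<Rightarrow> complex) \<Rightarrow> complex" where
  "L2_inner \<mu> f g = (\<integral>v. cnj (f v) * g v \<partial>\<mu>)"

definition orthonormal_basis :: "real measure \<Rightarrow> (nat \<Rightarrow> real \<Rightarrow> complex) \<Rightarrow> bool" where
  "orthonormal_basis \<mu> e \<longleftrightarrow>
     (\<forall>k. square_integrable \<mu> (e k)) \<and>
     (\<forall>j k. L2_inner \<mu> (e j) (e k) = (if j = k then 1 else 0)) \<and>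
     (\<forall>f. square_integrable \<mu> f \<longrightarrow> (\<forall>\<epsilon>>0. \<exists>N a.
        (\<integral>v. (cmod (f v - (\<Sum>k<N. a k * e k v)))\<^sup>2 \<partial>\<mu>) < \<epsilon>))"

text \<open>The family \<open>e\<^sub>k\<close> built from coefficients \<open>c k j = c\<^sup>k\<^sub>j\<close>; see the recursion
  equations in \<open>e_fun_rec\<close>.\<close>

function e_fun :: "real \<Rightarrow> (nat \<Rightarrow> nat \<Rightarrow> complex) \<Rightarrow> nat \<Rightarrow> real \<Rightarrow> complex" where
  "e_fun \<tau> c 0 v = 1"
| "e_fun \<tau> c (Suc n) v =
     (if even (Suc n) then e_fun \<tau> c (Suc n div 2) (ratmap \<tau> v)
      else complex_of_real (\<tau> * v + (\<tau> - 1) / v) *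
        (\<Sum>j\<le>Suc n div 2. c (Suc n div 2) j * e_fun \<tau> c j (ratmap \<tau> v)))"
  by pat_completeness auto
termination
  by (relation "Wellfounded.measure (\<lambda>(\<tau>, c, n, v). n)") (auto elim!: oddE)

lemma e_fun_rec:
  "e_fun \<tau> c 0 v = 1"
  "e_fun \<tau> c (2 * k) v = e_fun \<tau> c k (ratmap \<tau> v)"
  "e_fun \<tau> c (2 * k + 1) v = complex_of_real (\<tau> * v + (\<tau> - 1) / v) *
     (\<Sum>j=0..k. c k j * e_fun \<tau> c j (ratmap \<tau> v))"
proof -
  show "e_fun \<tau> c 0 v = 1" by simp
  show "e_fun \<tau> c (2 * k) v = e_fun \<tau> c k (ratmap \<tau> v)"
  proof (cases k)
    case (Suc m)
    then have "2 * k = Suc (2 * m + 1)" by simp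
    moreover have "Suc (2 * m + 1) div 2 = k" using Suc by simp
    ultimately show ?thesis by (simp only: e_fun.simps) simp
  qed simp
  show "e_fun \<tau> c (2 * k + 1) v = complex_of_real (\<tau> * v + (\<tau> - 1) / v) *
     (\<Sum>j=0..k. c k j * e_fun \<tau> c j (ratmap \<tau> v))"
  proof -
    have "2 * k + 1 = Suc (2 * k)" "Suc (2 * k) div 2 = k" by auto
    then show ?thesis by (simp only: e_fun.simps atLeast0AtMost) simp
  qed
qed

text \<open>The entries \<open>c\<^sup>k\<^sub>j\<close> with \<open>j > k\<close>, which do not enter the recursion, are set to \<open>0\<close>.\<close>

definition orthogonality_coeffs ::
    "real \<Rightarrow> real measure \<Rightarrow> (nat \<Rightarrow> nat \<Rightarrow> complex) \<Rightarrow> bool" where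
  "orthogonality_coeffs \<tau> \<mu> c \<longleftrightarrow>
     (\<forall>k j. k < j \<longrightarrow> c k j = 0) \<and>
     (\<forall>k. \<exists>r>0. c k k = complex_of_real r) \<and>
     (\<forall>k l. l \<le> 2 * k + 1 \<longrightarrow>
        L2_inner \<mu> (e_fun \<tau> c (2 * k + 1)) (e_fun \<tau> c l) = (if l = 2 * k + 1 then 1 else 0))"

text \<open>\<open>f = p / q\<close> is a rational function without poles in the spectrum of \<open>A\<close>, and
  \<open>y = f(A) x = p(A) q(A)\<^sup>-\<^sup>1 x\<close>. The fraction need not be in lowest terms; the zeros of
  \<open>q\<close> absorb the points where a division by zero occurs in \<open>f\<close>.\<close>

definition rational_calculus ::
    "(ell2 \<Rightarrow> ell2) \<Rightarrow> (real \<Rightarrow> complex) \<Rightarrow> ell2 \<Rightarrow> ell2 \<Rightarrow> bool" where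
  "rational_calculus A f x y \<longleftrightarrow> (\<exists>p q.
     (\<forall>z\<in>op_spectrum A. poly q z \<noteq> 0) \<and>
     (\<forall>v. poly q (complex_of_real v) \<noteq> 0 \<longrightarrow>
        f v = poly p (complex_of_real v) / poly q (complex_of_real v)) \<and>
     bij (poly_op q A) \<and> poly_op p A (inv (poly_op q A) x) = y)"

end

theory Submission
  imports Defs "HOL-Probability.Probability"
begin

text \<open>
  Write \<open>P = A\<^sup>2 + 4\<tau>(\<tau>-1)\<close> and let \<open>D\<close> be the direct sum of \<open>A\<close> and \<open>A\<^sub>*\<close>, transported by
  \<open>U\<close>. Then \<open>T = \<pi>\<^sup>*(A)\<close> satisfies \<open>\<tau>T\<^sup>2 = DT + (\<tau>-1)\<close>, that is \<open>\<pi>(T) = D\<close>. Hence \<open>f(T)\<close>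
  restricted to the even subspace is given by polynomials in \<open>A\<close> and by \<open>\<Phi>\<close>, and on moments
  with respect to \<open>|0\<rangle>\<close> the iteration acts as the Ruelle operator on polynomials. The latter is triangular with
  diagonal \<open>1, 1/(2\<tau>), 1/(2\<tau>\<^sup>2), \<dots>\<close>, so that all moments converge to those of \<open>\<mu>\<close>. Each
  \<open>2N \<times> 2N\<close> block of \<open>f(A\<^bsub>n+1\<^esub>)\<close> is a continuous function of \<open>N \<times> N\<close> blocks of polynomials
  in \<open>A\<^sub>n\<close>, which gives convergence of all matrix entries; the vectors \<open>f(A\<^sub>n)|0\<rangle>\<close> satisfy a
  contractive recursion, which gives strong convergence. The strong limit \<open>B\<close> is a fixed point of
  \<open>\<pi>\<^sup>*\<close> with moments \<open>\<langle>0|f(B)|0\<rangle> = \<integral>f d\<mu>\<close>. So \<open>p \<mapsto> p(B)|0\<rangle>\<close> extends to an isometry of \<open>C(K)\<close>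
  with the norm of \<open>L\<^sup>2(\<mu>)\<close>, where \<open>K\<close> is the Julia set, and \<open>\<pi>(B) = D\<close> shows that it sends \<open>e\<^sub>k\<close>
  to \<open>|k\<rangle>\<close>. The measure \<open>\<mu>\<close> itself is the law of a random infinite composition of the two inverse
  branches of \<open>\<pi>\<close>, which are contractions with factor \<open>1/\<tau>\<close>.
\<close>

section \<open>The Hilbert space\<close>

text \<open>Solving \<pi>(v) = x means \<tau> v^2 - x v - (\<tau> - 1) = 0, with discriminant x^2 +
  4\<tau>(\<tau> - 1). Its square root r = 2\<tau> v - x = \<tau> v + (\<tau> - 1)/v is the factor
  in front of e_{2k+1}. It changes sign between the two preimages of x, so g(\<pi>(v)) and r
  h(\<pi>(v)) are orthogonal for the eigen-measure, and the squared norm of r h(\<pi>(v)) is that of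
  h in the form given by P. Hence the triangular factorisation of P is Gram-Schmidt on the odd half,
  and the columns of the inverse of \<Phi> are the coefficients of e_{2k+1}. Two obstacles shape the
  proof. Blocks of \<Phi> are nonlinear functions of blocks of A^2, which blocks of A do not
  determine, so convergence has to be carried for all polynomials in A_n at once. And weak
  convergence does not pass to products such as A_n^2 or \<Phi>_n A_n, so strong convergence must
  come before the fixed-point equation. The functional calculus of B is then read off its
  moments.\<close>

lemma coord_add [simp]: "coord (x + y) k = coord x k + coord y k"
  and coord_diff [simp]: "coord (x - y) k = coord x k - coord y k"
  and coord_zero [simp]: "coord 0 k = 0"
  and coord_scaleC [simp]: "coord (a *\<^sub>C x) k = a * coord x k"
  by (simp_all add: coord_simps)

declare coord_scaleR [simp]

lemma coord_sum [simp]: "coord (\<Sum>i\<in>S. f i) k = (\<Sum>i\<in>S. coord (f i) k)"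
  by (induction S rule: infinite_finite_induct) auto

lemma coord_ket: "coord (ket j) k = (if k = j then 1 else 0)"
  by (simp add: ket.rep_eq)

lemma scaleR_eq_scaleC: "r *\<^sub>R x = complex_of_real r *\<^sub>C x" for x :: ell2
  by (simp add: scaleR_ell2_def)

lemma norm_ell2_sums: "(\<lambda>k. (cmod (coord x k))\<^sup>2) sums (norm x)\<^sup>2"
  using summable_sums[OF summable_coord[of x]] inner_self_sums[of x] by (simp add: power2_norm_eq_inner)

lemma cinner_commute: "cinner y x = cnj (cinner x y)"
  using sums_cnj[THEN iffD2, OF summable_sums[OF summable_cinner[of x y]]]
  unfolding cinner_def by (intro sums_unique[symmetric]) (simp add: mult.commute)

lemma of_real_cmod_square: "complex_of_real ((cmod a)\<^sup>2) = cnj a * a"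
  by (subst complex_norm_square) (rule mult.commute)

lemma cinner_self: "cinner x x = complex_of_real ((norm x)\<^sup>2)"
proof -
  have "(\<lambda>k. complex_of_real ((cmod (coord x k))\<^sup>2)) sums complex_of_real ((norm x)\<^sup>2)"
    using norm_ell2_sums[of x] by (rule sums_of_real)
  then have "(\<lambda>k. cnj (coord x k) * coord x k) sums complex_of_real ((norm x)\<^sup>2)"
    unfolding of_real_cmod_square .
  then show ?thesis unfolding cinner_def by (rule sums_unique[symmetric])
qed

lemma cinner_add_right: "cinner x (y + z) = cinner x y + cinner x z"
  unfolding cinner_def by (simp add: ring_distribs suminf_add[symmetric] summable_cinner)

lemma cinner_scaleC_right [simp]: "cinner x (a *\<^sub>C y) = a * cinner x y"
  unfolding cinner_def using suminf_mult[OF summable_cinner, of a x y] by (simp add: algebra_simps)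

lemma cinner_scaleC_left [simp]: "cinner (a *\<^sub>C x) y = cnj a * cinner x y"
  by (subst (1 2) cinner_commute) simp

lemma cinner_add_left: "cinner (x + y) z = cinner x z + cinner y z"
  by (subst (1 2 3) cinner_commute) (simp add: cinner_add_right)

lemma norm_scaleC [simp]: "norm (a *\<^sub>C x) = cmod a * norm x"
proof -
  have "complex_of_real ((norm (a *\<^sub>C x))\<^sup>2) = complex_of_real ((cmod a * norm x)\<^sup>2)"
    unfolding cinner_self[symmetric] power_mult_distrib of_real_mult of_real_cmod_square by simp
  then have "(norm (a *\<^sub>C x))\<^sup>2 = (cmod a * norm x)\<^sup>2" by (simp only: of_real_eq_iff)
  then show ?thesis by simp
qed

text \<open>Reduces to the real inequality: rescaling \<open>x\<close> by the complex number
  \<open>cinner x y\<close> makes its pairing with \<open>y\<close> the real number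
  |<x,y>|^2.\<close>

lemma cinner_Cauchy_Schwarz: "cmod (cinner x y) \<le> norm x * norm y"
proof (cases "cinner x y = 0")
  case False
  have "(cmod (cinner x y))\<^sup>2 = inner (cinner x y *\<^sub>C x) y"
    by (simp add: inner_ell2_def cmod_power2) (simp add: power2_eq_square)
  also have "\<dots> \<le> norm (cinner x y *\<^sub>C x) * norm y" by (rule norm_cauchy_schwarz)
  finally have "cmod (cinner x y) * cmod (cinner x y) \<le> cmod (cinner x y) * (norm x * norm y)"
    by (simp add: power2_eq_square mult.assoc)
  then show ?thesis using False by simp
qed auto

interpretation cinner: bounded_bilinear cinner
proof
  show "\<exists>K. \<forall>a b. cmod (cinner a b) \<le> norm a * norm b * K"
    using cinner_Cauchy_Schwarz by (intro exI[of _ 1]) simp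
qed (simp_all add: cinner_add_left cinner_add_right scaleR_eq_scaleC scaleR_conv_of_real)

interpretation scaleC: bounded_bilinear scaleC
proof
  show "\<exists>K. \<forall>a b. norm (a *\<^sub>C b) \<le> cmod a * norm b * K"
    by (intro exI[of _ 1]) simp
qed (auto intro!: ell2_eqI simp: algebra_simps scaleR_conv_of_real)

lemma scaleC_scaleC [simp]: "a *\<^sub>C b *\<^sub>C x = (a * b) *\<^sub>C x"
  by (rule ell2_eqI) simp

lemma scaleC_one [simp]: "1 *\<^sub>C x = x"
  by (rule ell2_eqI) simp

lemma cinner_scaleR_left [simp]: "cinner (r *\<^sub>R x) y = complex_of_real r * cinner x y"
  and cinner_scaleR_right [simp]: "cinner x (r *\<^sub>R y) = complex_of_real r * cinner x y"
  by (simp_all add: scaleR_eq_scaleC)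

lemma Re_cinner_self: "Re (cinner x x) = (norm x)\<^sup>2"
  by (simp add: cinner_self)

lemma cinner_ket_left [simp]: "cinner (ket k) x = coord x k"
proof -
  have "(\<lambda>j. cnj (coord (ket k) j) * coord x j) = (\<lambda>j. if j = k then coord x k else 0)"
    by (auto simp: coord_ket)
  then show ?thesis unfolding cinner_def using sums_unique[OF sums_single[of k "\<lambda>_. coord x k"]] by simp
qed

lemma cinner_ket_right [simp]: "cinner x (ket k) = cnj (coord x k)"
  by (subst cinner_commute) simp

lemma norm_ket [simp]: "norm (ket k) = 1"
  using Re_cinner_self[of "ket k"] norm_ge_zero[of "ket k"]
  by (simp add: coord_ket power2_eq_1_iff del: norm_ge_zero)

lemma norm_coord_le: "cmod (coord x k) \<le> norm x"
  using cinner_Cauchy_Schwarz[of "ket k" x] by simp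

lemma cinner_eqI: "(\<And>y. cinner y x = cinner y x') \<Longrightarrow> x = x'"
  by (metis cinner_ket_left ell2_eqI)

lemma ket_expansion: "(\<lambda>N. \<Sum>k<N. coord x k *\<^sub>C ket k) \<longlonglongrightarrow> x"
proof -
  define s where "s N = (\<Sum>k<N. coord x k *\<^sub>C ket k)" for N
  have coord_s: "coord (s N) j = (if j < N then coord x j else 0)" for N j
    by (simp add: s_def coord_ket if_distrib[of "\<lambda>a. _ * a"] sum.delta cong: if_cong)
  have "(norm (x - s N))\<^sup>2 = (norm x)\<^sup>2 - (\<Sum>k<N. (cmod (coord x k))\<^sup>2)" for N
  proof -
    have "(\<lambda>k. (cmod (coord x k))\<^sup>2 - (if k \<in> {..<N} then (cmod (coord x k))\<^sup>2 else 0)) sums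
        ((norm x)\<^sup>2 - (\<Sum>k<N. (cmod (coord x k))\<^sup>2))"
      by (intro sums_diff norm_ell2_sums sums_If_finite_set) simp
    also have "(\<lambda>k. (cmod (coord x k))\<^sup>2 - (if k \<in> {..<N} then (cmod (coord x k))\<^sup>2 else 0))
        = (\<lambda>k. (cmod (coord (x - s N) k))\<^sup>2)"
      by (auto simp: coord_s)
    finally show ?thesis using norm_ell2_sums[of "x - s N"] sums_unique2 by blast
  qed
  moreover have "(\<lambda>N. (norm x)\<^sup>2 - (\<Sum>k<N. (cmod (coord x k))\<^sup>2)) \<longlonglongrightarrow> (norm x)\<^sup>2 - (norm x)\<^sup>2"
    using norm_ell2_sums[of x] unfolding sums_def by (intro tendsto_intros)
  ultimately have "(\<lambda>N. (norm (x - s N))\<^sup>2) \<longlonglongrightarrow> 0" by simp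
  then have "(\<lambda>N. norm (x - s N)) \<longlonglongrightarrow> 0"
    using tendsto_real_sqrt[of "\<lambda>N. (norm (x - s N))\<^sup>2" 0] by simp
  then have "(\<lambda>N. norm (s N - x)) \<longlonglongrightarrow> 0" by (simp add: norm_minus_commute)
  then show ?thesis unfolding s_def by (rule LIM_zero_cancel[OF tendsto_norm_zero_cancel])
qed

lemma ket_expansion_finite:
  assumes "\<And>j. j > N \<Longrightarrow> coord x j = 0"
  shows "x = (\<Sum>j\<le>N. coord x j *\<^sub>C ket j)"
proof (rule ell2_eqI)
  fix i
  show "coord x i = coord (\<Sum>j\<le>N. coord x j *\<^sub>C ket j) i"
    using assms[of i]
    by (cases "i \<le> N") (simp_all add: coord_ket if_distrib[of "\<lambda>a. _ * a"] sum.delta cong: if_cong)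
qed

text \<open>Limits and operators are built from their coordinates; the norm bound comes along with
  the vector so that operator bounds follow at once.\<close>

lemma ell2_of_bounded_sums:
  assumes "\<And>N. (\<Sum>k<N. (cmod (f k))\<^sup>2) \<le> C\<^sup>2" "C \<ge> 0"
  shows "\<exists>x. coord x = f \<and> norm x \<le> C"
proof -
  have sm: "summable (\<lambda>k. (cmod (f k))\<^sup>2)"
    using assms(1) by (intro summableI_nonneg_bounded) auto
  then have c: "coord (Abs_ell2 f) = f" by (simp add: Abs_ell2_inverse)
  have "(norm (Abs_ell2 f))\<^sup>2 \<le> C\<^sup>2"
    using norm_ell2_sums[of "Abs_ell2 f"] assms(1) unfolding c sums_def
    by (intro LIMSEQ_le_const2) auto
  then have "norm (Abs_ell2 f) \<le> C" using assms(2) power2_le_imp_le by blast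
  with c show ?thesis by blast
qed

lemma norm_coord_sum_le: "(\<Sum>k<N. (cmod (coord x k))\<^sup>2) \<le> (norm x)\<^sup>2"
  using sum_le_suminf[OF summable_coord[of x], of "{..<N}"] norm_ell2_sums[of x] by (simp add: sums_iff)

instance ell2 :: complete_space
proof
  fix X :: "nat \<Rightarrow> ell2" assume X: "Cauchy X"
  have "\<exists>l. (\<lambda>n. coord (X n) k) \<longlonglongrightarrow> l" for k
  proof -
    have "Cauchy (\<lambda>n. coord (X n) k)"
      unfolding Cauchy_def
    proof (intro allI impI)
      fix e :: real assume "e > 0"
      then obtain M where M: "\<forall>m\<ge>M. \<forall>n\<ge>M. dist (X m) (X n) < e" using X unfolding Cauchy_def by blast
      have "dist (coord (X m) k) (coord (X n) k) \<le> dist (X m) (X n)" for m n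
        using norm_coord_le[of "X m - X n" k] by (simp add: dist_norm)
      with M show "\<exists>M. \<forall>m\<ge>M. \<forall>n\<ge>M. dist (coord (X m) k) (coord (X n) k) < e"
        by (meson le_less_trans)
    qed
    then show ?thesis by (simp add: Cauchy_convergent_iff convergent_def)
  qed
  then obtain f where f: "\<And>k. (\<lambda>n. coord (X n) k) \<longlonglongrightarrow> f k" by metis
  \<comment> \<open>\<open>f\<close> is only a coordinatewise limit, not yet known to be square
    summable. Finite partial sums pass to the limit in m, so its difference from \<open>X n\<close>
    is the coordinate sequence of a vector.\<close>
  have close: "\<exists>y. coord y = (\<lambda>k. coord (X n) k - f k) \<and> norm y \<le> e"
    if "e > 0" and M: "\<forall>m\<ge>n. dist (X n) (X m) \<le> e" for e n
  proof (rule ell2_of_bounded_sums)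
    fix N
    have "(\<lambda>m. \<Sum>k<N. (cmod (coord (X n) k - coord (X m) k))\<^sup>2)
        \<longlonglongrightarrow> (\<Sum>k<N. (cmod (coord (X n) k - f k))\<^sup>2)"
      by (intro tendsto_intros f)
    moreover have "\<forall>m\<ge>n. (\<Sum>k<N. (cmod (coord (X n) k - coord (X m) k))\<^sup>2) \<le> e\<^sup>2"
    proof (intro allI impI)
      fix m assume "m \<ge> n"
      have "(\<Sum>k<N. (cmod (coord (X n) k - coord (X m) k))\<^sup>2) \<le> (norm (X n - X m))\<^sup>2"
        using norm_coord_sum_le[of "X n - X m" N] by simp
      also have "\<dots> \<le> e\<^sup>2" using M \<open>m \<ge> n\<close> by (intro power_mono) (auto simp: dist_norm)
      finally show "(\<Sum>k<N. (cmod (coord (X n) k - coord (X m) k))\<^sup>2) \<le> e\<^sup>2" .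
    qed
    ultimately show "(\<Sum>k<N. (cmod (coord (X n) k - f k))\<^sup>2) \<le> e\<^sup>2"
      by (intro LIMSEQ_le_const2) auto
  qed (use that in simp)
  obtain n0 where n0: "\<forall>m\<ge>n0. \<forall>n\<ge>n0. dist (X m) (X n) < 1" using X unfolding Cauchy_def
    using zero_less_one by blast
  have "\<exists>y. coord y = (\<lambda>k. coord (X n0) k - f k) \<and> norm y \<le> 1"
    by (rule close) (use n0 less_imp_le in auto)
  then obtain y where y: "coord y = (\<lambda>k. coord (X n0) k - f k)" by blast
  define L where "L = X n0 - y"
  have L: "coord L k = f k" for k by (simp add: L_def y)
  have "X \<longlonglongrightarrow> L"
    unfolding LIMSEQ_def
  proof (intro allI impI)
    fix e :: real assume "e > 0"
    then obtain M where M: "\<forall>m\<ge>M. \<forall>n\<ge>M. dist (X m) (X n) < e / 2"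
      using X unfolding Cauchy_def using half_gt_zero by blast
    have "dist (X n) L < e" if "n \<ge> M" for n
    proof -
      have "\<exists>y. coord y = (\<lambda>k. coord (X n) k - f k) \<and> norm y \<le> e / 2"
        by (rule close) (use \<open>e > 0\<close> M that in \<open>auto intro: less_imp_le\<close>)
      then obtain y where y: "coord y = (\<lambda>k. coord (X n) k - f k)" "norm y \<le> e / 2" by blast
      have "y = X n - L" by (rule ell2_eqI) (simp add: y L)
      then show ?thesis using y(2) \<open>e > 0\<close> by (simp add: dist_norm)
    qed
    then show "\<exists>M. \<forall>n\<ge>M. dist (X n) L < e" by blast
  qed
  then show "convergent X" by (auto simp: convergent_def)
qed

section \<open>Bounded complex-linear operators and adjoints\<close>

lemma bounded_clinearI:
  assumes "\<And>x y. F (x + y) = F x + F y" "\<And>a x. F (a *\<^sub>C x) = a *\<^sub>C F x" "\<And>x. norm (F x) \<le> norm x * K"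
  shows "bounded_clinear F"
  unfolding bounded_clinear_def
  using assms by (auto intro!: bounded_linear_intro[where K = K] simp: scaleR_eq_scaleC)

locale bounded_clinear_op =
  fixes F
  assumes F: "bounded_clinear F"
begin

sublocale bounded_linear F
  using F by (simp add: bounded_clinear_def)

lemma scaleC: "F (a *\<^sub>C x) = a *\<^sub>C F x"
  using F by (simp add: bounded_clinear_def)

end

lemma bounded_clinear_compose:
  "bounded_clinear F \<Longrightarrow> bounded_clinear G \<Longrightarrow> bounded_clinear (\<lambda>x. F (G x))"
  by (auto simp: bounded_clinear_def intro: bounded_linear_compose)

lemma bounded_clinear_add:
  "bounded_clinear F \<Longrightarrow> bounded_clinear G \<Longrightarrow> bounded_clinear (\<lambda>x. F x + G x)"
  by (auto simp: bounded_clinear_def scaleC.add_right intro: bounded_linear_add)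

lemma bounded_clinear_scaleC: "bounded_clinear F \<Longrightarrow> bounded_clinear (\<lambda>x. a *\<^sub>C F x)"
  by (auto simp: bounded_clinear_def mult.commute intro: bounded_linear_compose[OF scaleC.bounded_linear_right])

lemma bounded_clinear_scaleR: "bounded_clinear F \<Longrightarrow> bounded_clinear (\<lambda>x. r *\<^sub>R F x)"
  unfolding scaleR_eq_scaleC by (rule bounded_clinear_scaleC)

lemma bounded_clinear_ident: "bounded_clinear (\<lambda>x. x)"
  by (auto simp: bounded_clinear_def)

lemma bounded_clinear_zero: "bounded_clinear (\<lambda>x. 0)"
  by (auto simp: bounded_clinear_def scaleC.zero_right)

lemma bounded_clinear_eq_on_kets:
  assumes "bounded_clinear F" "bounded_clinear G" "\<And>k. F (ket k) = G (ket k)"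
  shows "F x = G x"
proof -
  interpret F: bounded_clinear_op F by standard fact
  interpret G: bounded_clinear_op G by standard fact
  have "(\<lambda>N. F (\<Sum>k<N. coord x k *\<^sub>C ket k)) \<longlonglongrightarrow> F x" by (intro F.tendsto ket_expansion)
  moreover have "(\<lambda>N. G (\<Sum>k<N. coord x k *\<^sub>C ket k)) \<longlonglongrightarrow> G x" by (intro G.tendsto ket_expansion)
  ultimately show ?thesis
    by (simp add: F.sum G.sum F.scaleC G.scaleC assms(3) LIMSEQ_unique)
qed

text \<open>A Bessel-type inequality for the rows makes a matrix bounded. It yields adjoints, with
  rows \<open>T (ket j)\<close>, and the Cholesky factor, with rows
  \<open>P (gs P j)\<close>.\<close>

lemma op_of_rows:
  assumes "\<And>N x. (\<Sum>j<N. (cmod (cinner (u j) x))\<^sup>2) \<le> (C * norm x)\<^sup>2" "C \<ge> 0"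
  shows "\<exists>F. bounded_clinear F \<and> (\<forall>x j. coord (F x) j = cinner (u j) x)"
proof -
  have "\<exists>y. coord y = (\<lambda>j. cinner (u j) x) \<and> norm y \<le> C * norm x" for x
    using assms by (intro ell2_of_bounded_sums) auto
  then obtain F where F: "\<And>x. coord (F x) = (\<lambda>j. cinner (u j) x)" "\<And>x. norm (F x) \<le> C * norm x"
    by metis
  have "bounded_clinear F"
    by (rule bounded_clinearI[where K = C])
      (auto intro!: ell2_eqI simp: F(1) cinner.add_right F(2) mult.commute[of "norm _"])
  with F(1) show ?thesis by auto
qed

lemma cadjoint_exists:
  assumes "bounded_clinear T"
  shows "\<exists>F. \<forall>x y. cinner (F x) y = cinner x (T y)"
proof -
  interpret T: bounded_clinear_op T by standard fact
  obtain K where K: "\<And>x. norm (T x) \<le> norm x * K" "K \<ge> 0" using T.nonneg_bounded by blast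
  have "(\<Sum>j<N. (cmod (cinner (T (ket j)) x))\<^sup>2) \<le> (K * norm x)\<^sup>2" for N x
  proof -
    define s where "s = (\<Sum>j<N. (cmod (cinner (T (ket j)) x))\<^sup>2)"
    \<comment> \<open>The bound of \<open>T\<close> is tested on the truncated image itself: the
      squared norm of \<open>v\<close> equals <T v, x>, which is at most K times the norms of
      \<open>v\<close> and \<open>x\<close>.\<close>
    define v where "v = (\<Sum>j<N. cinner (T (ket j)) x *\<^sub>C ket j)"
    have "s \<ge> 0" by (auto simp: s_def intro: sum_nonneg)
    have cv: "coord v j = (if j < N then cinner (T (ket j)) x else 0)" for j
      by (simp add: v_def coord_ket if_distrib[of "\<lambda>a. _ * a"] sum.delta cong: if_cong)
    have "(\<lambda>k. if k \<in> {..<N} then (cmod (cinner (T (ket k)) x))\<^sup>2 else 0) sums s"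
      unfolding s_def by (rule sums_If_finite_set) simp
    also have "(\<lambda>k. if k \<in> {..<N} then (cmod (cinner (T (ket k)) x))\<^sup>2 else 0)
        = (\<lambda>k. (cmod (coord v k))\<^sup>2)" by (auto simp: cv)
    finally have nv: "s = (norm v)\<^sup>2" using norm_ell2_sums[of v] sums_unique2 by blast
    have "cinner (T v) x = (\<Sum>j<N. complex_of_real ((cmod (cinner (T (ket j)) x))\<^sup>2))"
      unfolding v_def T.sum cinner.sum_left T.scaleC cinner_scaleC_left
      by (simp add: complex_norm_square mult.commute del: of_real_power)
    then have "cinner (T v) x = complex_of_real s" by (simp add: s_def)
    then have "s \<le> norm (T v) * norm x"
      using cinner_Cauchy_Schwarz[of "T v" x] \<open>s \<ge> 0\<close> by simp
    also have "\<dots> \<le> norm v * K * norm x" by (intro mult_right_mono K) auto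
    finally have "norm v * norm v \<le> norm v * (K * norm x)" by (simp add: nv power2_eq_square mult.assoc)
    then have "norm v \<le> K * norm x" using K(2) by (cases "norm v = 0") auto
    then show ?thesis unfolding s_def[symmetric] nv by (intro power_mono) auto
  qed
  from op_of_rows[OF this K(2)] obtain F
    where F: "\<forall>x j. coord (F x) j = cinner (T (ket j)) x" by auto
  have "cinner (F x) y = cinner x (T y)" for x y
  proof -
    have "(\<lambda>N. cinner (F x) (\<Sum>k<N. coord y k *\<^sub>C ket k)) \<longlonglongrightarrow> cinner (F x) y"
      "(\<lambda>N. cinner x (T (\<Sum>k<N. coord y k *\<^sub>C ket k))) \<longlonglongrightarrow> cinner x (T y)"
      by (intro tendsto_intros cinner.tendsto T.tendsto ket_expansion)+
    moreover have "cinner (F x) (\<Sum>k<N. coord y k *\<^sub>C ket k) = cinner x (T (\<Sum>k<N. coord y k *\<^sub>C ket k))" for N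
      by (simp add: T.sum T.scaleC cinner.sum_right F cinner_commute[of x])
    ultimately show ?thesis using LIMSEQ_unique by simp
  qed
  then show ?thesis by blast
qed

lemma cinner_cadjoint:
  assumes "bounded_clinear T"
  shows "cinner (cadjoint T x) y = cinner x (T y)"
proof -
  obtain F where F: "\<forall>x y. cinner (F x) y = cinner x (T y)" using cadjoint_exists[OF assms] by blast
  have "cadjoint T = F"
    unfolding cadjoint_def
  proof (rule the_equality)
    fix G assume G: "\<forall>x y. cinner (G x) y = cinner x (T y)"
    show "G = F"
    proof (rule ext, rule cinner_eqI)
      fix x y show "cinner y (G x) = cinner y (F x)"
        using F G by (simp add: cinner_commute[of y])
    qed
  qed (rule F)
  with F show ?thesis by blast
qed

lemma cadjoint_eqI:
  assumes "bounded_clinear T" "\<And>y. cinner z y = cinner x (T y)"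
  shows "cadjoint T x = z"
proof (rule cinner_eqI)
  fix y
  have "cinner (cadjoint T x) y = cinner z y" by (simp add: assms(2) cinner_cadjoint[OF assms(1)])
  from arg_cong[OF this, of cnj] show "cinner y (cadjoint T x) = cinner y z"
    by (simp only: cinner_commute[symmetric])
qed

text \<open>For small \<open>\<epsilon>\<close> the map \<open>x \<mapsto> x - \<epsilon> (P x - y)\<close> is a contraction.\<close>

lemma Lax_Milgram:
  assumes P: "bounded_clinear P" and "\<delta> > 0" and coercive: "\<And>x. \<delta> * (norm x)\<^sup>2 \<le> Re (cinner x (P x))"
  shows "bij P"
proof -
  interpret P: bounded_clinear_op P by standard fact
  obtain K where K: "\<And>x. norm (P x) \<le> norm x * K" "K > 0" using P.pos_bounded by blast
  \<comment> \<open>The term K^2 in the denominator gives \<epsilon> K^2 \<le> \<delta>, which makes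
    the contraction gain at least \<epsilon> \<delta>; the term \<delta>^2 gives \<epsilon> \<delta>
    \<le> 1, so that the contraction constant is a real square root.\<close>
  define \<epsilon> where "\<epsilon> = \<delta> / (K\<^sup>2 + \<delta>\<^sup>2)"
  have den: "K\<^sup>2 + \<delta>\<^sup>2 > 0" using K by (simp add: add_pos_nonneg)
  then have \<epsilon>: "\<epsilon> > 0" using \<open>\<delta> > 0\<close> by (simp add: \<epsilon>_def)
  define q where "q = sqrt (1 - \<epsilon> * \<delta>)"
  have "\<epsilon> * \<delta> \<le> 1" using den by (simp add: \<epsilon>_def power2_eq_square)
  have "\<epsilon> * K\<^sup>2 \<le> \<delta>" using den \<open>\<delta> > 0\<close> by (simp add: \<epsilon>_def field_simps)
  have q: "0 \<le> q" "q < 1" using \<open>\<epsilon> * \<delta> \<le> 1\<close> \<epsilon> \<open>\<delta> > 0\<close> by (auto simp: q_def)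
  have contr: "norm (x - \<epsilon> *\<^sub>R P x) \<le> q * norm x" for x
  proof -
    have "(norm (x - \<epsilon> *\<^sub>R P x))\<^sup>2 = (norm x)\<^sup>2 - 2 * \<epsilon> * Re (cinner x (P x)) + \<epsilon>\<^sup>2 * (norm (P x))\<^sup>2"
      unfolding inner_ell2_def[symmetric] power2_norm_eq_inner
      by (simp add: inner_diff_left inner_diff_right inner_commute power2_eq_square)
    also have "\<dots> \<le> (norm x)\<^sup>2 - 2 * \<epsilon> * (\<delta> * (norm x)\<^sup>2) + \<epsilon>\<^sup>2 * (norm x * K)\<^sup>2"
      using \<epsilon> coercive K by (intro add_mono diff_mono mult_left_mono power_mono) auto
    also have "\<dots> = (norm x)\<^sup>2 * (1 - 2 * \<epsilon> * \<delta> + \<epsilon> * (\<epsilon> * K\<^sup>2))" by algebra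
    also have "\<dots> \<le> (norm x)\<^sup>2 * (1 - 2 * \<epsilon> * \<delta> + \<epsilon> * \<delta>)"
      using \<open>\<epsilon> * K\<^sup>2 \<le> \<delta>\<close> \<epsilon> by (intro mult_left_mono add_left_mono) auto
    also have "\<dots> = (q * norm x)\<^sup>2" using \<open>\<epsilon> * \<delta> \<le> 1\<close> by (simp add: q_def power_mult_distrib)
    finally show ?thesis by (rule power2_le_imp_le) (use q in simp)
  qed
  show ?thesis
  proof (rule bijI)
    show "inj P"
    proof (rule injI)
      fix x x' assume "P x = P x'"
      then have "norm (x - x') \<le> q * norm (x - x')" using contr[of "x - x'"] by (simp add: P.diff)
      then have "(1 - q) * norm (x - x') \<le> 0" by (simp add: algebra_simps)
      then show "x = x'" using q by (simp add: mult_le_0_iff)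
    qed
    show "surj P"
    proof (rule surjI)
      fix y
      define f where "f x = x - \<epsilon> *\<^sub>R (P x - y)" for x
      have "\<exists>!x. f x = x"
      proof (rule banach_fix_type[OF q])
        show "\<forall>x. \<forall>x'. dist (f x) (f x') \<le> q * dist x x'"
        proof (intro allI)
          fix x x'
          have "f x - f x' = (x - x') - \<epsilon> *\<^sub>R P (x - x')" by (simp add: f_def P.diff algebra_simps)
          then show "dist (f x) (f x') \<le> q * dist x x'" using contr[of "x - x'"] by (simp add: dist_norm)
        qed
      qed
      then obtain x where "f x = x" by blast
      then have "P x = y" using \<epsilon> by (simp add: f_def)
      then have "\<exists>x. P x = y" by blast
      then show "P (SOME x. P x = y) = y" by (rule someI_ex)
    qed
  qed
qed

lemma bounded_clinear_inv:
  assumes F: "bounded_clinear F" and "bij F" and "\<delta> > 0" and below: "\<And>x. \<delta> * norm x \<le> norm (F x)"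
  shows "bounded_clinear (inv F)"
proof -
  interpret F: bounded_clinear_op F by standard fact
  have [simp]: "inv F (F x) = x" "F (inv F x) = x" for x
    using \<open>bij F\<close> by (auto simp: bij_def surj_f_inv_f)
  show ?thesis
  proof (rule bounded_clinearI[where K = "1 / \<delta>"])
    fix x y a
    show "inv F (x + y) = inv F x + inv F y"
      using F.add[of "inv F x" "inv F y"] by (metis \<open>\<And>x. inv F (F x) = x\<close> \<open>\<And>x. F (inv F x) = x\<close>)
    show "inv F (a *\<^sub>C x) = a *\<^sub>C inv F x"
      using F.scaleC[of a "inv F x"] by (metis \<open>\<And>x. inv F (F x) = x\<close> \<open>\<And>x. F (inv F x) = x\<close>)
    show "norm (inv F x) \<le> norm x * (1 / \<delta>)"
      using below[of "inv F x"] \<open>\<delta> > 0\<close> by (simp add: field_simps)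
  qed
qed

section \<open>The isometries onto the even and the odd coordinates\<close>

definition ev :: "ell2 \<Rightarrow> ell2" where "ev y = U_adj (y, 0)"
definition od :: "ell2 \<Rightarrow> ell2" where "od z = U_adj (0, z)"

lemma coord_ev: "coord (ev y) k = (if even k then coord y (k div 2) else 0)"
  and coord_od: "coord (od y) k = (if even k then 0 else coord y (k div 2))"
  by (simp_all add: ev_def od_def coord_U_adj)

lemma U_adj_eq: "U_adj (y, z) = ev y + od z"
  by (rule ell2_eqI) (simp add: coord_U_adj coord_ev coord_od)

lemma ev_ket: "ev (ket k) = ket (2 * k)" and od_ket: "od (ket k) = ket (2 * k + 1)"
  by (rule ell2_eqI; auto simp: coord_ev coord_od coord_ket elim!: oddE)+

lemma U_op_ev_od: "U_op (ev y + od z) = (y, z)"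
  unfolding U_adj_eq[symmetric] U_adj_inverse ..

lemma cinner_ev_od [simp]:
  "cinner (ev y) (ev y') = cinner y y'" "cinner (od z) (od z') = cinner z z'"
  "cinner (ev y) (od z') = 0" "cinner (od z) (ev y') = 0"
proof -
  have e: "cinner (ev y + od z) (ev y' + od z') = cinner y y' + cinner z z'" for y z y' z'
    using U_adj_adjoint[of y z "ev y' + od z'"] unfolding U_op_ev_od U_adj_eq by simp
  have [simp]: "ev 0 = 0" "od 0 = 0" by (auto intro!: ell2_eqI simp: coord_ev coord_od)
  show "cinner (ev y) (ev y') = cinner y y'" using e[of y 0 y' 0] by (simp add: cinner.zero_left)
  show "cinner (od z) (od z') = cinner z z'" using e[of 0 z 0 z'] by (simp add: cinner.zero_left)
  show "cinner (ev y) (od z') = 0" using e[of y 0 0 z'] by (simp add: cinner.zero_left cinner.zero_right)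
  show "cinner (od z) (ev y') = 0" using e[of 0 z y' 0] by (simp add: cinner.zero_left cinner.zero_right)
qed

lemma norm_ev [simp]: "norm (ev y) = norm y" and norm_od [simp]: "norm (od y) = norm y"
proof -
  have "(norm (ev y))\<^sup>2 = (norm y)\<^sup>2" "(norm (od y))\<^sup>2 = (norm y)\<^sup>2"
    unfolding Re_cinner_self[symmetric] by simp_all
  then show "norm (ev y) = norm y" "norm (od y) = norm y" by simp_all
qed

lemma bounded_clinear_ev: "bounded_clinear ev" and bounded_clinear_od: "bounded_clinear od"
  by (rule bounded_clinearI[where K = 1]; (auto intro!: ell2_eqI simp: coord_ev coord_od)?)+

lemma ev_od_linear [simp]:
  "ev (x + y) = ev x + ev y" "ev (x - y) = ev x - ev y" "ev (a *\<^sub>C x) = a *\<^sub>C ev x" "ev (r *\<^sub>R x) = r *\<^sub>R ev x"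
  "od (x + y) = od x + od y" "od (x - y) = od x - od y" "od (a *\<^sub>C x) = a *\<^sub>C od x" "od (r *\<^sub>R x) = r *\<^sub>R od x"
  "ev 0 = 0" "od 0 = 0"
  by (auto intro!: ell2_eqI simp: coord_ev coord_od)

lemma tendsto_ev: "(f \<longlongrightarrow> x) F \<Longrightarrow> ((\<lambda>n. ev (f n)) \<longlongrightarrow> ev x) F"
  and tendsto_od: "(f \<longlongrightarrow> x) F \<Longrightarrow> ((\<lambda>n. od (f n)) \<longlongrightarrow> od x) F"
  using bounded_clinear_ev bounded_clinear_od
  by (auto simp: bounded_clinear_def intro: bounded_linear.tendsto)

lemma ev_od_cases: obtains y z where "x = ev y + od z"
  using U_adj_inverse(1)[of x] unfolding U_op_def U_adj_eq by metis

lemma norm_ev_od: "(norm (ev y + od z))\<^sup>2 = (norm y)\<^sup>2 + (norm z)\<^sup>2"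
  unfolding Re_cinner_self[symmetric] by (simp add: cinner.add_left cinner.add_right)

section \<open>Polynomials of operators and the Cholesky factorisation\<close>

context bounded_clinear_op
begin

lemma poly_op_bound:
  assumes "degree p \<le> N"
  shows "poly_op p F x = (\<Sum>i\<le>N. coeff p i *\<^sub>C (F ^^ i) x)"
  unfolding poly_op_def using assms
  by (intro sum.mono_neutral_left) (auto simp: coeff_eq_0 scaleC.zero_left)

lemma poly_op_0 [simp]: "poly_op 0 F x = 0"
  by (simp add: poly_op_def scaleC.zero_left)

lemma poly_op_pCons [simp]: "poly_op (pCons a p) F x = a *\<^sub>C x + F (poly_op p F x)"
proof -
  have "poly_op (pCons a p) F x = (\<Sum>i\<le>Suc (degree p). coeff (pCons a p) i *\<^sub>C (F ^^ i) x)"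
    by (rule poly_op_bound) (rule degree_pCons_le)
  then show ?thesis
    by (simp only: sum.atMost_Suc_shift) (simp add: poly_op_def sum scaleC)
qed

lemma poly_op_add: "poly_op (p + q) F x = poly_op p F x + poly_op q F x"
  using poly_op_bound[of p "max (degree p) (degree q)" x] poly_op_bound[of q "max (degree p) (degree q)" x]
    poly_op_bound[of "p + q" "max (degree p) (degree q)" x]
  by (simp add: degree_add_le_max scaleC.add_left sum.distrib)

lemma poly_op_smult: "poly_op (smult a p) F x = a *\<^sub>C poly_op p F x"
  by (induction p) (simp_all add: scaleC.zero_right scaleC.add_right scaleC)

lemma poly_op_diff: "poly_op (p - q) F x = poly_op p F x - poly_op q F x"
  using poly_op_add[of p "smult (-1) q" x] poly_op_smult[of "-1" q x]
  by (simp add: scaleC.minus_left)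

lemma poly_op_commute: "poly_op p F (F x) = F (poly_op p F x)"
  by (induction p) (simp_all add: zero add scaleC)

lemma poly_op_mult: "poly_op (p * q) F x = poly_op p F (poly_op q F x)"
  by (induction p) (simp_all add: poly_op_add poly_op_smult scaleC.zero_left)

lemma bounded_clinear_poly_op: "bounded_clinear (poly_op p F)"
proof (induction p)
  case 0
  have "poly_op 0 F = (\<lambda>x. 0)" by (rule ext) simp
  then show ?case by (simp only: bounded_clinear_zero)
next
  case (pCons a p)
  have "poly_op (pCons a p) F = (\<lambda>x. a *\<^sub>C x + F (poly_op p F x))" by (rule ext) simp
  then show ?case
    using bounded_clinear_add[OF bounded_clinear_scaleC[OF bounded_clinear_ident]
        bounded_clinear_compose[OF F pCons.IH]] by (simp only:)
qed

lemma poly_op_sum: "poly_op p F (\<Sum>i\<in>S. f i) = (\<Sum>i\<in>S. poly_op p F (f i))"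
  and poly_op_scaleC_arg: "poly_op p F (a *\<^sub>C x) = a *\<^sub>C poly_op p F x"
  and poly_op_diff_arg: "poly_op p F (x - y) = poly_op p F x - poly_op p F y"
  and poly_op_zero_arg: "poly_op p F 0 = 0"
proof -
  interpret q: bounded_clinear_op "poly_op p F" by standard (rule bounded_clinear_poly_op)
  show "poly_op p F (\<Sum>i\<in>S. f i) = (\<Sum>i\<in>S. poly_op p F (f i))"
    "poly_op p F (a *\<^sub>C x) = a *\<^sub>C poly_op p F x"
    "poly_op p F (x - y) = poly_op p F x - poly_op p F y" "poly_op p F 0 = 0"
    by (rule q.sum q.scaleC q.diff q.zero)+
qed

end

lemma cnj_poly: "cnj (poly p z) = poly (map_poly cnj p) (cnj z)"
  by (induction p) (simp_all add: map_poly_pCons)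

locale selfadjoint_op = bounded_clinear_op +
  assumes selfadj: "cinner (F x) y = cinner x (F y)"
begin

lemma cinner_poly_op: "cinner (poly_op p F x) y = cinner x (poly_op (map_poly cnj p) F y)"
proof (induction p arbitrary: x)
  case 0 show ?case by (simp add: cinner.zero_left cinner.zero_right)
next
  case (pCons a p)
  have "cinner (poly_op (pCons a p) F x) y = cnj a * cinner x y + cinner (poly_op p F (F x)) y"
    by (simp add: cinner.add_left poly_op_commute)
  also have "\<dots> = cinner x (poly_op (map_poly cnj (pCons a p)) F y)"
    by (simp add: pCons.IH selfadj map_poly_pCons cinner.add_right)
  finally show ?case .
qed

end

lemma selfadjoint_op_iff: "selfadjoint_op F \<longleftrightarrow> selfadjoint F"
  by (auto simp: selfadjoint_def selfadjoint_op_def selfadjoint_op_axioms_def bounded_clinear_op_def)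

text \<open>Gram-Schmidt orthonormalisation of the standard basis with respect to the inner product
  \<open>\<langle>x, P y\<rangle>\<close>. Its vectors are the columns of \<open>\<Phi>\<^sup>-\<^sup>1\<close> when \<open>P = \<Phi>\<^sup>*\<Phi>\<close>.\<close>

function gs :: "(ell2 \<Rightarrow> ell2) \<Rightarrow> nat \<Rightarrow> ell2" where
  "gs P k = (let v = ket k - (\<Sum>i<k. cinner (gs P i) (P (ket k)) *\<^sub>C gs P i)
    in (1 / sqrt (Re (cinner v (P v)))) *\<^sub>R v)"
  by pat_completeness auto
termination by (relation "Wellfounded.measure snd") auto

declare gs.simps [simp del]

definition gs_pre :: "(ell2 \<Rightarrow> ell2) \<Rightarrow> nat \<Rightarrow> ell2" where
  "gs_pre P k = ket k - (\<Sum>i<k. cinner (gs P i) (P (ket k)) *\<^sub>C gs P i)"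

lemma gs_eq: "gs P k = (1 / sqrt (Re (cinner (gs_pre P k) (P (gs_pre P k))))) *\<^sub>R gs_pre P k"
  by (subst gs.simps) (simp add: gs_pre_def Let_def)

section \<open>Existence, uniqueness and invertibility of the Cholesky factor of a coercive
  operator\<close>

locale coercive_op = selfadjoint_op P for P +
  fixes \<delta> :: real
  assumes \<delta>: "\<delta> > 0" and coercive: "\<delta> * (norm x)\<^sup>2 \<le> Re (cinner x (P x))"
begin

lemma form_positive: "Re (cinner x (P x)) \<ge> 0"
  using \<delta> coercive[of x] by (smt (verit) mult_nonneg_nonneg zero_le_power2)

lemma form_real: "cinner x (P x) = complex_of_real (Re (cinner x (P x)))"
proof -
  have "cnj (cinner x (P x)) = cinner x (P x)" by (simp add: cinner_commute[symmetric] selfadj)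
  then show ?thesis by (simp add: complex_eq_iff)
qed

lemma gs_pre_support:
  assumes "\<And>i j. i < k \<Longrightarrow> i < j \<Longrightarrow> coord (gs P i) j = 0" "j \<ge> k"
  shows "coord (gs_pre P k) j = (if j = k then 1 else 0)"
  using assms by (simp add: gs_pre_def coord_ket)

lemma gs_support: "k < j \<Longrightarrow> coord (gs P k) j = 0"
proof (induction k arbitrary: j rule: less_induct)
  case (less k)
  then show ?case using gs_pre_support[of k j] by (subst gs_eq) simp
qed

text \<open>These are the diagonal entries of \<Phi>, see \<open>Cholesky_diag\<close>.\<close>

definition gs_norm :: "nat \<Rightarrow> real" where
  "gs_norm k = sqrt (Re (cinner (gs_pre P k) (P (gs_pre P k))))"

text \<open>Coordinate k of \<open>gs_pre P k\<close> is 1, so coercivity applies. The bound depends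
  on \<delta> alone, which keeps the normalisation continuous along the iteration.\<close>

lemma gs_norm_ge: "gs_norm k \<ge> sqrt \<delta>"
proof -
  have "coord (gs_pre P k) k = 1" using gs_pre_support[of k k] gs_support by simp
  then have "1 \<le> norm (gs_pre P k)" using norm_coord_le[of "gs_pre P k" k] by simp
  then have "1 \<le> (norm (gs_pre P k))\<^sup>2" by simp
  then have "\<delta> * 1 \<le> \<delta> * (norm (gs_pre P k))\<^sup>2" using \<delta> by (intro mult_left_mono) auto
  also have "\<dots> \<le> Re (cinner (gs_pre P k) (P (gs_pre P k)))" by (rule coercive)
  finally show ?thesis by (simp add: gs_norm_def)
qed

lemma gs_norm_pos: "gs_norm k > 0"
  using gs_norm_ge[of k] \<delta> by (smt (verit) real_sqrt_gt_zero)

lemma gs_diag: "coord (gs P k) k = complex_of_real (1 / gs_norm k)"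
  using gs_pre_support[of k k] gs_support by (subst gs_eq) (simp add: gs_norm_def)

lemma gs_orthonormal_le: "j \<le> k \<Longrightarrow> cinner (gs P j) (P (gs P k)) = (if j = k then 1 else 0)"
proof (induction k arbitrary: j rule: less_induct)
  case (less k)
  have IH: "cinner (gs P i) (P (gs P j)) = (if i = j then 1 else 0)" if "i < k" "j < k" for i j
  proof (cases "i \<le> j")
    case True then show ?thesis using less.IH that by blast
  next
    case False
    then have "cinner (gs P j) (P (gs P i)) = 0" using less.IH[of i j] that by simp
    then have "cnj (cinner (P (gs P i)) (gs P j)) = 0" by (simp only: cinner_commute[symmetric])
    then show ?thesis using False by (simp add: selfadj)
  qed
  show ?case
  proof (cases "j = k")
    case True
    have "cinner (gs P k) (P (gs P k)) = complex_of_real ((1 / gs_norm k) * (1 / gs_norm k) *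
        Re (cinner (gs_pre P k) (P (gs_pre P k))))"
      by (subst (1 2) gs_eq) (simp add: scaleR gs_norm_def[symmetric] form_real[symmetric])
    also have "Re (cinner (gs_pre P k) (P (gs_pre P k))) = gs_norm k * gs_norm k"
      using form_positive by (simp add: gs_norm_def)
    finally show ?thesis using True gs_norm_pos[of k] by simp
  next
    case False
    with less.prems have "j < k" by simp
    have "cinner (gs P j) (P (gs_pre P k)) = cinner (gs P j) (P (ket k)) -
        (\<Sum>i<k. cinner (gs P i) (P (ket k)) * cinner (gs P j) (P (gs P i)))"
      by (simp add: gs_pre_def diff sum scaleC cinner.diff_right cinner.sum_right)
    also have "\<dots> = 0"
      using \<open>j < k\<close> by (simp add: IH if_distrib[of "\<lambda>a. _ * a"] sum.delta cong: if_cong)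
    finally show ?thesis using False by (subst (2) gs_eq) (simp add: scaleR)
  qed
qed

lemma gs_orthonormal: "cinner (gs P j) (P (gs P k)) = (if j = k then 1 else 0)"
proof (cases "j \<le> k")
  case False
  then have "cinner (gs P k) (P (gs P j)) = 0" using gs_orthonormal_le[of k j] by simp
  then have "cnj (cinner (P (gs P j)) (gs P k)) = 0" by (simp only: cinner_commute[symmetric])
  then show ?thesis using False by (simp add: selfadj)
qed (rule gs_orthonormal_le)

text \<open>Inverts the triangular system of Gram-Schmidt; the coefficients \<open>a\<close> are
  column k of \<Phi>.\<close>

lemma ket_in_gs_span: "\<exists>a. ket k = (\<Sum>i\<le>k. a i *\<^sub>C gs P i) \<and> a k = complex_of_real (gs_norm k)"
proof -
  have "gs_pre P k = complex_of_real (gs_norm k) *\<^sub>C gs P k"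
    using gs_norm_pos[of k]
    by (simp add: gs_eq[of P k] gs_norm_def[symmetric] scaleR_eq_scaleC)
  then have "ket k = complex_of_real (gs_norm k) *\<^sub>C gs P k + (\<Sum>i<k. cinner (gs P i) (P (ket k)) *\<^sub>C gs P i)"
    by (simp add: gs_pre_def algebra_simps)
  then show ?thesis
    by (intro exI[of _ "\<lambda>i. if i = k then complex_of_real (gs_norm k) else cinner (gs P i) (P (ket k))"])
      (simp add: lessThan_Suc_atMost[symmetric] add.commute)
qed

lemma gs_total:
  assumes "\<And>k. cinner z (gs P k) = cinner z' (gs P k)"
  shows "z = z'"
proof (rule ell2_eqI)
  fix k
  obtain a where a: "ket k = (\<Sum>i\<le>k. a i *\<^sub>C gs P i)" using ket_in_gs_span by blast
  have "cinner z (ket k) = cinner z' (ket k)" unfolding a by (simp add: cinner.sum_right assms)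
  then show "coord z k = coord z' k" by simp
qed

lemma bounded_clinear_eq_on_gs:
  assumes "bounded_clinear G" "bounded_clinear H" "\<And>k. G (gs P k) = H (gs P k)"
  shows "G = H"
proof
  fix x
  interpret G: bounded_clinear_op G by standard fact
  interpret H: bounded_clinear_op H by standard fact
  show "G x = H x"
  proof (rule bounded_clinear_eq_on_kets[OF assms(1,2)])
    fix k
    obtain a where a: "ket k = (\<Sum>i\<le>k. a i *\<^sub>C gs P i)" using ket_in_gs_span by blast
    show "G (ket k) = H (ket k)" unfolding a by (simp add: G.sum H.sum G.scaleC H.scaleC assms(3))
  qed
qed

text \<open>Positivity of the form on x minus its P-orthogonal projection to a finite span. This is
  the row estimate that makes the factor a bounded operator.\<close>

lemma Bessel: "(\<Sum>j<N. (cmod (cinner (gs P j) (P x)))\<^sup>2) \<le> Re (cinner x (P x))"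
proof -
  define a where "a j = cinner (gs P j) (P x)" for j
  define s where "s = (\<Sum>j<N. a j *\<^sub>C gs P j)"
  define S where "S = (\<Sum>j<N. (cmod (a j))\<^sup>2)"
  have S: "complex_of_real S = (\<Sum>j<N. cnj (a j) * a j)"
    by (simp add: S_def of_real_cmod_square[symmetric] del: of_real_power)
  have sx: "cinner s (P x) = complex_of_real S"
    unfolding S by (simp add: s_def cinner.sum_left a_def[symmetric])
  have "cinner (gs P j) (P s) = (if j < N then a j else 0)" for j
    by (simp add: s_def sum scaleC cinner.sum_right gs_orthonormal if_distrib[of "\<lambda>a. _ * a"] sum.delta
        cong: if_cong)
  then have ss: "cinner s (P s) = complex_of_real S"
    unfolding S by (subst s_def) (simp add: cinner.sum_left)
  have "cinner x (P s) = cnj (cinner s (P x))" by (simp add: cinner_commute[symmetric] selfadj)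
  then have xs: "cinner x (P s) = complex_of_real S" by (simp add: sx)
  have "0 \<le> Re (cinner (x - s) (P (x - s)))" by (rule form_positive)
  also have "\<dots> = Re (cinner x (P x)) - S"
    by (simp add: diff cinner.diff_left cinner.diff_right sx ss xs)
  finally show ?thesis by (simp add: S_def a_def)
qed

lemma Cholesky_exists: "\<exists>\<Phi>. bounded_clinear \<Phi> \<and> (\<forall>x j. coord (\<Phi> x) j = cinner (gs P j) (P x))"
proof -
  obtain K where K: "\<And>x. norm (P x) \<le> norm x * K" "K \<ge> 0" using nonneg_bounded by blast
  have "(\<Sum>j<N. (cmod (cinner (P (gs P j)) x))\<^sup>2) \<le> (sqrt K * norm x)\<^sup>2" for N x
  proof -
    have "(\<Sum>j<N. (cmod (cinner (P (gs P j)) x))\<^sup>2) \<le> Re (cinner x (P x))"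
      unfolding selfadj by (rule Bessel)
    also have "\<dots> \<le> cmod (cinner x (P x))" by (rule complex_Re_le_cmod)
    also have "\<dots> \<le> norm x * norm (P x)" by (rule cinner_Cauchy_Schwarz)
    also have "\<dots> \<le> norm x * (norm x * K)" by (intro mult_left_mono K) auto
    also have "\<dots> = (sqrt K * norm x)\<^sup>2" using K(2) by (simp add: power_mult_distrib power2_eq_square)
    finally show ?thesis .
  qed
  from op_of_rows[OF this] K(2) show ?thesis by (auto simp: selfadj)
qed

definition Cholesky :: "ell2 \<Rightarrow> ell2" where
  "Cholesky = (SOME \<Phi>. bounded_clinear \<Phi> \<and> (\<forall>x j. coord (\<Phi> x) j = cinner (gs P j) (P x)))"

lemma bounded_clinear_Cholesky: "bounded_clinear Cholesky"
  and coord_Cholesky: "coord (Cholesky x) j = cinner (gs P j) (P x)"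
  using someI_ex[OF Cholesky_exists] by (simp_all add: Cholesky_def)

lemma Cholesky_gs: "Cholesky (gs P k) = ket k"
  by (rule ell2_eqI) (simp add: coord_Cholesky gs_orthonormal coord_ket)

lemma cadjoint_Cholesky: "cadjoint Cholesky (Cholesky x) = P x"
proof (rule gs_total)
  fix k
  have "cinner (P x) (gs P k) = cnj (cinner (gs P k) (P x))" by (rule cinner_commute)
  then show "cinner (cadjoint Cholesky (Cholesky x)) (gs P k) = cinner (P x) (gs P k)"
    by (simp add: cinner_cadjoint[OF bounded_clinear_Cholesky] Cholesky_gs coord_Cholesky)
qed

lemma Cholesky_upper: "k < j \<Longrightarrow> coord (Cholesky (ket k)) j = 0"
  and Cholesky_diag: "coord (Cholesky (ket k)) k = complex_of_real (gs_norm k)"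
proof -
  obtain a where a: "ket k = (\<Sum>i\<le>k. a i *\<^sub>C gs P i)" "a k = complex_of_real (gs_norm k)"
    using ket_in_gs_span by blast
  have *: "coord (Cholesky (ket k)) j = (if j \<le> k then a j else 0)" for j
    unfolding coord_Cholesky a(1)
    by (simp add: sum scaleC cinner.sum_right gs_orthonormal if_distrib[of "\<lambda>a. _ * a"] sum.delta cong: if_cong)
  show "k < j \<Longrightarrow> coord (Cholesky (ket k)) j = 0" "coord (Cholesky (ket k)) k = complex_of_real (gs_norm k)"
    by (simp_all add: * a(2))
qed

text \<open>\<open>G\<close> turns the form into the inner product, so it maps the vectors
  \<open>gs P k\<close> to orthonormal ones. Triangularity kills the coordinates of the image above
  k, orthogonality to the earlier images \<open>ket i\<close> kills those below, and the positive
  diagonal fixes the phase of the remaining one.\<close>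

lemma Cholesky_unique:
  assumes G: "bounded_clinear G" and upper: "\<And>j k. k < j \<Longrightarrow> coord (G (ket k)) j = 0"
    and diag: "\<And>k. \<exists>r>0. coord (G (ket k)) k = complex_of_real r"
    and fact: "\<And>x. cadjoint G (G x) = P x"
  shows "G = Cholesky"
proof (rule bounded_clinear_eq_on_gs[OF G bounded_clinear_Cholesky])
  interpret G: bounded_clinear_op G by standard fact
  have form: "cinner (G x) (G y) = cinner x (P y)" for x y
    using cinner_cadjoint[OF G, of "G x" y] by (simp add: fact selfadj)
  fix k
  have "G (gs P k) = ket k"
  proof (induction k rule: less_induct)
    case (less k)
    have exp: "gs P k = (\<Sum>j\<le>k. coord (gs P k) j *\<^sub>C ket j)"
      by (rule ket_expansion_finite) (rule gs_support)
    have G_coord: "coord (G (gs P k)) i = (\<Sum>j\<le>k. coord (gs P k) j * coord (G (ket j)) i)" for i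
      by (subst exp) (simp add: G.sum G.scaleC)
    have above: "coord (G (gs P k)) i = 0" if "i > k" for i
      unfolding G_coord using that upper by (intro sum.neutral) auto
    have below: "coord (G (gs P k)) i = 0" if "i < k" for i
      using form[of "gs P i" "gs P k"] that by (simp add: less.IH gs_orthonormal)
    obtain r where r: "r > 0" "coord (G (ket k)) k = complex_of_real r" using diag by blast
    have "coord (G (gs P k)) k = coord (gs P k) k * coord (G (ket k)) k"
      unfolding G_coord by (rule sum.remove[THEN trans, of _ k]) (auto intro!: sum.neutral simp: upper)
    then obtain s where s: "s > 0" "coord (G (gs P k)) k = complex_of_real s"
      using r gs_norm_pos[of k] by (auto simp: gs_diag intro!: that[of "1 / gs_norm k * r"])
    have eq: "G (gs P k) = complex_of_real s *\<^sub>C ket k"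
      by (rule ell2_eqI) (metis above below s(2) coord_ket coord_scaleC linorder_neqE_nat mult.right_neutral mult_zero_right)
    have "cinner (G (gs P k)) (G (gs P k)) = 1" by (simp add: form gs_orthonormal)
    then have "complex_of_real (s * s) = complex_of_real 1" unfolding eq by (simp add: coord_ket)
    then have "s * s = 1" by (simp only: of_real_eq_iff)
    then have "s = 1" using s(1) by (metis abs_mult_self_eq abs_of_pos mult_cancel_left2 power2_eq_1_iff power2_eq_square zero_less_one not_less_iff_gr_or_eq less_minus_iff neg_0_equal_iff_equal neg_less_0_iff_less)
    then show ?case using eq by simp
  qed
  then show "G (gs P k) = Cholesky (gs P k)" by (simp add: Cholesky_gs)
qed

lemma form_Cholesky: "cinner (Cholesky x) (Cholesky y) = cinner x (P y)"
  using cinner_cadjoint[OF bounded_clinear_Cholesky, of "Cholesky x" y] by (simp add: cadjoint_Cholesky selfadj)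

lemma norm_Cholesky: "sqrt \<delta> * norm x \<le> norm (Cholesky x)"
proof (rule power2_le_imp_le)
  have "(sqrt \<delta> * norm x)\<^sup>2 = \<delta> * (norm x)\<^sup>2" using \<delta> by (simp add: power_mult_distrib)
  also have "\<dots> \<le> (norm (Cholesky x))\<^sup>2" using coercive by (simp add: Re_cinner_self[symmetric] form_Cholesky)
  finally show "(sqrt \<delta> * norm x)\<^sup>2 \<le> (norm (Cholesky x))\<^sup>2" .
qed simp

lemma bij_Cholesky: "bij Cholesky"
proof (rule bijI)
  interpret \<Phi>: bounded_clinear_op Cholesky by standard (rule bounded_clinear_Cholesky)
  show "inj Cholesky"
  proof (rule injI)
    fix x y assume "Cholesky x = Cholesky y"
    then have "sqrt \<delta> * norm (x - y) \<le> 0" using norm_Cholesky[of "x - y"] by (simp add: \<Phi>.diff)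
    then show "x = y" using \<delta> by (simp add: mult_le_0_iff)
  qed
  have "bij P" by (rule Lax_Milgram[OF F \<delta> coercive])
  show "surj Cholesky"
    unfolding surj_def
  proof
    fix y
    \<comment> \<open>A triangular matrix with positive diagonal need not be onto in infinite
      dimension; the coercive equation for \<open>P\<close> supplies the preimage.\<close>
    obtain x where x: "P x = cadjoint Cholesky y" using \<open>bij P\<close> by (metis bij_pointE)
    have "y = Cholesky x"
    proof (rule ell2_eqI)
      fix k
      have "cinner y (Cholesky (gs P k)) = cinner (Cholesky x) (Cholesky (gs P k))"
        unfolding cinner_cadjoint[OF bounded_clinear_Cholesky, symmetric] cadjoint_Cholesky x ..
      then show "coord y k = coord (Cholesky x) k" by (simp add: Cholesky_gs)
    qed
    then show "\<exists>x. y = Cholesky x" ..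
  qed
qed

lemma bounded_clinear_inv_Cholesky: "bounded_clinear (inv Cholesky)"
  by (rule bounded_clinear_inv[OF bounded_clinear_Cholesky bij_Cholesky _ norm_Cholesky]) (use \<delta> in simp)

end

section \<open>One step of the iteration\<close>

lemma bounded_clinear_cadjoint:
  assumes T: "bounded_clinear T"
  shows "bounded_clinear (cadjoint T)"
proof -
  interpret T: bounded_clinear_op T by standard fact
  obtain K where K: "\<And>x. norm (T x) \<le> norm x * K" "K \<ge> 0" using T.nonneg_bounded by blast
  note adj = cinner_cadjoint[OF T]
  show ?thesis
  proof (rule bounded_clinearI[where K = K])
    fix x y a
    show "cadjoint T (x + y) = cadjoint T x + cadjoint T y" "cadjoint T (a *\<^sub>C x) = a *\<^sub>C cadjoint T x"
      by (rule cadjoint_eqI[OF T]; simp add: cinner.add_left adj)+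
    have "(norm (cadjoint T x))\<^sup>2 = Re (cinner x (T (cadjoint T x)))"
      by (simp add: Re_cinner_self[symmetric] adj)
    also have "\<dots> \<le> cmod (cinner x (T (cadjoint T x)))" by (rule complex_Re_le_cmod)
    also have "\<dots> \<le> norm x * norm (T (cadjoint T x))" by (rule cinner_Cauchy_Schwarz)
    also have "\<dots> \<le> norm x * (norm (cadjoint T x) * K)" by (intro mult_left_mono K) auto
    finally have "norm (cadjoint T x) * norm (cadjoint T x) \<le> norm (cadjoint T x) * (norm x * K)"
      by (simp add: power2_eq_square mult_ac)
    then show "norm (cadjoint T x) \<le> norm x * K"
      using K(2) by (cases "norm (cadjoint T x) = 0") auto
  qed
qed

lemma norm_even_odd_part: "(norm x)\<^sup>2 = (norm (even_part x))\<^sup>2 + (norm (odd_part x))\<^sup>2"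
  using norm_ev_od[of "even_part x" "odd_part x"] U_adj_inverse(1)[of x]
  by (simp add: U_op_def U_adj_eq)

lemma bounded_clinear_even_part: "bounded_clinear even_part"
  and bounded_clinear_odd_part: "bounded_clinear odd_part"
proof -
  have "norm (even_part x) \<le> norm x" "norm (odd_part x) \<le> norm x" for x
    by (rule power2_le_imp_le; use norm_even_odd_part[of x] in simp)+
  then show "bounded_clinear even_part" "bounded_clinear odd_part"
    by (auto intro!: bounded_clinearI[where K = 1] ell2_eqI simp: even_part.rep_eq odd_part.rep_eq)
qed

definition shift_sq :: "real \<Rightarrow> (ell2 \<Rightarrow> ell2) \<Rightarrow> ell2 \<Rightarrow> ell2" where
  "shift_sq \<tau> A x = A (A x) + (4 * \<tau> * (\<tau> - 1)) *\<^sub>R x"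

text \<open>\<open>Theta \<tau> A\<close> identifies \<open>\<ell>\<^sup>2 \<oplus> \<ell>\<^sup>2\<close>, with the inner product
  \<open>\<langle>x, x'\<rangle> + \<langle>y, (A\<^sup>2 + 4\<tau>(\<tau>-1)) y'\<rangle>\<close>, with \<open>\<ell>\<^sup>2\<close>. In this picture \<open>2\<tau> \<pi>\<^sup>*(A)\<close> has the
  entries \<open>A, A\<^sup>2 + 4\<tau>(\<tau>-1), 1, A\<close>, which no longer involve \<open>\<Phi>\<close>.\<close>

definition Theta :: "real \<Rightarrow> (ell2 \<Rightarrow> ell2) \<Rightarrow> ell2 \<Rightarrow> ell2 \<Rightarrow> ell2" where
  "Theta \<tau> A x y = ev x + od (Phi \<tau> A y)"

text \<open>\<open>even_coef \<tau> f\<close> and \<open>odd_coef \<tau> f\<close> are the polynomials \<open>S\<close>, \<open>U\<close> with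
  \<open>f(v) = S(x) + (2\<tau>v - x) U(x)\<close> for \<open>x = \<pi>(v)\<close>; note \<open>(2\<tau>v - x)\<^sup>2 = x\<^sup>2 + 4\<tau>(\<tau>-1)\<close>.\<close>

definition quad :: "real \<Rightarrow> complex poly" where
  "quad \<tau> = [:complex_of_real (4 * \<tau> * (\<tau> - 1)), 0, 1:]"

text \<open>A Horner step: multiplication by v = (x + r) / (2\<tau>), where r = 2\<tau> v - x and
  r^2 = x^2 + 4\<tau>(\<tau> - 1). It comes from (x + r)(S + r U) = (x S + r^2 U) + r (S + x
  U).\<close>

definition coef_step :: "real \<Rightarrow> complex \<Rightarrow> complex poly \<times> complex poly \<Rightarrow> complex poly \<times> complex poly" where
  "coef_step \<tau> a su =
    ([:a:] + smult (1 / complex_of_real (2 * \<tau>)) (pCons 0 (fst su) + quad \<tau> * snd su),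
     smult (1 / complex_of_real (2 * \<tau>)) (fst su + pCons 0 (snd su)))"

definition even_coef :: "real \<Rightarrow> complex poly \<Rightarrow> complex poly" where
  "even_coef \<tau> f = fst (fold_coeffs (coef_step \<tau>) f (0, 0))"

definition odd_coef :: "real \<Rightarrow> complex poly \<Rightarrow> complex poly" where
  "odd_coef \<tau> f = snd (fold_coeffs (coef_step \<tau>) f (0, 0))"

lemma coef_0 [simp]: "even_coef \<tau> 0 = 0" "odd_coef \<tau> 0 = 0"
  by (simp_all add: even_coef_def odd_coef_def)

lemma coef_pCons:
  "even_coef \<tau> (pCons a f) = [:a:] + smult (1 / complex_of_real (2 * \<tau>)) (pCons 0 (even_coef \<tau> f) + quad \<tau> * odd_coef \<tau> f)"
  "odd_coef \<tau> (pCons a f) = smult (1 / complex_of_real (2 * \<tau>)) (even_coef \<tau> f + pCons 0 (odd_coef \<tau> f))"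
  \<comment> \<open>\<open>pCons 0 0\<close> is the zero polynomial, on which the fold makes no
    step; the equations hold there because the step fixes the pair of zeros.\<close>
  by (cases "a = 0 \<and> f = 0"; force simp: even_coef_def odd_coef_def coef_step_def)+

lemma poly_coef:
  assumes "\<tau> \<noteq> 0" and root: "of_real \<tau> * v * v = x * v + of_real (\<tau> - 1)"
  shows "poly f v = poly (even_coef \<tau> f) x + (2 * of_real \<tau> * v - x) * poly (odd_coef \<tau> f) x"
proof (induction f)
  case (pCons a f)
  define s u t r where "s = poly (even_coef \<tau> f) x" and "u = poly (odd_coef \<tau> f) x"
    and "t = complex_of_real \<tau>" and "r = 2 * t * v - x"
  have t: "t \<noteq> 0" using assms by (simp add: t_def)
  have "r * r = 4 * t * (t * v * v - x * v) + x * x" by (simp add: r_def algebra_simps)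
  then have rr: "r * r = x * x + 4 * t * (t - 1)"
    using root by (simp add: t_def)
  have v: "2 * t * v = x + r" by (simp add: r_def)
  have "2 * t * poly (pCons a f) v = 2 * t * a + (x + r) * (s + r * u)"
  proof -
    have "2 * t * poly (pCons a f) v = 2 * t * a + (2 * t * v) * poly f v" by (simp add: algebra_simps)
    also have "\<dots> = 2 * t * a + (x + r) * (s + r * u)"
      unfolding v pCons.IH by (simp add: s_def u_def r_def t_def)
    finally show ?thesis .
  qed
  also have "(x + r) * (s + r * u) = x * s + (r * r) * u + r * (s + x * u)" by algebra
  also have "2 * t * a + \<dots> = 2 * t * (poly (even_coef \<tau> (pCons a f)) x + r * poly (odd_coef \<tau> (pCons a f)) x)"
    unfolding rr coef_pCons quad_def using t
    by (simp add: s_def[symmetric] u_def[symmetric] t_def[symmetric] field_simps)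
  finally show ?case using t by (simp add: r_def t_def)
qed simp

text \<open>A constant has no odd part, so the first factor v contributes 1/(2\<tau>). Afterwards
  both parts have the same leading coefficient, and each further factor v contributes
  2/(2\<tau>).\<close>

definition coef_factor :: "real \<Rightarrow> nat \<Rightarrow> real" where
  "coef_factor \<tau> n = (if n = 0 then 1 else 1 / (2 * \<tau> ^ n))"

text \<open>A bound n replaces the degree so that vanishing leading coefficients are allowed in the
  induction. That the odd part loses one degree is what later lets inductions on the degree treat it
  as a lower-order term.\<close>

lemma coef_degree:
  assumes "\<tau> \<noteq> 0" "\<And>i. i > n \<Longrightarrow> coeff f i = 0"
  shows "(\<forall>i>n. coeff (even_coef \<tau> f) i = 0) \<and> coeff (even_coef \<tau> f) n = of_real (coef_factor \<tau> n) * coeff f n \<and>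
    (\<forall>i\<ge>n. coeff (odd_coef \<tau> f) i = 0) \<and> (n > 0 \<longrightarrow> coeff (odd_coef \<tau> f) (n - 1) = of_real (coef_factor \<tau> n) * coeff f n)"
  using assms(2)
proof (induction f arbitrary: n)
  case (pCons a f)
  show ?case
  proof (cases n)
    case 0
    have "f = 0"
    proof (rule poly_eqI)
      fix i show "coeff f i = coeff 0 i" using pCons.prems[of "Suc i"] 0 by simp
    qed
    then show ?thesis using 0 by (simp add: coef_pCons coef_factor_def coeff_eq_0)
  next
    case (Suc m)
    have IH: "\<forall>i>m. coeff (even_coef \<tau> f) i = 0" "coeff (even_coef \<tau> f) m = of_real (coef_factor \<tau> m) * coeff f m"
      "\<forall>i\<ge>m. coeff (odd_coef \<tau> f) i = 0" "m > 0 \<longrightarrow> coeff (odd_coef \<tau> f) (m - 1) = of_real (coef_factor \<tau> m) * coeff f m"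
      using pCons.IH[of m] pCons.prems[of "Suc _"] Suc by auto
    have quad: "quad \<tau> * q = smult (complex_of_real (4 * \<tau> * (\<tau> - 1))) q + pCons 0 (pCons 0 q)" for q
      by (simp add: quad_def)
    have "coeff (even_coef \<tau> (pCons a f)) n = of_real (coef_factor \<tau> n) * coeff (pCons a f) n"
      using IH Suc assms(1)
      by (cases m) (simp_all add: coef_pCons quad coef_factor_def coeff_pCons field_simps)
    moreover have "coeff (odd_coef \<tau> (pCons a f)) (n - 1) = of_real (coef_factor \<tau> n) * coeff (pCons a f) n"
      using IH Suc assms(1)
      by (cases m) (simp_all add: coef_pCons coef_factor_def coeff_pCons field_simps)
    moreover have "\<forall>i>n. coeff (even_coef \<tau> (pCons a f)) i = 0" "\<forall>i\<ge>n. coeff (odd_coef \<tau> (pCons a f)) i = 0"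
      using IH Suc by (auto simp: coef_pCons quad coeff_pCons split: nat.splits)
    ultimately show ?thesis by blast
  qed
qed simp

section \<open>The lifted operator in the coordinates \<open>Theta\<close>\<close>

locale lift_op = selfadjoint_op A for A + fixes \<tau> :: real assumes \<tau>: "\<tau> > 1"
begin

abbreviation "P \<equiv> shift_sq \<tau> A"
abbreviation "\<Phi> \<equiv> Phi \<tau> A"
abbreviation "\<Theta> \<equiv> Theta \<tau> A"

lemma bounded_clinear_P: "bounded_clinear P"
  unfolding shift_sq_def[abs_def]
  by (rule bounded_clinear_add[OF bounded_clinear_compose[OF F F] bounded_clinear_scaleR[OF bounded_clinear_ident]])

sublocale P: coercive_op P "4 * \<tau> * (\<tau> - 1)"
proof
  show "bounded_clinear P" by (rule bounded_clinear_P)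
  show "cinner (P x) y = cinner x (P y)" for x y
    by (simp add: shift_sq_def cinner.add_left cinner.add_right selfadj)
  show "0 < 4 * \<tau> * (\<tau> - 1)" using \<tau> by simp
  fix x
  have "cinner x (P x) = cinner (A x) (A x) + of_real (4 * \<tau> * (\<tau> - 1)) * cinner x x"
    by (simp add: shift_sq_def cinner.add_right selfadj)
  then show "4 * \<tau> * (\<tau> - 1) * (norm x)\<^sup>2 \<le> Re (cinner x (P x))"
    by (simp add: cinner_self)
qed

lemma is_Phi_Cholesky: "is_Phi \<tau> A P.Cholesky"
  unfolding is_Phi_def
  using P.bounded_clinear_Cholesky P.Cholesky_upper P.Cholesky_diag P.gs_norm_pos P.cadjoint_Cholesky
  by (auto simp: shift_sq_def)

lemma is_Phi_unique: "is_Phi \<tau> A G \<Longrightarrow> G = P.Cholesky"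
  by (rule P.Cholesky_unique) (auto simp: is_Phi_def shift_sq_def)

lemma Phi_eq: "\<Phi> = P.Cholesky"
  unfolding Phi_def using is_Phi_Cholesky is_Phi_unique by (rule the_equality)

lemma is_Phi_iff: "is_Phi \<tau> A G \<longleftrightarrow> G = \<Phi>"
  unfolding Phi_eq using is_Phi_Cholesky is_Phi_unique by blast

lemma bounded_clinear_Phi: "bounded_clinear \<Phi>"
  unfolding Phi_eq by (rule P.bounded_clinear_Cholesky)

sublocale Phi: bounded_clinear_op \<Phi>
  by standard (rule bounded_clinear_Phi)

lemmas bij_Phi = P.bij_Cholesky[folded Phi_eq]
  and bounded_clinear_inv_Phi = P.bounded_clinear_inv_Cholesky[folded Phi_eq]
  and coord_Phi = P.coord_Cholesky[folded Phi_eq]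
  and Phi_gs = P.Cholesky_gs[folded Phi_eq]
  and form_Phi = P.form_Cholesky[folded Phi_eq]
  and cadjoint_Phi = P.cadjoint_Cholesky[folded Phi_eq]
  and Phi_upper = P.Cholesky_upper[folded Phi_eq]
  and Phi_diag = P.Cholesky_diag[folded Phi_eq]

lemma inv_Phi_ket: "inv \<Phi> (ket k) = gs P k"
  using inv_f_f[OF bij_is_inj[OF bij_Phi], of "gs P k"] by (simp add: Phi_gs)

lemma Theta_linear [simp]:
  "\<Theta> (x + x') (y + y') = \<Theta> x y + \<Theta> x' y'" "\<Theta> (x - x') (y - y') = \<Theta> x y - \<Theta> x' y'"
  "\<Theta> (a *\<^sub>C x) (a *\<^sub>C y) = a *\<^sub>C \<Theta> x y" "\<Theta> (r *\<^sub>R x) (r *\<^sub>R y) = r *\<^sub>R \<Theta> x y"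
  by (simp_all add: Theta_def Phi.add Phi.diff Phi.scaleC Phi.scaleR scaleC.add_right scaleR_add_right)

lemma Theta_cases: obtains x y where "z = \<Theta> x y"
  using ev_od_cases[of z] bij_Phi unfolding Theta_def by (metis bij_pointE)

lemma cinner_Theta: "cinner (\<Theta> x y) (\<Theta> x' y') = cinner x x' + cinner y (P y')"
  by (simp add: Theta_def cinner.add_left cinner.add_right form_Phi)

lemma Theta_ev: "\<Theta> x 0 = ev x"
  by (simp add: Theta_def Phi.zero)

lemma P_commute: "P (A x) = A (P x)"
  by (simp add: shift_sq_def add scaleR)

lemma pi_star_Theta: "pi_star \<tau> A (\<Theta> x y) = (1 / (2 * \<tau>)) *\<^sub>R \<Theta> (A x + P y) (x + A y)"
proof -
  have "inv \<Phi> (\<Phi> y) = y" by (rule inv_f_f[OF bij_is_inj[OF bij_Phi]])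
  then show ?thesis
    unfolding pi_star_def Theta_def U_op_ev_od
    by (simp add: U_adj_eq cadjoint_Phi A_star_def Phi.add)
qed

lemma selfadjoint_pi_star: "selfadjoint (pi_star \<tau> A)"
  unfolding selfadjoint_def
proof (intro conjI allI)
  have "pi_star \<tau> A = (\<lambda>x. (1 / (2 * \<tau>)) *\<^sub>R (ev (A (even_part x) + cadjoint \<Phi> (odd_part x)) +
      od (\<Phi> (even_part x) + \<Phi> (A (inv \<Phi> (odd_part x))))))"
    by (rule ext) (simp add: pi_star_def U_op_def U_adj_eq A_star_def)
  moreover have "bounded_clinear (\<lambda>x. ev (A (even_part x) + cadjoint \<Phi> (odd_part x)))"
    by (rule bounded_clinear_compose[OF bounded_clinear_ev bounded_clinear_add[OF
          bounded_clinear_compose[OF F bounded_clinear_even_part]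
          bounded_clinear_compose[OF bounded_clinear_cadjoint[OF bounded_clinear_Phi] bounded_clinear_odd_part]]])
  moreover have "bounded_clinear (\<lambda>x. od (\<Phi> (even_part x) + \<Phi> (A (inv \<Phi> (odd_part x)))))"
    by (rule bounded_clinear_compose[OF bounded_clinear_od bounded_clinear_add[OF
          bounded_clinear_compose[OF bounded_clinear_Phi bounded_clinear_even_part]
          bounded_clinear_compose[OF bounded_clinear_Phi bounded_clinear_compose[OF F
              bounded_clinear_compose[OF bounded_clinear_inv_Phi bounded_clinear_odd_part]]]]])
  ultimately show "bounded_clinear (pi_star \<tau> A)"
    by (simp only: bounded_clinear_scaleR[OF bounded_clinear_add])
  fix z z'
  obtain x y where z: "z = \<Theta> x y" by (rule Theta_cases)
  obtain x' y' where z': "z' = \<Theta> x' y'" by (rule Theta_cases)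
  show "cinner (pi_star \<tau> A z) z' = cinner z (pi_star \<tau> A z')"
    unfolding z z' pi_star_Theta
    by (simp add: cinner_Theta cinner.add_left cinner.add_right selfadj P.selfadj P_commute P.add)
qed

lemma poly_op_quad: "poly_op (quad \<tau>) A x = P x"
  by (simp add: quad_def shift_sq_def zero scaleR_eq_scaleC scaleC.zero_left scaleC.zero_right add.commute)

text \<open>Let D act as \<open>A\<close> on both components. Then E = 2\<tau> T - D sends (x, y) to
  (P y, x), commutes with D and has square P. So f(T) = S(D) + E U(D), the operator version of the
  splitting of f.\<close>

lemma poly_op_Theta:
  assumes T: "bounded_clinear T" and T_Theta: "\<And>x y. T (\<Theta> x y) = (1 / (2 * \<tau>)) *\<^sub>R \<Theta> (A x + P y) (x + A y)"
  shows "poly_op f T (\<Theta> x y) = \<Theta> (poly_op (even_coef \<tau> f) A x + P (poly_op (odd_coef \<tau> f) A y))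
    (poly_op (odd_coef \<tau> f) A x + poly_op (even_coef \<tau> f) A y)"
proof -
  interpret T: bounded_clinear_op T by standard fact
  have Theta0: "\<Theta> 0 0 = 0" by (simp add: Theta_ev)
  show ?thesis
  proof (induction f)
    case 0 show ?case by (simp add: Theta0 P.zero)
  next
    case (pCons a f)
    show ?case
      unfolding T.poly_op_pCons pCons.IH T_Theta coef_pCons poly_op_add poly_op_smult poly_op_pCons
        poly_op_mult poly_op_quad poly_op_0 zero
      by (simp only: Theta_linear[symmetric] scaleR_eq_scaleC add add_0_right scaleC.add_right P.add P.scaleC scaleC
          P_commute scaleC.zero_left of_real_divide of_real_1)
        (simp add: add_ac Theta0 scaleC.zero_right)
  qed
qed

lemma coord_Theta: "coord (\<Theta> x y) (2 * j) = coord x j" "coord (\<Theta> x y) (2 * j + 1) = cinner (gs P j) (P y)"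
  by (simp_all add: Theta_def coord_ev coord_od coord_Phi)

lemma norm_Theta: "(norm (\<Theta> x y))\<^sup>2 = (norm x)\<^sup>2 + (norm (\<Phi> y))\<^sup>2"
  by (simp add: Theta_def norm_ev_od)

lemma norm_Phi_sq: "(norm (\<Phi> y))\<^sup>2 = (norm (A y))\<^sup>2 + 4 * \<tau> * (\<tau> - 1) * (norm y)\<^sup>2"
  using form_Phi[of y y]
  by (simp add: Re_cinner_self[symmetric] shift_sq_def cinner.add_right selfadj)

lemma norm_Phi_le:
  assumes K: "\<And>x. norm (A x) \<le> K * norm x"
  shows "norm (\<Phi> y) \<le> sqrt (K\<^sup>2 + 4 * \<tau> * (\<tau> - 1)) * norm y"
proof (rule power2_le_imp_le)
  have nn: "K\<^sup>2 + 4 * \<tau> * (\<tau> - 1) \<ge> 0" using \<tau> by simp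
  have "(norm (A y))\<^sup>2 \<le> (K * norm y)\<^sup>2" by (intro power_mono K) simp
  then show "(norm (\<Phi> y))\<^sup>2 \<le> (sqrt (K\<^sup>2 + 4 * \<tau> * (\<tau> - 1)) * norm y)\<^sup>2"
    using nn by (simp add: norm_Phi_sq power_mult_distrib algebra_simps)
  show "0 \<le> sqrt (K\<^sup>2 + 4 * \<tau> * (\<tau> - 1)) * norm y" using nn by simp
qed

text \<open>The block operator has norm at most \<open>\<parallel>A\<parallel> + \<parallel>\<Phi>\<parallel> \<le> K + (K\<^sup>2 + 4\<tau>(\<tau>-1))\<^bsup>1/2\<^esup>\<close>, and this is at most
  \<open>2\<tau>K\<close> because \<open>K \<ge> 1\<close>.\<close>

lemma norm_pi_star:
  assumes K: "\<And>x. norm (A x) \<le> K * norm x" "K \<ge> 1"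
  shows "norm (pi_star \<tau> A z) \<le> K * norm z"
proof -
  obtain x y where z: "z = \<Theta> x y" by (rule Theta_cases)
  define \<phi> where "\<phi> = sqrt (K\<^sup>2 + 4 * \<tau> * (\<tau> - 1))"
  have \<phi>0: "\<phi> \<ge> 0" using \<tau> by (simp add: \<phi>_def)
  have norm_Phi: "norm (\<Phi> y) \<le> \<phi> * norm y" for y unfolding \<phi>_def by (rule norm_Phi_le[OF K(1)])
  have norm_D: "norm (\<Theta> (A x) (A y)) \<le> K * norm z"
  proof (rule power2_le_imp_le)
    have sq: "(norm (A x))\<^sup>2 \<le> K\<^sup>2 * (norm x)\<^sup>2" for x
      using K(1)[of x] by (metis norm_ge_zero power_mono power_mult_distrib)
    have "(norm (\<Phi> (A y)))\<^sup>2 \<le> K\<^sup>2 * (norm (A y))\<^sup>2 + 4 * \<tau> * (\<tau> - 1) * (K\<^sup>2 * (norm y)\<^sup>2)"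
      unfolding norm_Phi_sq using \<tau> by (intro add_mono mult_left_mono sq) auto
    also have "\<dots> = K\<^sup>2 * (norm (\<Phi> y))\<^sup>2" unfolding norm_Phi_sq by (simp add: algebra_simps)
    finally show "(norm (\<Theta> (A x) (A y)))\<^sup>2 \<le> (K * norm z)\<^sup>2"
      using sq[of x] by (simp add: z norm_Theta power_mult_distrib distrib_left)
  qed (use K(2) in simp)
  \<comment> \<open>This is the bound of \<Phi> transferred to its adjoint, since \<open>P y\<close>
    is the adjoint applied to \<Phi> y.\<close>
  have norm_P: "norm (P y) \<le> \<phi> * norm (\<Phi> y)"
  proof -
    have "(norm (P y))\<^sup>2 = Re (cinner (\<Phi> y) (\<Phi> (P y)))"
      by (simp add: Re_cinner_self[symmetric] form_Phi P.selfadj)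
    also have "\<dots> \<le> norm (\<Phi> y) * norm (\<Phi> (P y))"
      using complex_Re_le_cmod cinner_Cauchy_Schwarz by (rule order_trans)
    also have "\<dots> \<le> norm (\<Phi> y) * (\<phi> * norm (P y))" by (intro mult_left_mono norm_Phi) simp
    finally have "norm (P y) * norm (P y) \<le> norm (P y) * (\<phi> * norm (\<Phi> y))"
      by (simp add: power2_eq_square mult_ac)
    then show ?thesis using \<phi>0 by (cases "norm (P y) = 0") auto
  qed
  have norm_O: "norm (\<Theta> (P y) x) \<le> \<phi> * norm z"
  proof (rule power2_le_imp_le)
    have "(norm (\<Theta> (P y) x))\<^sup>2 \<le> (\<phi> * norm (\<Phi> y))\<^sup>2 + (\<phi> * norm x)\<^sup>2"
      unfolding norm_Theta by (intro add_mono power_mono norm_P norm_Phi) auto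
    then show "(norm (\<Theta> (P y) x))\<^sup>2 \<le> (\<phi> * norm z)\<^sup>2"
      by (simp add: z norm_Theta power_mult_distrib distrib_left add.commute)
  qed (use \<phi>0 in simp)
  \<comment> \<open>Rests on (2\<tau> - 1)^2 = 1 + 4\<tau>(\<tau> - 1).\<close>
  have "\<phi> \<le> (2 * \<tau> - 1) * K"
    unfolding \<phi>_def
  proof (rule real_le_lsqrt)
    have "4 * \<tau> * (\<tau> - 1) * 1 \<le> 4 * \<tau> * (\<tau> - 1) * K\<^sup>2" using K(2) \<tau> by (intro mult_left_mono) auto
    then show "K\<^sup>2 + 4 * \<tau> * (\<tau> - 1) \<le> ((2 * \<tau> - 1) * K)\<^sup>2" by (simp add: power2_eq_square algebra_simps)
  qed (use K(2) \<tau> in auto)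
  then have "(K + \<phi>) * norm z \<le> (2 * \<tau> * K) * norm z" by (intro mult_right_mono) (simp_all add: algebra_simps)
  moreover have "norm (\<Theta> (A x + P y) (x + A y)) \<le> norm (\<Theta> (A x) (A y)) + norm (\<Theta> (P y) x)"
    unfolding add.commute[of x] Theta_linear(1) by (rule norm_triangle_ineq)
  ultimately have "norm (\<Theta> (A x + P y) (x + A y)) \<le> 2 * \<tau> * (K * norm z)"
    using norm_D norm_O by (simp add: distrib_right)
  then show ?thesis using \<tau> unfolding z pi_star_Theta norm_scaleR by (simp add: field_simps del: Theta_linear)
qed

end

section \<open>The eigen-measure\<close>

definition branch :: "real \<Rightarrow> bool \<Rightarrow> real \<Rightarrow> real" where
  "branch \<tau> b x = (x + (if b then 1 else - 1) * sqrt (x\<^sup>2 + 4 * \<tau> * (\<tau> - 1))) / (2 * \<tau>)"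

context
  fixes \<tau> :: real
  assumes \<tau>: "\<tau> > 1"
begin

lemma disc_pos: "x\<^sup>2 + 4 * \<tau> * (\<tau> - 1) > 0"
  using \<tau> by (intro add_nonneg_pos) auto

lemma ratmap_eq_iff:
  assumes "v \<noteq> 0"
  shows "ratmap \<tau> v = x \<longleftrightarrow> \<tau> * v * v = x * v + (\<tau> - 1)"
  using assms by (auto simp: ratmap_def field_simps)

lemma branch_root: "\<tau> * branch \<tau> b x * branch \<tau> b x = x * branch \<tau> b x + (\<tau> - 1)"
proof -
  define s where "s = (if b then 1 else - 1) * sqrt (x\<^sup>2 + 4 * \<tau> * (\<tau> - 1))"
  have s: "s * s = x * x + 4 * \<tau> * (\<tau> - 1)"
    using disc_pos[of x] by (auto simp: s_def power2_eq_square)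
  have b: "2 * \<tau> * branch \<tau> b x = x + s" using \<tau> by (simp add: branch_def s_def)
  have "4 * \<tau> * (\<tau> * branch \<tau> b x * branch \<tau> b x) = (2 * \<tau> * branch \<tau> b x) * (2 * \<tau> * branch \<tau> b x)" by simp
  also have "\<dots> = 2 * x * (x + s) + 4 * \<tau> * (\<tau> - 1)" unfolding b using s by (simp add: algebra_simps)
  also have "\<dots> = 4 * \<tau> * (x * branch \<tau> b x + (\<tau> - 1))" unfolding b[symmetric] by (simp add: algebra_simps)
  finally show ?thesis using \<tau> by simp
qed

lemma branch_nonzero: "branch \<tau> b x \<noteq> 0"
  using branch_root[of b x] \<tau> by auto

lemma ratmap_branch: "ratmap \<tau> (branch \<tau> b x) = x"
  using ratmap_eq_iff[OF branch_nonzero] branch_root by blast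

text \<open>On the two branches 2\<tau> v - x is plus and minus the root of the discriminant. This
  sign change cancels the odd part of a function in the Ruelle average.\<close>

lemma branch_add: "2 * \<tau> * branch \<tau> True x - x = - (2 * \<tau> * branch \<tau> False x - x)"
  using \<tau> by (simp add: branch_def)

lemma branch_distinct: "branch \<tau> True x \<noteq> branch \<tau> False x"
  using disc_pos[of x] \<tau> by (simp add: branch_def)

lemma ratmap_preimage: "{v. v \<noteq> 0 \<and> ratmap \<tau> v = x} = {branch \<tau> True x, branch \<tau> False x}"
proof (intro equalityI subsetI)
  fix v assume "v \<in> {v. v \<noteq> 0 \<and> ratmap \<tau> v = x}"
  then have "\<tau> * v * v = x * v + (\<tau> - 1)" using ratmap_eq_iff by blast
  note root = this
  have "(2 * \<tau> * v - x)\<^sup>2 = 4 * \<tau> * (\<tau> * v * v) - 4 * \<tau> * (x * v) + x\<^sup>2"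
    by (simp add: power2_eq_square algebra_simps)
  also have "\<dots> = x\<^sup>2 + 4 * \<tau> * (\<tau> - 1)" unfolding root by (simp add: algebra_simps)
  finally have "(2 * \<tau> * v - x)\<^sup>2 = (sqrt (x\<^sup>2 + 4 * \<tau> * (\<tau> - 1)))\<^sup>2"
    using disc_pos[of x] by simp
  then have "2 * \<tau> * v - x = sqrt (x\<^sup>2 + 4 * \<tau> * (\<tau> - 1)) \<or> 2 * \<tau> * v - x = - sqrt (x\<^sup>2 + 4 * \<tau> * (\<tau> - 1))"
    by (rule power2_eq_iff[THEN iffD1])
  then show "v \<in> {branch \<tau> True x, branch \<tau> False x}" using \<tau> by (auto simp: branch_def field_simps)
qed (auto simp: ratmap_branch branch_nonzero)

lemma ruelle_eq: "ruelle \<tau> f x = (f (branch \<tau> True x) + f (branch \<tau> False x)) / 2"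
  unfolding ruelle_def ratmap_preimage using branch_distinct by simp

lemma branch_in_E1: "x \<in> E0 \<Longrightarrow> branch \<tau> b x \<in> E1 \<tau>"
  by (simp add: E1_def branch_nonzero ratmap_branch)

lemma E1_subset: "E1 \<tau> \<subseteq> E0"
proof -
  have "1 / \<tau> < 1" using \<tau> by simp
  then show ?thesis unfolding E1_eq[OF \<tau>] by auto
qed

lemma compact_E1: "compact (E1 \<tau>)"
  unfolding E1_eq[OF \<tau>] by (intro compact_Un compact_Icc)

text \<open>The square root of x^2 + c is the Euclidean norm of (x, sqrt c), hence 1-Lipschitz in x
  by the reverse triangle inequality; the numerator of \<open>branch\<close> is then
  2-Lipschitz.\<close>

lemma branch_Lipschitz: "\<bar>branch \<tau> b x - branch \<tau> b y\<bar> \<le> \<bar>x - y\<bar> / \<tau>"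
proof -
  define c where "c = 4 * \<tau> * (\<tau> - 1)"
  have c: "c > 0" using \<tau> by (simp add: c_def)
  define s where "s x = sqrt (x\<^sup>2 + c)" for x
  have "s x = norm (x, sqrt c)" for x using c by (simp add: s_def norm_Pair)
  then have "\<bar>s x - s y\<bar> \<le> norm ((x, sqrt c) - (y, sqrt c))" using norm_triangle_ineq3[of "(x, sqrt c)" "(y, sqrt c)"] by simp
  then have s: "\<bar>s x - s y\<bar> \<le> \<bar>x - y\<bar>" by (simp add: norm_Pair)
  define e where "e = (if b then 1 else - 1 :: real)"
  have "branch \<tau> b x - branch \<tau> b y = ((x - y) + e * (s x - s y)) / (2 * \<tau>)"
    by (simp add: branch_def s_def c_def e_def diff_divide_distrib add_divide_distrib)
  also have "\<bar>\<dots>\<bar> = \<bar>(x - y) + e * (s x - s y)\<bar> / (2 * \<tau>)" using \<tau> by simp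
  also have "\<dots> \<le> (\<bar>x - y\<bar> + \<bar>x - y\<bar>) / (2 * \<tau>)"
  proof (rule divide_right_mono)
    show "\<bar>(x - y) + e * (s x - s y)\<bar> \<le> \<bar>x - y\<bar> + \<bar>x - y\<bar>"
      using abs_triangle_ineq[of "x - y" "e * (s x - s y)"] s by (simp add: abs_mult e_def split: if_splits)
  qed (use \<tau> in simp)
  finally show ?thesis using \<tau> by simp
qed

lemma continuous_branch: "continuous_on S (branch \<tau> b)"
  unfolding branch_def using \<tau> by (intro continuous_intros) auto

lemma borel_measurable_branch [measurable]: "branch \<tau> b \<in> borel_measurable borel"
  by (rule borel_measurable_continuous_onI) (rule continuous_branch)

text \<open>The first symbol is applied last, so \<pi> acts on the limit points as the shift on
  sequences.\<close>

primrec coding_approx :: "nat \<Rightarrow> bool stream \<Rightarrow> real" where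
  "coding_approx 0 \<omega> = 0"
| "coding_approx (Suc n) \<omega> = branch \<tau> (shd \<omega>) (coding_approx n (stl \<omega>))"

lemma coding_approx_bound: "coding_approx n \<omega> \<in> E0"
proof (induction n arbitrary: \<omega>)
  case (Suc n)
  then show ?case using branch_in_E1 E1_subset by (auto simp del: atLeastAtMost_iff)
qed simp

lemma coding_approx_step: "\<bar>coding_approx (Suc n) \<omega> - coding_approx n \<omega>\<bar> \<le> (1 / \<tau>) ^ n"
proof (induction n arbitrary: \<omega>)
  case 0
  \<comment> \<open>Starting from 0, the centre of [-1,1], makes the first displacement at most
    1.\<close>
  show ?case using coding_approx_bound[of 1 \<omega>] by (simp add: abs_le_iff)
next
  case (Suc n)
  have "\<bar>coding_approx (Suc (Suc n)) \<omega> - coding_approx (Suc n) \<omega>\<bar> \<le> \<bar>coding_approx (Suc n) (stl \<omega>) - coding_approx n (stl \<omega>)\<bar> / \<tau>"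
    using branch_Lipschitz by simp
  also have "\<dots> \<le> (1 / \<tau>) ^ n / \<tau>" using Suc.IH \<tau> by (intro divide_right_mono) auto
  finally show ?case by simp
qed

lemma coding_approx_convergent: "convergent (\<lambda>n. coding_approx n \<omega>)"
proof -
  have "summable (\<lambda>n. coding_approx (Suc n) \<omega> - coding_approx n \<omega>)"
  proof (rule summable_comparison_test')
    show "summable (\<lambda>n. (1 / \<tau>) ^ n)" using \<tau> by (intro summable_geometric) simp
    show "norm (coding_approx (Suc n) \<omega> - coding_approx n \<omega>) \<le> (1 / \<tau>) ^ n" for n
      using coding_approx_step by (simp del: coding_approx.simps)
  qed
  then have "(\<lambda>N. coding_approx N \<omega> - coding_approx 0 \<omega>) \<longlonglongrightarrow> (\<Sum>n. coding_approx (Suc n) \<omega> - coding_approx n \<omega>)"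
    using summable_LIMSEQ[of "\<lambda>n. coding_approx (Suc n) \<omega> - coding_approx n \<omega>"]
    unfolding sum_lessThan_telescope[of "\<lambda>n. coding_approx n \<omega>"] by blast
  then show ?thesis by (auto simp: convergent_def)
qed

definition coding :: "bool stream \<Rightarrow> real" where
  "coding \<omega> = lim (\<lambda>n. coding_approx n \<omega>)"

lemma coding_approx_tendsto: "(\<lambda>n. coding_approx n \<omega>) \<longlonglongrightarrow> coding \<omega>"
  using coding_approx_convergent by (simp add: coding_def convergent_LIMSEQ_iff)

lemma coding_unfold: "coding \<omega> = branch \<tau> (shd \<omega>) (coding (stl \<omega>))"
proof (rule LIMSEQ_unique)
  show "(\<lambda>n. coding_approx (Suc n) \<omega>) \<longlonglongrightarrow> coding \<omega>" using coding_approx_tendsto by (rule LIMSEQ_Suc)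
  have "isCont (branch \<tau> b) x" for b x
    using continuous_branch[of UNIV b] by (simp add: continuous_on_eq_continuous_at)
  then show "(\<lambda>n. coding_approx (Suc n) \<omega>) \<longlonglongrightarrow> branch \<tau> (shd \<omega>) (coding (stl \<omega>))"
    unfolding coding_approx.simps using coding_approx_tendsto by (rule isCont_tendsto_compose)
qed

lemma coding_in_E0: "coding \<omega> \<in> E0"
  using coding_approx_bound coding_approx_tendsto closed_sequentially[of E0] by (metis closed_atLeastAtMost)

lemma coding_in_E1: "coding \<omega> \<in> E1 \<tau>"
  unfolding coding_unfold[of \<omega>] by (rule branch_in_E1) (rule coding_in_E0)

lemma ratmap_coding: "ratmap \<tau> (coding \<omega>) = coding (stl \<omega>)"
  unfolding coding_unfold[of \<omega>] by (rule ratmap_branch)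

text \<open>\<pi> maps \<open>E1\<close> onto the larger \<open>E0\<close>. The functional model
  needs a compact set carrying the measure and invariant under \<pi>, since it composes functions
  with \<pi>.\<close>

definition julia :: "real set" where
  "julia = {v. \<forall>n. (ratmap \<tau> ^^ n) v \<in> E1 \<tau>}"

lemma coding_in_julia: "coding \<omega> \<in> julia"
proof -
  have "(ratmap \<tau> ^^ n) (coding \<omega>) = coding (sdrop n \<omega>)" for n
    by (induction n arbitrary: \<omega>) (simp_all add: ratmap_coding funpow_swap1)
  then show ?thesis using coding_in_E1 by (simp add: julia_def)
qed

lemma julia_subset: "julia \<subseteq> E1 \<tau>"
  unfolding julia_def by (auto dest: spec[of _ 0])

lemma ratmap_julia: "v \<in> julia \<Longrightarrow> ratmap \<tau> v \<in> julia"
  unfolding julia_def by (auto dest: spec[of _ "Suc _"] simp: funpow_swap1)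

text \<open>An iterate of \<pi> is continuous only where the earlier iterates avoid the pole 0. So
  closedness of the set of points staying in \<open>E1\<close> for n steps and continuity of the
  next iterate on it are proved together.\<close>

lemma compact_julia: "compact julia"
proof -
  have "closed {v. \<forall>i\<le>n. (ratmap \<tau> ^^ i) v \<in> E1 \<tau>} \<and>
     continuous_on {v. \<forall>i\<le>n. (ratmap \<tau> ^^ i) v \<in> E1 \<tau>} (ratmap \<tau> ^^ Suc n)" for n
  proof (induction n)
    case 0
    have "continuous_on (E1 \<tau>) (ratmap \<tau>)"
      unfolding ratmap_def by (intro continuous_intros) (simp add: E1_def)
    then show ?case using compact_E1 by (simp add: compact_imp_closed)
  next
    case (Suc n)
    let ?S = "\<lambda>n. {v. \<forall>i\<le>n. (ratmap \<tau> ^^ i) v \<in> E1 \<tau>}"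
    have eq: "?S (Suc n) = ?S n \<inter> (ratmap \<tau> ^^ Suc n) -` E1 \<tau>"
      by (auto simp: le_Suc_eq simp del: funpow.simps)
    have cl: "closed (?S (Suc n))"
      unfolding eq using Suc.IH compact_imp_closed[OF compact_E1] by (intro continuous_closed_preimage) auto
    have "continuous_on ((ratmap \<tau> ^^ Suc n) ` ?S (Suc n)) (ratmap \<tau>)"
      unfolding ratmap_def by (intro continuous_intros) (auto simp: E1_def simp del: funpow.simps)
    moreover have "continuous_on (?S (Suc n)) (ratmap \<tau> ^^ Suc n)"
      by (rule continuous_on_subset[OF conjunct2[OF Suc.IH]]) (unfold eq, rule Int_lower1)
    ultimately have "continuous_on (?S (Suc n)) (ratmap \<tau> \<circ> (ratmap \<tau> ^^ Suc n))"
      by (intro continuous_on_compose)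
    with cl show ?case unfolding funpow.simps(2)[of "Suc n"] by (rule conjI)
  qed
  then have "closed (\<Inter>n. {v. \<forall>i\<le>n. (ratmap \<tau> ^^ i) v \<in> E1 \<tau>})" by blast
  also have "(\<Inter>n. {v. \<forall>i\<le>n. (ratmap \<tau> ^^ i) v \<in> E1 \<tau>}) = julia"
    by (auto simp: julia_def)
  finally have "closed julia" .
  then have "compact (E1 \<tau> \<inter> julia)" using compact_E1 by (rule compact_Int_closed[rotated])
  then show ?thesis using julia_subset by (simp add: Int_absorb1)
qed

section \<open>The eigen-measure as an image of fair coin tossing\<close>

definition coin_space :: "bool stream measure" where
  "coin_space = stream_space (measure_pmf (bernoulli_pmf (1 / 2)))"

lemma prob_space_coin_space: "prob_space coin_space"
  unfolding coin_space_def by (rule prob_space.prob_space_stream_space) (rule measure_pmf.prob_space_axioms)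

lemma measurable_shd_coin: "shd \<in> measurable coin_space (count_space UNIV)"
  unfolding coin_space_def
  using measurable_shd[of "measure_pmf (bernoulli_pmf (1 / 2))"] by (simp cong: measurable_cong_sets)

lemma measurable_stl_coin: "stl \<in> measurable coin_space coin_space"
  unfolding coin_space_def by (rule measurable_stl)

lemma measurable_approx: "coding_approx n \<in> borel_measurable coin_space"
proof (induction n)
  case (Suc n)
  have [measurable]: "(\<lambda>\<omega>. coding_approx n (stl \<omega>)) \<in> borel_measurable coin_space"
    using measurable_compose[OF measurable_stl_coin Suc.IH] .
  have [measurable]: "Measurable.pred coin_space shd" by (rule measurable_shd_coin)
  have "(\<lambda>\<omega>. if shd \<omega> then branch \<tau> True (coding_approx n (stl \<omega>)) else branch \<tau> False (coding_approx n (stl \<omega>)))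
      \<in> borel_measurable coin_space"
    by measurable
  also have "(\<lambda>\<omega>. if shd \<omega> then branch \<tau> True (coding_approx n (stl \<omega>)) else branch \<tau> False (coding_approx n (stl \<omega>))) = coding_approx (Suc n)"
    by (auto simp: fun_eq_iff)
  finally show ?case .
qed (simp add: coding_approx.simps(1)[abs_def])

lemma measurable_coding: "coding \<in> borel_measurable coin_space"
  by (rule borel_measurable_LIMSEQ_real[OF coding_approx_tendsto measurable_approx])

definition eigen :: "real measure" where
  "eigen = distr coin_space borel coding"

lemma sets_eigen [simp, measurable_cong]: "sets eigen = sets borel"
  by (simp add: eigen_def)

lemma prob_space_eigen: "prob_space eigen"
  unfolding eigen_def by (rule prob_space.prob_space_distr[OF prob_space_coin_space measurable_coding])

lemma AE_eigen_julia: "AE v in eigen. v \<in> julia"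
  unfolding eigen_def
  by (subst AE_distr_iff[OF measurable_coding])
    (use coding_in_julia compact_imp_closed[OF compact_julia] in \<open>auto intro: borel_closed\<close>)

text \<open>Conditions on the first toss: it selects a branch with probability 1/2, and the
  remaining tosses have the law of the whole sequence.\<close>

lemma nn_integral_eigen:
  assumes [measurable]: "f \<in> borel_measurable borel"
  shows "(\<integral>\<^sup>+v. f v \<partial>eigen) = ((\<integral>\<^sup>+v. f (branch \<tau> True v) \<partial>eigen) + (\<integral>\<^sup>+v. f (branch \<tau> False v) \<partial>eigen)) / 2"
proof -
  note [measurable] = measurable_coding
  have d: "(\<integral>\<^sup>+v. h v \<partial>eigen) = (\<integral>\<^sup>+\<omega>. h (coding \<omega>) \<partial>coin_space)" if "h \<in> borel_measurable borel" for h
    unfolding eigen_def using that by (intro nn_integral_distr measurable_coding) simp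
  have "(\<integral>\<^sup>+\<omega>. f (coding \<omega>) \<partial>coin_space) =
      (\<integral>\<^sup>+b. (\<integral>\<^sup>+\<omega>. f (coding (b ## \<omega>)) \<partial>coin_space) \<partial>measure_pmf (bernoulli_pmf (1 / 2)))"
    unfolding coin_space_def
    by (rule prob_space.nn_integral_stream_space[OF measure_pmf.prob_space_axioms])
      (use measurable_compose[OF measurable_coding assms] in \<open>simp add: coin_space_def\<close>)
  also have "\<dots> = (\<integral>\<^sup>+b. (\<integral>\<^sup>+\<omega>. f (branch \<tau> b (coding \<omega>)) \<partial>coin_space) \<partial>measure_pmf (bernoulli_pmf (1 / 2)))"
    by (simp only: coding_unfold[of "_ ## _"] stream.sel)
  finally have "(\<integral>\<^sup>+\<omega>. f (coding \<omega>) \<partial>coin_space) =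
      (\<integral>\<^sup>+b. (\<integral>\<^sup>+\<omega>. f (branch \<tau> b (coding \<omega>)) \<partial>coin_space) \<partial>measure_pmf (bernoulli_pmf (1 / 2)))" .
  moreover have "ennreal (1 / 2) = inverse 2" using inverse_ennreal[of 2] by simp
  ultimately show ?thesis by (simp add: d divide_ennreal_def distrib_right)
qed

text \<open>Adding the bound C makes the integrand nonnegative, which reduces the claim to the
  version for nonnegative integrals.\<close>

lemma integral_eigen:
  fixes f :: "real \<Rightarrow> real"
  assumes [measurable]: "f \<in> borel_measurable borel" and bound: "\<And>v. \<bar>f v\<bar> \<le> C"
  shows "(\<integral>v. f v \<partial>eigen) = (\<integral>v. (f (branch \<tau> True v) + f (branch \<tau> False v)) / 2 \<partial>eigen)"
proof -
  interpret prob_space eigen by (rule prob_space_eigen)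
  have int: "integrable eigen (\<lambda>v. h v)" if "h \<in> borel_measurable borel" "\<And>v. \<bar>h v\<bar> \<le> D" for D and h :: "real \<Rightarrow> real"
    using that by (intro integrable_const_bound[of _ D]) auto
  have nonneg: "0 \<le> f v + C" for v using bound[of v] by (simp add: abs_le_iff)
  have C: "C \<ge> 0" using bound[of 0] by linarith
  have b: "\<bar>f v + C\<bar> \<le> 2 * C" for v using bound[of v] by linarith
  have i: "integrable eigen (\<lambda>v. f v + C)" "integrable eigen (\<lambda>v. f (branch \<tau> b v) + C)"
    "integrable eigen (\<lambda>v. f (branch \<tau> b v))" "integrable eigen f" for b
    by (rule int[of _ "2 * C"] int[of _ C]; use b bound in simp)+
  define I where "I b = (\<integral>v. f (branch \<tau> b v) + C \<partial>eigen)" for b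
  have I0: "I b \<ge> 0" for b unfolding I_def using nonneg by simp
  have "ennreal (\<integral>v. f v + C \<partial>eigen) = (\<integral>\<^sup>+v. ennreal (f v + C) \<partial>eigen)"
    by (rule nn_integral_eq_integral[symmetric]) (use i nonneg in auto)
  also have "\<dots> = ((\<integral>\<^sup>+v. ennreal (f (branch \<tau> True v) + C) \<partial>eigen) + (\<integral>\<^sup>+v. ennreal (f (branch \<tau> False v) + C) \<partial>eigen)) / 2"
    by (rule nn_integral_eigen) simp
  also have "\<dots> = (ennreal (I True) + ennreal (I False)) / 2"
    unfolding I_def by (subst (1 2) nn_integral_eq_integral) (use i nonneg in auto)
  also have "\<dots> = ennreal ((I True + I False) / 2)"
    using I0 by (simp add: ennreal_plus[symmetric] divide_ennreal[symmetric] del: ennreal_plus)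
  finally have "(\<integral>v. f v + C \<partial>eigen) = (I True + I False) / 2"
    using I0 nonneg by (subst (asm) ennreal_inj) auto
  then have "(\<integral>v. f v \<partial>eigen) + C = ((\<integral>v. f (branch \<tau> True v) \<partial>eigen) + C + ((\<integral>v. f (branch \<tau> False v) \<partial>eigen) + C)) / 2"
    using i by (simp add: I_def prob_space)
  then show ?thesis using i by (simp add: field_simps)
qed

lemma is_eigen_measure_eigen: "is_eigen_measure \<tau> eigen"
  unfolding is_eigen_measure_def
proof (intro conjI allI impI)
  show "AE v in eigen. v \<in> E1 \<tau>" using AE_eigen_julia julia_subset by (auto elim: eventually_mono)
  fix f :: "real \<Rightarrow> real" assume f: "continuous_on (E1 \<tau>) f"
  \<comment> \<open>\<open>f\<close> is controlled only on \<open>E1\<close>; its cut-off is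
    globally measurable and bounded. Over points of \<open>E0\<close> both branches land in
    \<open>E1\<close>, so the cut-off does not change the Ruelle average there.\<close>
  define h where "h v = indicator (E1 \<tau>) v *\<^sub>R f v" for v
  have h: "h \<in> borel_measurable borel"
    unfolding h_def using f compact_E1
    by (intro borel_measurable_continuous_on_indicator) (auto intro: borel_closed compact_imp_closed)
  have "bounded (f ` E1 \<tau>)" using f compact_E1 by (intro compact_imp_bounded compact_continuous_image)
  then obtain C where C: "C > 0" "\<And>v. v \<in> E1 \<tau> \<Longrightarrow> \<bar>f v\<bar> \<le> C" by (auto simp: bounded_pos)
  have bound: "\<bar>h v\<bar> \<le> C" for v using C by (auto simp: h_def indicator_def)
  have "set_lebesgue_integral eigen (E1 \<tau>) f = (\<integral>v. h v \<partial>eigen)"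
    by (simp add: set_lebesgue_integral_def h_def)
  also have "\<dots> = (\<integral>v. (h (branch \<tau> True v) + h (branch \<tau> False v)) / 2 \<partial>eigen)"
    by (rule integral_eigen[OF h bound])
  also have "\<dots> = (\<integral>v. indicator E0 v *\<^sub>R ((h (branch \<tau> True v) + h (branch \<tau> False v)) / 2) \<partial>eigen)"
    using h
    by (intro integral_cong_AE) (use AE_eigen_julia julia_subset E1_subset in \<open>auto elim!: eventually_mono\<close>)
  also have "\<dots> = set_lebesgue_integral eigen E0 (ruelle \<tau> f)"
    unfolding set_lebesgue_integral_def
    by (intro Bochner_Integration.integral_cong) (auto simp: indicator_def ruelle_eq h_def branch_in_E1)
  finally show "set_lebesgue_integral eigen (E1 \<tau>) f = set_lebesgue_integral eigen E0 (ruelle \<tau> f)" .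
qed (auto intro: prob_space_eigen)

end

section \<open>Moments\<close>

lemma perturbed_contraction_tendsto_zero:
  fixes d e :: "nat \<Rightarrow> real"
  assumes q: "0 \<le> q" "q < 1" and d: "\<And>n. 0 \<le> d n" "\<And>n. d (Suc n) \<le> q * d n + e n" and e: "e \<longlonglongrightarrow> 0"
  shows "d \<longlonglongrightarrow> 0"
proof (rule LIMSEQ_I)
  fix \<epsilon> :: real assume "\<epsilon> > 0"
  \<comment> \<open>With errors below this threshold, \<epsilon>/2 is a fixed point of the
    majorising recursion t \<mapsto> q t + (1 - q) \<epsilon>/2.\<close>
  then have "\<epsilon> / 2 * (1 - q) > 0" using q by simp
  from LIMSEQ_D[OF e this] obtain N where N: "\<And>n. n \<ge> N \<Longrightarrow> \<bar>e n\<bar> < \<epsilon> / 2 * (1 - q)" by auto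
  have bound: "d (N + k) \<le> \<epsilon> / 2 + q ^ k * d N" for k
  proof (induction k)
    case (Suc k)
    have "d (N + Suc k) \<le> q * d (N + k) + e (N + k)" using d(2)[of "N + k"] by simp
    also have "\<dots> \<le> q * (\<epsilon> / 2 + q ^ k * d N) + \<epsilon> / 2 * (1 - q)"
      using N[of "N + k"] Suc.IH q by (intro add_mono mult_left_mono) auto
    also have "\<dots> = \<epsilon> / 2 + q ^ Suc k * d N" by (simp add: field_simps)
    finally show ?case .
  qed (use \<open>\<epsilon> > 0\<close> in simp)
  have "(\<lambda>k. q ^ k * d N) \<longlonglongrightarrow> 0 * d N" using q by (intro tendsto_intros LIMSEQ_power_zero) auto
  then have "\<exists>k0. \<forall>k\<ge>k0. norm (q ^ k * d N - 0) < \<epsilon> / 2" using \<open>\<epsilon> > 0\<close> by (intro LIMSEQ_D) auto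
  then obtain k0 where k0: "\<And>k. k \<ge> k0 \<Longrightarrow> q ^ k * d N < \<epsilon> / 2" by fastforce
  show "\<exists>no. \<forall>n\<ge>no. norm (d n - 0) < \<epsilon>"
  proof (intro exI allI impI)
    fix n assume n: "n \<ge> N + k0"
    have "d (N + (n - N)) \<le> \<epsilon> / 2 + q ^ (n - N) * d N" by (rule bound)
    also have "q ^ (n - N) * d N < \<epsilon> / 2" using n by (intro k0) simp
    finally show "norm (d n - 0) < \<epsilon>" using n d(1)[of n] by simp
  qed
qed

text \<open>The limit is the fixed point of x \<mapsto> L x + w with w the limit of
  \<open>z\<close>; the distance to it obeys the scalar recursion.\<close>

lemma perturbed_contraction_convergent:
  fixes L :: "'a::{banach} \<Rightarrow> 'a"
  assumes L: "linear L" "\<And>x. norm (L x) \<le> q * norm x" "0 \<le> q" "q < 1"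
    and y: "\<And>n. y (Suc n) = L (y n) + z n" and z: "convergent z"
  shows "convergent y"
proof -
  interpret L: linear L by fact
  obtain w where w: "z \<longlonglongrightarrow> w" using z by (auto simp: convergent_def)
  have "\<exists>!x. L x + w = x"
  proof (rule banach_fix_type[OF L(3,4)])
    show "\<forall>x y. dist (L x + w) (L y + w) \<le> q * dist x y"
      using L(2) by (simp add: dist_norm L.diff[symmetric])
  qed
  then obtain x where x: "L x + w = x" by blast
  have "(\<lambda>n. norm (y n - x)) \<longlonglongrightarrow> 0"
  proof (rule perturbed_contraction_tendsto_zero[OF L(3,4)])
    show "norm (y (Suc n) - x) \<le> q * norm (y n - x) + norm (z n - w)" for n
    proof -
      have "y (Suc n) - x = L (y n - x) + (z n - w)" using x by (simp add: y L.diff algebra_simps)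
      then show ?thesis using norm_triangle_ineq[of "L (y n - x)" "z n - w"] L(2)[of "y n - x"] by simp
    qed
    show "(\<lambda>n. norm (z n - w)) \<longlonglongrightarrow> 0" using w by (simp add: LIM_zero tendsto_norm_zero)
  qed auto
  then have "y \<longlonglongrightarrow> x" by (simp add: LIM_zero_iff tendsto_norm_zero_iff)
  then show ?thesis by (auto simp: convergent_def)
qed

lemma coef_factor_bound:
  assumes "\<tau> > 1"
  shows "0 \<le> coef_factor \<tau> (Suc n)" "coef_factor \<tau> (Suc n) < 1"
proof -
  have "\<tau> ^ Suc n > 1" using assms by (intro one_less_power) auto
  then show "0 \<le> coef_factor \<tau> (Suc n)" "coef_factor \<tau> (Suc n) < 1"
    by (simp_all add: coef_factor_def divide_less_eq del: power_Suc)
qed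

text \<open>\<open>even_coef \<tau>\<close> is triangular on polynomials, and its diagonal entries are less than 1 except
  on the constants.\<close>

lemma even_coef_decay:
  fixes \<delta> :: "nat \<Rightarrow> complex poly \<Rightarrow> complex"
  assumes "\<tau> > 1" and add: "\<And>n f g. \<delta> n (f + g) = \<delta> n f + \<delta> n g" and smult: "\<And>n a f. \<delta> n (smult a f) = a * \<delta> n f"
    and step: "\<And>n f. \<delta> (Suc n) f = \<delta> n (even_coef \<tau> f)" and one: "\<And>n. \<delta> n 1 = 0"
  shows "(\<lambda>n. \<delta> n f) \<longlonglongrightarrow> 0"
proof -
  have "\<forall>i>p. coeff f i = 0 \<Longrightarrow> (\<lambda>n. \<delta> n f) \<longlonglongrightarrow> 0" for p
  proof (induction p arbitrary: f)
    case 0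
    then have "f = smult (coeff f 0) 1" by (intro poly_eqI) (auto simp: coeff_pCons split: nat.split)
    then have "\<delta> n f = 0" for n by (metis smult one mult_zero_right)
    then show ?case by simp
  next
    case (Suc p)
    define q where "q = coef_factor \<tau> (Suc p)"
    have q: "0 \<le> q" "q < 1" using coef_factor_bound[OF assms(1)] by (simp_all add: q_def)
    \<comment> \<open>Removing the diagonal part leaves lower degree, so the induction hypothesis
      makes \<open>g\<close> a vanishing perturbation of a contraction with factor q.\<close>
    define g where "g = even_coef \<tau> f - smult (of_real q) f"
    have deg: "\<forall>i>Suc p. coeff (even_coef \<tau> f) i = 0" "coeff (even_coef \<tau> f) (Suc p) = of_real q * coeff f (Suc p)"
      using coef_degree[of \<tau> "Suc p" f] Suc.prems assms(1) by (auto simp: q_def)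
    have "coeff g i = 0" if "i > p" for i
      using that deg Suc.prems by (cases "i = Suc p") (auto simp: g_def)
    then have g: "(\<lambda>n. \<delta> n g) \<longlonglongrightarrow> 0" by (intro Suc.IH) auto
    have "\<delta> (Suc n) f = of_real q * \<delta> n f + \<delta> n g" for n
      unfolding step add[symmetric] smult[symmetric] by (simp add: g_def)
    then have "cmod (\<delta> (Suc n) f) \<le> q * cmod (\<delta> n f) + cmod (\<delta> n g)" for n
      using norm_triangle_ineq[of "of_real q * \<delta> n f" "\<delta> n g"] q by (simp add: norm_mult)
    then have "(\<lambda>n. cmod (\<delta> n f)) \<longlonglongrightarrow> 0"
      by (rule perturbed_contraction_tendsto_zero[OF q norm_ge_zero _ tendsto_norm_zero[OF g]])
    then show ?case by (rule tendsto_norm_zero_cancel)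
  qed
  from this[of "degree f"] show ?thesis by (simp add: coeff_eq_0)
qed

abbreviation rpoly :: "complex poly \<Rightarrow> real \<Rightarrow> complex" where
  "rpoly p v \<equiv> poly p (complex_of_real v)"

lemma Weierstrass_complex_poly:
  fixes f :: "real \<Rightarrow> complex"
  assumes K: "compact K" and f: "continuous_on K f" and e: "e > 0"
  shows "\<exists>p. \<forall>v\<in>K. cmod (f v - rpoly p v) < e"
proof -
  have real: "\<exists>p. \<forall>v\<in>K. cmod (of_real (g v) - rpoly p v) < e / 2"
    if g: "continuous_on K g" for g :: "real \<Rightarrow> real"
  proof -
    have "e / 2 > 0" using e by simp
    then obtain h where h: "real_polynomial_function h" "\<And>v. v \<in> K \<Longrightarrow> \<bar>g v - h v\<bar> < e / 2"
      using Stone_Weierstrass_real_polynomial_function[OF K g] by metis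
    obtain a n where a: "h = (\<lambda>x. \<Sum>i\<le>n. a i * x ^ i)" using h(1) real_polynomial_function_iff_sum by blast
    define p where "p = (\<Sum>i\<le>n. monom (complex_of_real (a i)) i)"
    have "rpoly p v = of_real (h v)" for v by (simp add: p_def a poly_sum poly_monom)
    then have "cmod (of_real (g v) - rpoly p v) < e / 2" if "v \<in> K" for v
      using h(2)[OF that] by (metis norm_of_real of_real_diff real_norm_def)
    then show ?thesis by blast
  qed
  have "continuous_on K (\<lambda>v. Re (f v))" "continuous_on K (\<lambda>v. Im (f v))" using f by (auto intro: continuous_intros)
  from this[THEN real] obtain p q where p: "\<forall>v\<in>K. cmod (of_real (Re (f v)) - rpoly p v) < e / 2"
    and q: "\<forall>v\<in>K. cmod (of_real (Im (f v)) - rpoly q v) < e / 2" by blast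
  have "cmod (f v - rpoly (p + smult \<i> q) v) < e" if "v \<in> K" for v
  proof -
    have "f v - rpoly (p + smult \<i> q) v =
        (of_real (Re (f v)) - rpoly p v) + \<i> * (of_real (Im (f v)) - rpoly q v)"
      using complex_eq[of "f v"] by (simp add: algebra_simps)
    also have "cmod \<dots> \<le> cmod (of_real (Re (f v)) - rpoly p v) + cmod (\<i> * (of_real (Im (f v)) - rpoly q v))"
      by (rule norm_triangle_ineq)
    also have "\<dots> < e / 2 + e / 2" using p q that by (intro add_strict_mono) (auto simp: norm_mult)
    finally show ?thesis by simp
  qed
  then show ?thesis by blast
qed

lemma borel_measurable_poly [measurable]: "(rpoly p) \<in> borel_measurable borel"
  by (intro borel_measurable_continuous_onI continuous_intros)

section \<open>Measures on a compact set and their polynomial moments\<close>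

locale compact_prob = prob_space \<mu> for \<mu> :: "real measure" +
  fixes K :: "real set"
  assumes sets_mu [measurable_cong, simp]: "sets \<mu> = sets borel"
    and compact_K: "compact K" and AE_K: "AE v in \<mu>. v \<in> K"
begin

lemma integrable_continuous:
  fixes f :: "real \<Rightarrow> complex"
  assumes "f \<in> borel_measurable borel" "continuous_on K f"
  shows "integrable \<mu> f"
proof -
  have "bounded (f ` K)" using assms(2) compact_K by (intro compact_imp_bounded compact_continuous_image)
  then obtain C where "\<And>v. v \<in> K \<Longrightarrow> norm (f v) \<le> C" by (auto simp: bounded_pos)
  then show ?thesis
    using AE_K assms(1) by (intro integrable_const_bound[of _ C]) (auto elim: eventually_mono)
qed

lemma integrable_poly: "integrable \<mu> (rpoly p)"
  by (rule integrable_continuous) (auto intro!: continuous_intros)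

lemma norm_integral_le:
  fixes f :: "real \<Rightarrow> complex"
  assumes "integrable \<mu> f" "\<And>v. v \<in> K \<Longrightarrow> cmod (f v) \<le> e"
  shows "cmod (\<integral>v. f v \<partial>\<mu>) \<le> e"
proof -
  have "cmod (\<integral>v. f v \<partial>\<mu>) \<le> (\<integral>v. cmod (f v) \<partial>\<mu>)" by (rule integral_norm_bound)
  also have "\<dots> \<le> (\<integral>v. e \<partial>\<mu>)"
    using assms AE_K by (intro integral_mono_AE) (auto elim: eventually_mono)
  finally show ?thesis by (simp add: prob_space)
qed

lemma norm_integral_diff_le:
  fixes f g :: "real \<Rightarrow> complex"
  assumes "integrable \<mu> f" "integrable \<mu> g" "\<And>v. v \<in> K \<Longrightarrow> cmod (f v - g v) \<le> e"
  shows "cmod ((\<integral>v. f v \<partial>\<mu>) - (\<integral>v. g v \<partial>\<mu>)) \<le> e"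
  using norm_integral_le[of "\<lambda>v. f v - g v" e] assms by simp

end

text \<open>Polynomials approximate each exponential uniformly on K, so equal moments force equal
  characteristic functions.\<close>

lemma compact_prob_eqI:
  assumes "compact_prob \<mu> K" "compact_prob \<nu> K"
    and moments: "\<And>p. (\<integral>v. rpoly p v \<partial>\<mu>) = (\<integral>v. rpoly p v \<partial>\<nu>)"
  shows "\<mu> = \<nu>"
proof (rule Levy_uniqueness)
  interpret M: compact_prob \<mu> K by fact
  interpret N: compact_prob \<nu> K by fact
  show "real_distribution \<mu>" "real_distribution \<nu>" by unfold_locales simp_all
  show "char \<mu> = char \<nu>"
  proof
    fix t
    have meas: "(\<lambda>v. iexp (t * v)) \<in> borel_measurable borel"
      by (intro borel_measurable_continuous_onI continuous_intros)
    have cont: "continuous_on K (\<lambda>v. iexp (t * v))" by (intro continuous_intros)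
    have close: "cmod (char \<mu> t - char \<nu> t) \<le> e + e" if "e > 0" for e
    proof -
      obtain p where p: "\<forall>v\<in>K. cmod (iexp (t * v) - rpoly p v) < e"
        using Weierstrass_complex_poly[OF M.compact_K cont \<open>e > 0\<close>] by blast
      have "cmod (char \<mu> t - (\<integral>v. rpoly p v \<partial>\<mu>)) \<le> e" "cmod (char \<nu> t - (\<integral>v. rpoly p v \<partial>\<nu>)) \<le> e"
        unfolding char_def
        by (rule M.norm_integral_diff_le[OF M.integrable_continuous[OF meas cont] M.integrable_poly]
            N.norm_integral_diff_le[OF N.integrable_continuous[OF meas cont] N.integrable_poly],
            use p less_imp_le in blast)+
      then show ?thesis
        unfolding moments using norm_triangle_ineq4[of "char \<mu> t - (\<integral>v. rpoly p v \<partial>\<nu>)" "char \<nu> t - (\<integral>v. rpoly p v \<partial>\<nu>)"]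
        by simp
    qed
    show "char \<mu> t = char \<nu> t"
    proof (rule ccontr)
      assume "char \<mu> t \<noteq> char \<nu> t"
      then show False using close[of "cmod (char \<mu> t - char \<nu> t) / 4"] by simp
    qed
  qed
qed

lemma eigen_compact_prob:
  assumes "\<tau> > 1" "is_eigen_measure \<tau> \<mu>"
  shows "compact_prob \<mu> (E1 \<tau>)"
  using assms compact_E1[OF assms(1)]
  by (auto simp: is_eigen_measure_def compact_prob_def compact_prob_axioms_def)

lemma eigen_integral_poly:
  assumes \<tau>: "\<tau> > 1" and \<mu>: "is_eigen_measure \<tau> \<mu>"
  shows "(\<integral>v. rpoly f v \<partial>\<mu>) = (\<integral>v. rpoly (even_coef \<tau> f) v \<partial>\<mu>)"
proof -
  interpret compact_prob \<mu> "E1 \<tau>" by (rule eigen_compact_prob[OF assms])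
  have AE0: "AE v in \<mu>. v \<in> E0" using AE_K E1_subset[OF \<tau>] by (auto elim!: eventually_mono simp del: atLeastAtMost_iff)
  have meas_E1 [measurable]: "E1 \<tau> \<in> sets borel" using compact_K by (auto intro: borel_closed compact_imp_closed)
  \<comment> \<open>The root terms of the two branches are opposite, which leaves the even part: on
    polynomials the Ruelle operator is \<open>even_coef \<tau>\<close>.\<close>
  have avg: "(rpoly f (branch \<tau> True x) + rpoly f (branch \<tau> False x)) / 2 = rpoly (even_coef \<tau> f) x" for x
  proof -
    have "rpoly f (branch \<tau> b x) = rpoly (even_coef \<tau> f) x +
        of_real (2 * \<tau> * branch \<tau> b x - x) * rpoly (odd_coef \<tau> f) x" for b
    proof -
      have "complex_of_real (\<tau> * branch \<tau> b x * branch \<tau> b x) = of_real (x * branch \<tau> b x + (\<tau> - 1))"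
        unfolding branch_root[OF \<tau>] ..
      then show ?thesis
        using poly_coef[of \<tau> "complex_of_real (branch \<tau> b x)" "complex_of_real x" f] \<tau> by simp
    qed
    note root = this
    show ?thesis
      unfolding root[of True] root[of False] branch_add[OF \<tau>] of_real_minus by (simp del: of_real_diff of_real_mult)
  qed
  \<comment> \<open>The eigen-measure equation concerns real functions, so L stands for the real or
    the imaginary part.\<close>
  have real: "(\<integral>v. L (rpoly f v) \<partial>\<mu>) = (\<integral>v. L (rpoly (even_coef \<tau> f) v) \<partial>\<mu>)"
    if L: "bounded_linear L" for L :: "complex \<Rightarrow> real"
  proof -
    interpret L: bounded_linear L by fact
    have contL: "continuous_on S (\<lambda>v. L (rpoly p v))" for S p
      by (intro L.continuous_on continuous_intros)
    have [measurable]: "(\<lambda>v. L (rpoly p v)) \<in> borel_measurable borel" for p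
      by (intro borel_measurable_continuous_onI contL)
    have "(\<integral>v. L (rpoly f v) \<partial>\<mu>) = set_lebesgue_integral \<mu> (E1 \<tau>) (\<lambda>v. L (rpoly f v))"
      unfolding set_lebesgue_integral_def
      by (intro integral_cong_AE) (use AE_K in \<open>auto elim: eventually_mono\<close>)
    also have "\<dots> = set_lebesgue_integral \<mu> E0 (ruelle \<tau> (\<lambda>v. L (rpoly f v)))"
      using \<mu> contL unfolding is_eigen_measure_def by blast
    also have "ruelle \<tau> (\<lambda>v. L (rpoly f v)) = (\<lambda>v. L (rpoly (even_coef \<tau> f) v))"
    proof
      fix x
      have "L ((1 / 2) *\<^sub>R (rpoly f (branch \<tau> True x) + rpoly f (branch \<tau> False x))) = L (rpoly (even_coef \<tau> f) x)"
        unfolding avg[symmetric] by (simp add: scaleR_conv_of_real)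
      then show "ruelle \<tau> (\<lambda>v. L (rpoly f v)) x = L (rpoly (even_coef \<tau> f) x)"
        by (simp only: L.scaleR L.add ruelle_eq[OF \<tau>]) simp
    qed
    also have "set_lebesgue_integral \<mu> E0 \<dots> = (\<integral>v. L (rpoly (even_coef \<tau> f) v) \<partial>\<mu>)"
      unfolding set_lebesgue_integral_def
      by (intro integral_cong_AE) (use AE0 in \<open>auto elim: eventually_mono\<close>)
    finally show ?thesis .
  qed
  have "Re (\<integral>v. rpoly f v \<partial>\<mu>) = Re (\<integral>v. rpoly (even_coef \<tau> f) v \<partial>\<mu>)"
    "Im (\<integral>v. rpoly f v \<partial>\<mu>) = Im (\<integral>v. rpoly (even_coef \<tau> f) v \<partial>\<mu>)"
    using real[OF bounded_linear_Re] real[OF bounded_linear_Im] integrable_poly by simp_all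
  then show ?thesis by (rule complex_eqI)
qed

lemma eigen_measure_unique:
  assumes \<tau>: "\<tau> > 1" and \<mu>: "is_eigen_measure \<tau> \<mu>" and \<nu>: "is_eigen_measure \<tau> \<nu>"
  shows "\<mu> = \<nu>"
proof (rule compact_prob_eqI)
  show "compact_prob \<mu> (E1 \<tau>)" "compact_prob \<nu> (E1 \<tau>)" using assms eigen_compact_prob by auto
  then interpret M: compact_prob \<mu> "E1 \<tau>" + N: compact_prob \<nu> "E1 \<tau>" .
  fix p
  define \<delta> where "\<delta> f = (\<integral>v. rpoly f v \<partial>\<mu>) - (\<integral>v. rpoly f v \<partial>\<nu>)" for f
  \<comment> \<open>The difference of the two moment functionals is invariant under
    \<open>even_coef\<close>, so the decay result applies to a constant sequence and forces it to
    vanish.\<close>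
  have "(\<lambda>n::nat. \<delta> p) \<longlonglongrightarrow> 0"
  proof (rule even_coef_decay[OF \<tau>])
    show "\<delta> (f + g) = \<delta> f + \<delta> g" for f g by (simp add: \<delta>_def M.integrable_poly N.integrable_poly)
    show "\<delta> (smult a f) = a * \<delta> f" for a f by (simp add: \<delta>_def M.integrable_poly N.integrable_poly algebra_simps)
    show "\<delta> f = \<delta> (even_coef \<tau> f)" for f by (simp add: \<delta>_def eigen_integral_poly[OF \<tau> \<mu>, of f] eigen_integral_poly[OF \<tau> \<nu>, of f])
    show "\<delta> 1 = 0" by (simp add: \<delta>_def M.prob_space N.prob_space)
  qed
  then have "\<delta> p = 0" by (simp add: LIMSEQ_const_iff)
  then show "(\<integral>v. rpoly p v \<partial>\<mu>) = (\<integral>v. rpoly p v \<partial>\<nu>)" by (simp add: \<delta>_def)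
qed

section \<open>Convergence of the iteration\<close>

instance ell2 :: banach ..

lemma convergent_cnj: "convergent f \<Longrightarrow> convergent (\<lambda>n. cnj (f n))"
  unfolding convergent_def using tendsto_cnj by blast

lemma convergent_scaleC: "convergent a \<Longrightarrow> convergent x \<Longrightarrow> convergent (\<lambda>n. a n *\<^sub>C x n)"
  unfolding convergent_def using scaleC.tendsto by blast

lemma convergent_ell2_add: "convergent x \<Longrightarrow> convergent y \<Longrightarrow> convergent (\<lambda>n. x n + y n)" for x y :: "nat \<Rightarrow> ell2"
  unfolding convergent_def using tendsto_add by blast

lemma convergent_ev_od: "convergent x \<Longrightarrow> convergent y \<Longrightarrow> convergent (\<lambda>n. ev (x n) + od (y n))"
  unfolding convergent_def using tendsto_ev tendsto_od tendsto_add by blast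

text \<open>The support bound is uniform in n, so coordinatewise convergence is norm convergence.
  Gram-Schmidt vectors along the iteration are of this kind.\<close>

definition finitely_convergent :: "nat \<Rightarrow> (nat \<Rightarrow> ell2) \<Rightarrow> bool" where
  "finitely_convergent N x \<longleftrightarrow> (\<forall>n. \<forall>j>N. coord (x n) j = 0) \<and> (\<forall>j. convergent (\<lambda>n. coord (x n) j))"

lemma finitely_convergent_expand:
  "finitely_convergent N x \<Longrightarrow> x n = (\<Sum>j\<le>N. coord (x n) j *\<^sub>C ket j)"
  by (rule ket_expansion_finite) (simp add: finitely_convergent_def)

lemma finitely_convergent_imp_convergent:
  assumes "finitely_convergent N x" shows "convergent x"
proof -
  have "convergent (\<lambda>n. \<Sum>j\<le>N. coord (x n) j *\<^sub>C ket j)"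
    using assms by (intro convergent_sum convergent_scaleC convergent_const) (simp add: finitely_convergent_def)
  then show ?thesis unfolding finitely_convergent_expand[OF assms, symmetric] .
qed

lemma finitely_convergent_ket: "k \<le> N \<Longrightarrow> finitely_convergent N (\<lambda>n. ket k)"
  by (auto simp: finitely_convergent_def coord_ket convergent_const)

lemma finitely_convergent_0: "finitely_convergent N (\<lambda>n. 0)"
  by (auto simp: finitely_convergent_def convergent_const)

lemma finitely_convergent_diff:
  "finitely_convergent N x \<Longrightarrow> finitely_convergent N y \<Longrightarrow> finitely_convergent N (\<lambda>n. x n - y n)"
  by (auto simp: finitely_convergent_def convergent_diff)

lemma finitely_convergent_scaleC:
  "convergent a \<Longrightarrow> finitely_convergent N x \<Longrightarrow> finitely_convergent N (\<lambda>n. a n *\<^sub>C x n)"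
  by (auto simp: finitely_convergent_def convergent_mult)

lemma finitely_convergent_sum:
  "(\<And>i. i \<in> S \<Longrightarrow> finitely_convergent N (x i)) \<Longrightarrow> finitely_convergent N (\<lambda>n. \<Sum>i\<in>S. x i n)"
  by (auto simp: finitely_convergent_def intro: convergent_sum)

locale uniformly_bounded =
  fixes F :: "nat \<Rightarrow> ell2 \<Rightarrow> ell2" and K :: real
  assumes bounded_clinear_F: "bounded_clinear (F n)" and norm_F: "norm (F n x) \<le> K * norm x"
begin

lemma linear_F: "F n (x + y) = F n x + F n y" "F n (x - y) = F n x - F n y" "F n (a *\<^sub>C x) = a *\<^sub>C F n x"
    "F n (\<Sum>i\<in>S. f i) = (\<Sum>i\<in>S. F n (f i))"
proof -
  interpret F: bounded_clinear_op "F n" by standard (rule bounded_clinear_F)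
  show "F n (x + y) = F n x + F n y" "F n (x - y) = F n x - F n y" "F n (a *\<^sub>C x) = a *\<^sub>C F n x"
    "F n (\<Sum>i\<in>S. f i) = (\<Sum>i\<in>S. F n (f i))" by (rule F.add F.diff F.scaleC F.sum)+
qed

lemma K_nonneg: "K \<ge> 0"
  using norm_F[of 0 "ket 0"] order_trans[OF norm_ge_zero] by fastforce

lemma convergent_all:
  assumes kets: "\<And>k. convergent (\<lambda>n. F n (ket k))"
  shows "convergent (\<lambda>n. F n x)"
proof -
  have "Cauchy (\<lambda>n. F n x)"
  proof (rule metric_CauchyI)
    fix e :: real assume e: "e > 0"
    \<comment> \<open>The summand 1 avoids division by zero when K = 0.\<close>
    have "e / (3 * (K + 1)) > 0" using e K_nonneg by simp
    from LIMSEQ_D[OF ket_expansion[of x] this]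
    obtain N where N: "norm ((\<Sum>k<N. coord x k *\<^sub>C ket k) - x) < e / (3 * (K + 1))" by blast
    define s where "s = (\<Sum>k<N. coord x k *\<^sub>C ket k)"
    have close: "dist (F n x) (F n s) < e / 3" for n
    proof -
      have "dist (F n x) (F n s) = norm (F n (s - x))" by (simp add: dist_norm norm_minus_commute linear_F)
      also have "\<dots> \<le> K * norm (s - x)" by (rule norm_F)
      also have "\<dots> \<le> (K + 1) * norm (s - x)" by (intro mult_right_mono) auto
      also have "\<dots> < (K + 1) * (e / (3 * (K + 1)))"
        using N K_nonneg unfolding s_def[symmetric] by (intro mult_strict_left_mono) auto
      also have "\<dots> = e / 3" using K_nonneg by (simp add: field_simps)
      finally show ?thesis .
    qed
    have "convergent (\<lambda>n. F n s)"
      unfolding s_def linear_F by (intro convergent_sum convergent_scaleC convergent_const kets)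
    then have "Cauchy (\<lambda>n. F n s)" by (rule convergent_Cauchy)
    then obtain M where M: "\<And>m n. m \<ge> M \<Longrightarrow> n \<ge> M \<Longrightarrow> dist (F m s) (F n s) < e / 3"
      using e metric_CauchyD[of "\<lambda>n. F n s" "e / 3"] by auto
    show "\<exists>M. \<forall>m\<ge>M. \<forall>n\<ge>M. dist (F m x) (F n x) < e"
    proof (intro exI allI impI)
      fix m n assume "m \<ge> M" "n \<ge> M"
      then show "dist (F m x) (F n x) < e"
        using close[of m] close[of n] M[of m n] dist_triangle[of "F m x" "F n x" "F m s"]
          dist_triangle[of "F m s" "F n x" "F n s"] dist_commute[of "F n s" "F n x"] by linarith
    qed
  qed
  then show ?thesis by (simp add: Cauchy_convergent_iff)
qed

text \<open>Uniform bounds make strong convergence stable under moving arguments, which is how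
  products such as squares of \<open>A n\<close> pass to the limit.\<close>

lemma tendsto_joint:
  assumes G: "\<And>x. (\<lambda>n. F n x) \<longlonglongrightarrow> G x" and x: "x \<longlonglongrightarrow> y"
  shows "(\<lambda>n. F n (x n)) \<longlonglongrightarrow> G y"
proof -
  have "(\<lambda>n. K * norm (x n - y)) \<longlonglongrightarrow> K * 0" using x by (intro tendsto_intros) (simp add: LIM_zero tendsto_norm_zero)
  then have "(\<lambda>n. K * norm (x n - y)) \<longlonglongrightarrow> 0" by simp
  then have "(\<lambda>n. F n (x n - y)) \<longlonglongrightarrow> 0"
    by (rule Lim_null_comparison[rotated]) (simp add: norm_F)
  then have "(\<lambda>n. F n (x n - y) + F n y) \<longlonglongrightarrow> 0 + G y" by (intro tendsto_add G)
  then show ?thesis by (simp add: linear_F)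
qed

lemma bounded_clinear_limit:
  assumes G: "\<And>x. (\<lambda>n. F n x) \<longlonglongrightarrow> G x"
  shows "bounded_clinear G"
proof (rule bounded_clinearI[where K = K])
  fix x y a
  show "G (x + y) = G x + G y"
    using LIMSEQ_unique[OF G[of "x + y"]] tendsto_add[OF G[of x] G[of y]] by (simp add: linear_F)
  show "G (a *\<^sub>C x) = a *\<^sub>C G x"
    using LIMSEQ_unique[OF G[of "a *\<^sub>C x"]] scaleC.tendsto[OF tendsto_const G[of x], of a] by (simp add: linear_F)
  show "norm (G x) \<le> norm x * K"
    using norm_F by (intro LIMSEQ_le_const2[OF tendsto_norm[OF G]]) (auto simp: mult.commute)
qed

end

locale pi_star_iteration =
  fixes \<tau> :: real and A :: "nat \<Rightarrow> ell2 \<Rightarrow> ell2"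
  assumes \<tau>: "\<tau> > 1" and A0: "selfadjoint (A 0)" and A_Suc: "A (Suc n) = pi_star \<tau> (A n)"
begin

lemma lift_op_A: "lift_op (A n) \<tau>"
proof (induction n)
  case 0 show ?case using A0 \<tau> by (simp add: lift_op_def lift_op_axioms_def selfadjoint_op_iff)
next
  case (Suc n)
  then show ?case using lift_op.selfadjoint_pi_star[OF Suc] \<tau>
    by (simp add: A_Suc lift_op_def lift_op_axioms_def selfadjoint_op_iff)
qed

sublocale A: lift_op "A n" \<tau> for n
  by (rule lift_op_A)

lemma A_Suc_Theta: "A (Suc n) (A.\<Theta> n x y) = (1 / (2 * \<tau>)) *\<^sub>R A.\<Theta> n (A n x + A.P n y) (x + A n y)"
  unfolding A_Suc by (rule A.pi_star_Theta)

lemma poly_op_Suc_Theta: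
  "poly_op f (A (Suc n)) (A.\<Theta> n x y) =
    A.\<Theta> n (poly_op (even_coef \<tau> f) (A n) x + poly_op (quad \<tau> * odd_coef \<tau> f) (A n) y)
      (poly_op (odd_coef \<tau> f) (A n) x + poly_op (even_coef \<tau> f) (A n) y)"
  unfolding A.poly_op_Theta[OF A.F A_Suc_Theta] A.poly_op_mult A.poly_op_quad ..

lemma ket_even: "ket (2 * k) = A.\<Theta> n (ket k) 0"
  by (simp add: A.Theta_ev ev_ket)

lemma ket_odd: "ket (2 * k + 1) = A.\<Theta> n 0 (gs (A.P n) k)"
  by (simp add: Theta_def A.Phi_gs od_ket)

text \<open>The vector |0> lies in the even subspace, so <0|f(A_{n+1})|0> = <0|S(A_n)|0> with S =
  \<open>even_coef \<tau> f\<close>. Integration against the eigen-measure is invariant under f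
  \<mapsto> S, hence the difference decays.\<close>

lemma moments_tendsto: "(\<lambda>n. coord (poly_op f (A n) (ket 0)) 0) \<longlonglongrightarrow> (\<integral>v. rpoly f v \<partial>eigen \<tau>)"
proof -
  define I where "I f = (\<integral>v. rpoly f v \<partial>eigen \<tau>)" for f
  have eig: "is_eigen_measure \<tau> (eigen \<tau>)" by (rule is_eigen_measure_eigen[OF \<tau>])
  interpret compact_prob "eigen \<tau>" "E1 \<tau>" by (rule eigen_compact_prob[OF \<tau> eig])
  have I: "I (f + g) = I f + I g" "I (smult a f) = a * I f" "I 1 = 1" "I (even_coef \<tau> f) = I f" for f g a
    using eigen_integral_poly[OF \<tau> eig, of f] prob_space by (simp_all add: I_def integrable_poly)
  define \<delta> where "\<delta> n f = coord (poly_op f (A n) (ket 0)) 0 - I f" for n f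
  have "(\<lambda>n. \<delta> n f) \<longlonglongrightarrow> 0"
  proof (rule even_coef_decay[OF \<tau>])
    show "\<delta> n (f + g) = \<delta> n f + \<delta> n g" for n f g by (simp add: \<delta>_def I A.poly_op_add)
    show "\<delta> n (smult a f) = a * \<delta> n f" for n a f by (simp add: \<delta>_def I A.poly_op_smult algebra_simps)
    show "\<delta> n 1 = 0" for n using I(3) by (simp add: \<delta>_def one_pCons A.zero coord_ket)
    show "\<delta> (Suc n) f = \<delta> n (even_coef \<tau> f)" for n f
    proof -
      have "coord (poly_op f (A (Suc n)) (ket (2 * 0))) (2 * 0) = coord (poly_op (even_coef \<tau> f) (A n) (ket 0)) 0"
        unfolding ket_even[of 0 n] poly_op_Suc_Theta A.coord_Theta by (simp add: A.poly_op_zero_arg)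
      then show ?thesis by (simp add: \<delta>_def I)
    qed
  qed
  then show ?thesis unfolding \<delta>_def I_def by (simp add: LIM_zero_iff)
qed

text \<open>All polynomials are included because one step of the iteration replaces f by its even
  and odd parts and their products with \<open>quad \<tau>\<close>.\<close>

definition weak_block :: "nat \<Rightarrow> bool" where
  "weak_block N \<longleftrightarrow> (\<forall>f. \<forall>i\<le>N. \<forall>j\<le>N. convergent (\<lambda>n. coord (poly_op f (A n) (ket j)) i))"

lemma weak_block_cinner:
  assumes N: "weak_block N" and x: "finitely_convergent N x" and y: "finitely_convergent N y"
  shows "convergent (\<lambda>n. cinner (x n) (poly_op f (A n) (y n)))"
proof -
  have "cinner (x n) (poly_op f (A n) (y n)) =
      (\<Sum>j\<le>N. \<Sum>i\<le>N. coord (y n) j * (cnj (coord (x n) i) * coord (poly_op f (A n) (ket j)) i))" for n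
    by (subst finitely_convergent_expand[OF x], subst finitely_convergent_expand[OF y])
      (simp add: A.poly_op_sum A.poly_op_scaleC_arg cinner.sum_left cinner.sum_right sum_distrib_left)
  then show ?thesis
    using N x y
    by (auto simp: weak_block_def finitely_convergent_def intro!: convergent_sum convergent_mult convergent_cnj)
qed

text \<open>Gram-Schmidt up to index k is a finite algorithm in the entries of P =
  \<open>quad \<tau>\<close> evaluated at \<open>A n\<close>, all inside the block. Its only
  division is by \<open>gs_norm\<close>, which stays away from 0 uniformly in n.\<close>

lemma weak_block_gs:
  assumes N: "weak_block N" and k: "k \<le> N"
  shows "finitely_convergent N (\<lambda>n. gs (A.P n) k)"
  using k
proof (induction k rule: less_induct)
  case (less k)
  have P: "convergent (\<lambda>n. cinner (x n) (A.P n (y n)))"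
    if "finitely_convergent N x" "finitely_convergent N y" for x y
    using weak_block_cinner[OF N that, of "quad \<tau>"] by (simp add: A.poly_op_quad)
  have pre: "finitely_convergent N (\<lambda>n. gs_pre (A.P n) k)"
    unfolding gs_pre_def using less
    by (intro finitely_convergent_diff finitely_convergent_sum finitely_convergent_scaleC P finitely_convergent_ket) auto
  obtain L where L: "(\<lambda>n. cinner (gs_pre (A.P n) k) (A.P n (gs_pre (A.P n) k))) \<longlonglongrightarrow> L"
    using P[OF pre pre] by (auto simp: convergent_def)
  then have norm: "(\<lambda>n. A.P.gs_norm n k) \<longlonglongrightarrow> sqrt (Re L)"
    unfolding A.P.gs_norm_def by (intro tendsto_intros)
  have "sqrt (4 * \<tau> * (\<tau> - 1)) \<le> sqrt (Re L)"
    using A.P.gs_norm_ge by (intro LIMSEQ_le_const[OF norm]) auto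
  moreover have "sqrt (4 * \<tau> * (\<tau> - 1)) > 0" using \<tau> by simp
  ultimately have "sqrt (Re L) \<noteq> 0" by linarith
  then have "(\<lambda>n. complex_of_real (1 / A.P.gs_norm n k)) \<longlonglongrightarrow> complex_of_real (1 / sqrt (Re L))"
    by (intro tendsto_intros norm)
  then have "convergent (\<lambda>n. complex_of_real (1 / A.P.gs_norm n k))" by (auto simp: convergent_def)
  from finitely_convergent_scaleC[OF this pre]
  show ?case unfolding A.P.gs_norm_def scaleR_eq_scaleC[symmetric] gs_eq[symmetric] .
qed

text \<open>Reduces the basis vector j at one stage to vectors at the previous stage supported in
  the block of half the size.\<close>

lemma ket_block:
  assumes "weak_block (j div 2)"
  obtains x y where "finitely_convergent (j div 2) x" "finitely_convergent (j div 2) y" "\<And>n. ket j = A.\<Theta> n (x n) (y n)"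
proof (cases "even j")
  case True
  then show ?thesis
    using that[of "\<lambda>n. ket (j div 2)" "\<lambda>n. 0"] ket_even[of "j div 2"]
    by (auto simp: finitely_convergent_ket finitely_convergent_0)
next
  case False
  then show ?thesis
    using that[of "\<lambda>n. 0" "\<lambda>n. gs (A.P n) (j div 2)"] ket_odd[of "j div 2"] weak_block_gs[OF assms]
    by (auto simp: finitely_convergent_0 odd_two_times_div_two_succ)
qed

lemma weak_block_mono: "weak_block N \<Longrightarrow> M \<le> N \<Longrightarrow> weak_block M"
  unfolding weak_block_def by (meson le_trans)

lemma finitely_convergent_mono: "finitely_convergent M x \<Longrightarrow> M \<le> N \<Longrightarrow> finitely_convergent N x"
  unfolding finitely_convergent_def by (meson le_less_trans)

lemma weak_block_all: "weak_block N"
proof (induction N rule: less_induct)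
  case (less N)
  show ?case
  proof (cases "N = 0")
    \<comment> \<open>Halving does not decrease 0, so the induction starts from the moments.\<close>
    case True
    then show ?thesis using moments_tendsto by (auto simp: weak_block_def convergent_def)
  next
    case False
    define M where "M = N div 2"
    then have M: "weak_block M" using less False by simp
    show ?thesis
      unfolding weak_block_def
    proof (intro allI impI)
      fix f i j assume "i \<le> N" "j \<le> N"
      then have ij: "i div 2 \<le> M" "j div 2 \<le> M" by (auto simp: M_def div_le_mono)
      obtain x y where xy: "finitely_convergent (j div 2) x" "finitely_convergent (j div 2) y"
        and ket: "\<And>n. ket j = A.\<Theta> n (x n) (y n)"
        using ket_block weak_block_mono[OF M ij(2)] by metis
      note x = finitely_convergent_mono[OF xy(1) ij(2)] and y = finitely_convergent_mono[OF xy(2) ij(2)]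
      have conv: "convergent (\<lambda>n. cinner (z n) (poly_op f (A n) (x n)) + cinner (z n) (poly_op g (A n) (y n)))"
        if "finitely_convergent M z" for z f g
        using that by (intro convergent_add weak_block_cinner[OF M] x y)
      have "convergent (\<lambda>n. coord (poly_op f (A (Suc n)) (ket j)) i)"
      proof (cases "even i")
        case True
        then have i: "i = 2 * (i div 2)" by simp
        have "coord (poly_op f (A (Suc n)) (ket j)) i =
            cinner (ket (i div 2)) (poly_op (even_coef \<tau> f) (A n) (x n)) +
            cinner (ket (i div 2)) (poly_op (quad \<tau> * odd_coef \<tau> f) (A n) (y n))" for n
          unfolding ket[of n] poly_op_Suc_Theta by (subst i, subst A.coord_Theta) simp
        then show ?thesis using conv[OF finitely_convergent_ket[OF ij(1)]] by simp
      next
        \<comment> \<open>An odd row is read off by pairing the second component with a Gram-Schmidt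
          vector through P, hence the extra factor \<open>quad \<tau>\<close>.\<close>
        case False
        then have i: "i = 2 * (i div 2) + 1" by simp
        have "coord (poly_op f (A (Suc n)) (ket j)) i =
            cinner (gs (A.P n) (i div 2)) (poly_op (quad \<tau> * odd_coef \<tau> f) (A n) (x n)) +
            cinner (gs (A.P n) (i div 2)) (poly_op (quad \<tau> * even_coef \<tau> f) (A n) (y n))" for n
          unfolding ket[of n] poly_op_Suc_Theta
          by (subst i, subst A.coord_Theta) (simp add: A.P.add cinner.add_right A.poly_op_mult A.poly_op_quad)
        then show ?thesis using conv[OF weak_block_gs[OF M ij(1)]] by simp
      qed
      then show "convergent (\<lambda>n. coord (poly_op f (A n) (ket j)) i)"
        by (rule convergent_Suc_iff[THEN iffD1])
    qed
  qed
qed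

lemma uniform_bound: "\<exists>K. \<forall>n x. norm (A n x) \<le> K * norm x"
proof -
  obtain K where K: "\<And>x. norm (A 0 x) \<le> norm x * K" using A.bounded by blast
  \<comment> \<open>The maximum with 1 is taken because \<open>norm_pi_star\<close> preserves only
    bounds of size at least 1.\<close>
  have "norm (A n x) \<le> max K 1 * norm x" for n x
  proof (induction n arbitrary: x)
    case 0
    have "norm (A 0 x) \<le> norm x * K" by (rule K)
    also have "\<dots> \<le> norm x * max K 1" by (intro mult_left_mono) auto
    finally show ?case by (simp add: mult.commute)
  next
    case (Suc n)
    then show ?case unfolding A_Suc by (intro A.norm_pi_star) auto
  qed
  then show ?thesis by (intro exI[of _ "max K 1"]) auto
qed

definition bound :: real where "bound = (SOME K. \<forall>n x. norm (A n x) \<le> K * norm x)"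

lemma norm_A: "norm (A n x) \<le> bound * norm x"
  using someI_ex[OF uniform_bound] by (auto simp: bound_def)

sublocale UA: uniformly_bounded A bound
  by standard (rule A.F norm_A)+

sublocale UPhi: uniformly_bounded "\<lambda>n. Phi \<tau> (A n)" "sqrt (bound\<^sup>2 + 4 * \<tau> * (\<tau> - 1))"
proof
  show "bounded_clinear (Phi \<tau> (A n))" for n by (rule A.bounded_clinear_Phi)
  show "norm (Phi \<tau> (A n) x) \<le> sqrt (bound\<^sup>2 + 4 * \<tau> * (\<tau> - 1)) * norm x" for n x
    by (rule A.norm_Phi_le) (rule norm_A)
qed

text \<open>Column k of \<Phi> has no entries below the diagonal, so convergence of its entries is
  already norm convergence; the uniform bound extends this to all vectors.\<close>

lemma Phi_convergent: "convergent (\<lambda>n. Phi \<tau> (A n) x)"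
proof (rule UPhi.convergent_all)
  fix k
  have "finitely_convergent k (\<lambda>n. Phi \<tau> (A n) (ket k))"
    unfolding finitely_convergent_def
  proof (intro conjI allI impI)
    show "k < j \<Longrightarrow> coord (Phi \<tau> (A n) (ket k)) j = 0" for n j by (rule A.Phi_upper)
    fix j
    have "finitely_convergent (max j k) (\<lambda>n. gs (A.P n) j)" by (rule weak_block_gs[OF weak_block_all]) simp
    moreover have "finitely_convergent (max j k) (\<lambda>n. ket k)" by (rule finitely_convergent_ket) simp
    ultimately show "convergent (\<lambda>n. coord (Phi \<tau> (A n) (ket k)) j)"
      unfolding A.coord_Phi A.poly_op_quad[symmetric] by (rule weak_block_cinner[OF weak_block_all])
  qed
  then show "convergent (\<lambda>n. Phi \<tau> (A n) (ket k))" by (rule finitely_convergent_imp_convergent)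
qed

lemma Phi_convergent_joint:
  assumes "convergent x" shows "convergent (\<lambda>n. Phi \<tau> (A n) (x n))"
proof -
  obtain y where y: "x \<longlonglongrightarrow> y" using assms by (auto simp: convergent_def)
  have "(\<lambda>n. Phi \<tau> (A n) z) \<longlonglongrightarrow> lim (\<lambda>n. Phi \<tau> (A n) z)" for z
    using Phi_convergent by (simp add: convergent_LIMSEQ_iff)
  from UPhi.tendsto_joint[OF this y] show ?thesis by (auto simp: convergent_def)
qed

text \<open>For degree p + 1 the vectors y_n = f(A_n)|0> satisfy y_{n+1} = q \<open>ev\<close> y_n +
  z_n with q < 1 and \<open>ev\<close> isometric. The perturbation z_n contains only polynomials of
  degree at most p, since subtracting q f lowers the even part and the odd part has lost a
  degree.\<close>

lemma strong_convergent_vacuum: "convergent (\<lambda>n. poly_op f (A n) (ket 0))"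
proof -
  have "\<forall>i>p. coeff f i = 0 \<Longrightarrow> convergent (\<lambda>n. poly_op f (A n) (ket 0))" for p
  proof (induction p arbitrary: f)
    case 0
    then have "f = [:coeff f 0:]" by (intro poly_eqI) (auto simp: coeff_pCons split: nat.split)
    then have "poly_op f (A n) (ket 0) = coeff f 0 *\<^sub>C ket 0" for n
      by (metis A.poly_op_pCons A.poly_op_0 A.zero add.right_neutral)
    then show ?case by (simp add: convergent_const)
  next
    case (Suc p)
    define q where "q = coef_factor \<tau> (Suc p)"
    have q: "0 \<le> q" "q < 1" using coef_factor_bound[OF \<tau>] by (simp_all add: q_def)
    define g where "g = even_coef \<tau> f - smult (of_real q) f"
    have deg: "\<forall>i>Suc p. coeff (even_coef \<tau> f) i = 0" "coeff (even_coef \<tau> f) (Suc p) = of_real q * coeff f (Suc p)"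
      "\<forall>i\<ge>Suc p. coeff (odd_coef \<tau> f) i = 0"
      using coef_degree[of \<tau> "Suc p" f] Suc.prems \<tau> by (auto simp: q_def)
    have "coeff g i = 0" if "i > p" for i
      using that deg Suc.prems by (cases "i = Suc p") (auto simp: g_def)
    then have g: "convergent (\<lambda>n. poly_op g (A n) (ket 0))" by (intro Suc.IH) auto
    have u: "convergent (\<lambda>n. poly_op (odd_coef \<tau> f) (A n) (ket 0))" using deg(3) by (intro Suc.IH) auto
    define z where "z n = ev (poly_op g (A n) (ket 0)) + od (Phi \<tau> (A n) (poly_op (odd_coef \<tau> f) (A n) (ket 0)))" for n
    have z: "convergent z" unfolding z_def[abs_def] by (intro convergent_ev_od g Phi_convergent_joint u)
    show ?case
    proof (rule perturbed_contraction_convergent[OF _ _ q _ z])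
      show "linear (\<lambda>x. q *\<^sub>R ev x)" by (rule linearI) (auto simp: algebra_simps)
      show "norm (q *\<^sub>R ev x) \<le> q * norm x" for x using q by simp
      fix n
      have "even_coef \<tau> f = g + smult (of_real q) f" by (simp add: g_def)
      then have "poly_op (even_coef \<tau> f) (A n) (ket 0) = poly_op g (A n) (ket 0) + q *\<^sub>R poly_op f (A n) (ket 0)"
        by (simp add: A.poly_op_add A.poly_op_smult scaleR_eq_scaleC)
      then have "poly_op f (A (Suc n)) (ket (2 * 0)) = q *\<^sub>R ev (poly_op f (A n) (ket 0)) + z n"
        unfolding ket_even[of 0 n] poly_op_Suc_Theta by (simp add: A.poly_op_zero_arg Theta_def z_def algebra_simps)
      then show "poly_op f (A (Suc n)) (ket 0) = q *\<^sub>R ev (poly_op f (A n) (ket 0)) + z n" by simp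
    qed
  qed
  from this[of "degree f"] show ?thesis by (simp add: coeff_eq_0)
qed

text \<open>For k > 0 one step of the iteration expresses the vector through basis vectors with
  index at most k div 2 < k, with convergent coefficients, and through strongly convergent factors
  \<Phi>.\<close>

lemma strong_convergent: "convergent (\<lambda>n. poly_op f (A n) (ket k))"
proof (induction k arbitrary: f rule: less_induct)
  case (less k)
  show ?case
  proof (cases "k = 0")
    case False
    obtain x y where x: "finitely_convergent (k div 2) x" and y: "finitely_convergent (k div 2) y"
      and ket: "\<And>n. ket k = A.\<Theta> n (x n) (y n)"
      using ket_block weak_block_all by metis
    have conv: "convergent (\<lambda>n. poly_op f (A n) (z n))" if z: "finitely_convergent (k div 2) z" for f z
    proof -
      have "convergent (\<lambda>n. \<Sum>j\<le>k div 2. coord (z n) j *\<^sub>C poly_op f (A n) (ket j))"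
        using z False less by (intro convergent_sum convergent_scaleC) (auto simp: finitely_convergent_def)
      moreover have "(\<Sum>j\<le>k div 2. coord (z n) j *\<^sub>C poly_op f (A n) (ket j)) = poly_op f (A n) (z n)" for n
        by (subst (2) finitely_convergent_expand[OF z]) (simp add: A.poly_op_sum A.poly_op_scaleC_arg)
      ultimately show ?thesis by simp
    qed
    have eq: "poly_op f (A (Suc n)) (ket k) =
        ev (poly_op (even_coef \<tau> f) (A n) (x n) + poly_op (quad \<tau> * odd_coef \<tau> f) (A n) (y n)) +
        od (Phi \<tau> (A n) (poly_op (odd_coef \<tau> f) (A n) (x n) + poly_op (even_coef \<tau> f) (A n) (y n)))" for n
      unfolding ket[of n] poly_op_Suc_Theta unfolding Theta_def ..
    have "convergent (\<lambda>n. poly_op f (A (Suc n)) (ket k))"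
      unfolding eq by (intro convergent_ev_od Phi_convergent_joint convergent_ell2_add conv x y)
    then show ?thesis by (rule convergent_Suc_iff[THEN iffD1])
  qed (simp add: strong_convergent_vacuum)
qed

section \<open>The strong limit and its fixed-point equation\<close>

definition B :: "ell2 \<Rightarrow> ell2" where "B x = lim (\<lambda>n. A n x)"

lemma A_tendsto: "(\<lambda>n. A n x) \<longlonglongrightarrow> B x"
proof -
  have "convergent (\<lambda>n. A n x)"
  proof (rule UA.convergent_all)
    show "convergent (\<lambda>n. A n (ket k))" for k
      using strong_convergent[of "[:0, 1:]" k] by (simp add: A.zero scaleC.zero_left)
  qed
  then show ?thesis by (simp add: B_def convergent_LIMSEQ_iff)
qed

lemmas A_tendsto_joint = UA.tendsto_joint[OF A_tendsto]

lemma lift_op_B: "lift_op B \<tau>"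
proof -
  have "bounded_clinear B" by (rule UA.bounded_clinear_limit) (rule A_tendsto)
  moreover have "cinner (B x) y = cinner x (B y)" for x y
  proof (rule LIMSEQ_unique)
    show "(\<lambda>n. cinner (A n x) y) \<longlonglongrightarrow> cinner (B x) y" by (intro cinner.tendsto A_tendsto tendsto_const)
    show "(\<lambda>n. cinner (A n x) y) \<longlonglongrightarrow> cinner x (B y)"
      unfolding A.selfadj by (intro cinner.tendsto A_tendsto tendsto_const)
  qed
  ultimately show ?thesis
    using \<tau> by (simp add: lift_op_def lift_op_axioms_def selfadjoint_op_iff selfadjoint_def)
qed

sublocale B: lift_op B \<tau>
  by (rule lift_op_B)

lemma poly_op_tendsto: "(\<lambda>n. poly_op f (A n) x) \<longlonglongrightarrow> poly_op f B x"
proof (induction f)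
  case (pCons a f)
  then show ?case by (simp add: tendsto_add A_tendsto_joint)
qed simp

lemma P_tendsto: "(\<lambda>n. A.P n x) \<longlonglongrightarrow> B.P x"
  using poly_op_tendsto[of "quad \<tau>" x] by (simp add: A.poly_op_quad B.poly_op_quad)

text \<open>The strong limit is identified by uniqueness of the factorisation. The relation with P
  is passed to the limit as an identity of forms, which avoids limits of adjoints, and the uniform
  lower bound keeps the limiting diagonal strictly positive.\<close>

lemma Phi_tendsto: "(\<lambda>n. Phi \<tau> (A n) x) \<longlonglongrightarrow> B.\<Phi> x"
proof -
  define G where "G x = lim (\<lambda>n. Phi \<tau> (A n) x)" for x
  have G: "(\<lambda>n. Phi \<tau> (A n) x) \<longlonglongrightarrow> G x" for x
    using Phi_convergent by (simp add: G_def convergent_LIMSEQ_iff)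
  have bG: "bounded_clinear G" by (rule UPhi.bounded_clinear_limit) (rule G)
  have coord: "(\<lambda>n. coord (Phi \<tau> (A n) x) j) \<longlonglongrightarrow> coord (G x) j" for x j
    using cinner.tendsto[OF tendsto_const G, of "ket j" x] by simp
  have "is_Phi \<tau> B G"
    unfolding is_Phi_def
  proof (intro conjI allI impI)
    show "bounded_clinear G" by (rule bG)
    show "k < j \<Longrightarrow> cinner (ket j) (G (ket k)) = 0" for j k
      using coord[of "ket k" j] A.Phi_upper by (simp add: LIMSEQ_const_iff)
    fix k
    have re: "(\<lambda>n. A.P.gs_norm n k) \<longlonglongrightarrow> Re (coord (G (ket k)) k)"
      using tendsto_Re[OF coord[of "ket k" k]] by (simp add: A.Phi_diag)
    have im: "Im (coord (G (ket k)) k) = 0"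
      using tendsto_Im[OF coord[of "ket k" k]] by (simp add: A.Phi_diag LIMSEQ_const_iff)
    have "sqrt (4 * \<tau> * (\<tau> - 1)) \<le> Re (coord (G (ket k)) k)"
      using A.P.gs_norm_ge by (intro LIMSEQ_le_const[OF re]) auto
    moreover have "sqrt (4 * \<tau> * (\<tau> - 1)) > 0" using \<tau> by simp
    ultimately have "Re (coord (G (ket k)) k) > 0" by linarith
    then show "\<exists>r>0. cinner (ket k) (G (ket k)) = complex_of_real r"
      using im by (intro exI[of _ "Re (coord (G (ket k)) k)"]) (auto simp: complex_eq_iff)
  next
    fix x
    have form: "cinner (G x) (G y) = cinner x (B.P y)" for y
    proof (rule LIMSEQ_unique)
      show "(\<lambda>n. cinner (Phi \<tau> (A n) x) (Phi \<tau> (A n) y)) \<longlonglongrightarrow> cinner (G x) (G y)" by (intro cinner.tendsto G)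
      show "(\<lambda>n. cinner (Phi \<tau> (A n) x) (Phi \<tau> (A n) y)) \<longlonglongrightarrow> cinner x (B.P y)"
        unfolding A.form_Phi by (intro cinner.tendsto P_tendsto tendsto_const)
    qed
    have "cadjoint G (G x) = B.P x" by (rule cadjoint_eqI[OF bG]) (simp only: B.P.selfadj form)
    then show "cadjoint G (G x) = B (B x) + (4 * \<tau> * (\<tau> - 1)) *\<^sub>R x" by (simp only: shift_sq_def)
  qed
  then have "G = B.\<Phi>" by (simp add: B.is_Phi_iff)
  with G show ?thesis by simp
qed

text \<open>The fixed-point equation in coordinates. \<open>Theta\<close> itself moves with n, so
  both sides are limits of operators applied to converging vectors.\<close>

lemma B_Theta: "B (B.\<Theta> x y) = (1 / (2 * \<tau>)) *\<^sub>R B.\<Theta> (B x + B.P y) (x + B y)"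
proof (rule LIMSEQ_unique)
  have Th: "(\<lambda>n. A.\<Theta> n (u n) (w n)) \<longlonglongrightarrow> B.\<Theta> u' w'" if "u \<longlonglongrightarrow> u'" "w \<longlonglongrightarrow> w'" for u w u' w'
    unfolding Theta_def by (intro tendsto_add tendsto_ev tendsto_od UPhi.tendsto_joint[OF Phi_tendsto] that)
  show "(\<lambda>n. A (Suc n) (A.\<Theta> n x y)) \<longlonglongrightarrow> (1 / (2 * \<tau>)) *\<^sub>R B.\<Theta> (B x + B.P y) (x + B y)"
    unfolding A_Suc_Theta by (intro tendsto_scaleR tendsto_const Th tendsto_add A_tendsto P_tendsto)
  have shift: "uniformly_bounded (\<lambda>n. A (Suc n)) bound" by standard (rule A.F norm_A)+
  show "(\<lambda>n. A (Suc n) (A.\<Theta> n x y)) \<longlonglongrightarrow> B (B.\<Theta> x y)"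
    by (rule uniformly_bounded.tendsto_joint[OF shift LIMSEQ_Suc[OF A_tendsto] Th[OF tendsto_const tendsto_const]])
qed

lemma B_moments: "coord (poly_op f B (ket 0)) 0 = (\<integral>v. rpoly f v \<partial>eigen \<tau>)"
proof (rule LIMSEQ_unique[OF _ moments_tendsto])
  show "(\<lambda>n. coord (poly_op f (A n) (ket 0)) 0) \<longlonglongrightarrow> coord (poly_op f B (ket 0)) 0"
    using cinner.tendsto[OF tendsto_const poly_op_tendsto, of "ket 0" f "ket 0"] by simp
qed

lemma weakly_converges_B: "weakly_converges A B"
  unfolding weakly_converges_def by (intro allI cinner.tendsto tendsto_const A_tendsto)

end

section \<open>The functional model of the limit\<close>

lemma measurable_cnj [measurable (raw)]:
  "f \<in> borel_measurable M \<Longrightarrow> (\<lambda>x. cnj (f x)) \<in> borel_measurable M"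
  by (rule borel_measurable_continuous_on[where f = cnj]) (intro continuous_intros)

locale fixed_op = lift_op B \<tau> for B \<tau> +
  assumes B_Theta: "B (Theta \<tau> B x y) = (1 / (2 * \<tau>)) *\<^sub>R Theta \<tau> B (B x + shift_sq \<tau> B y) (x + B y)"
    and moments: "coord (poly_op f B (ket 0)) 0 = (\<integral>v. rpoly f v \<partial>eigen \<tau>)"
begin

abbreviation "\<mu> \<equiv> eigen \<tau>"
abbreviation "K \<equiv> julia \<tau>"

sublocale compact_prob \<mu> K
  using prob_space_eigen[OF \<tau>] compact_julia[OF \<tau>] AE_eigen_julia[OF \<tau>] sets_eigen[OF \<tau>]
  by (simp add: compact_prob_def compact_prob_axioms_def)

lemma julia_nonzero: "v \<in> K \<Longrightarrow> v \<noteq> 0"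
  using julia_subset[OF \<tau>] by (auto simp: E1_def)

lemma continuous_ratmap: "continuous_on K (ratmap \<tau>)"
  unfolding ratmap_def by (intro continuous_intros) (simp add: julia_nonzero)

lemma poly_map_cnj: "rpoly (map_poly cnj p) v = cnj (rpoly p v)"
  by (simp only: cnj_poly complex_cnj_complex_of_real)

definition vec :: "complex poly \<Rightarrow> ell2" where "vec p = poly_op p B (ket 0)"

lemma vec_diff: "vec (p - q) = vec p - vec q"
  and vec_add: "vec (p + q) = vec p + vec q"
  and vec_mult: "vec (p * q) = poly_op p B (vec q)"
  by (simp_all add: vec_def poly_op_diff poly_op_add poly_op_mult)

lemma vec_one: "vec 1 = ket 0"
  by (simp add: vec_def one_pCons zero)

text \<open>Self-adjointness turns the inner product into the moment of conj(p) q; this is where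
  moments become an isometry.\<close>

lemma cinner_vec: "cinner (vec p) (vec q) = (\<integral>v. cnj (rpoly p v) * rpoly q v \<partial>\<mu>)"
proof -
  have "cinner (vec p) (vec q) = coord (poly_op (map_poly cnj p * q) B (ket 0)) 0"
    by (simp add: vec_def cinner_poly_op poly_op_mult)
  then show ?thesis by (simp add: moments poly_map_cnj)
qed

lemma norm_vec_le:
  assumes "\<And>v. v \<in> K \<Longrightarrow> cmod (rpoly p v) \<le> e" "e \<ge> 0"
  shows "norm (vec p) \<le> e"
proof (rule power2_le_imp_le)
  have "(norm (vec p))\<^sup>2 = cmod (cinner (vec p) (vec p))" by (simp add: cinner_self norm_power)
  also have "\<dots> \<le> e\<^sup>2"
    unfolding cinner_vec
  proof (rule norm_integral_le)
    have "integrable \<mu> (rpoly (map_poly cnj p * p))" by (rule integrable_poly)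
    then show "integrable \<mu> (\<lambda>v. cnj (rpoly p v) * rpoly p v)"
      by (simp add: poly_map_cnj)
    show "cmod (cnj (rpoly p v) * rpoly p v) \<le> e\<^sup>2" if "v \<in> K" for v
      using assms that by (auto simp: norm_mult power2_eq_square intro!: mult_mono)
  qed
  finally show "(norm (vec p))\<^sup>2 \<le> e\<^sup>2" .
qed fact

text \<open>\<open>Rep f x\<close>: the vector \<open>x\<close> corresponds to \<open>f\<close> under the isometry of \<open>C(K) \<subseteq> L\<^sup>2(\<mu>)\<close> into
  \<open>\<ell>\<^sup>2\<close> which maps a polynomial \<open>p\<close> to \<open>p(B)|0\<rangle>\<close>.\<close>

definition Rep :: "(real \<Rightarrow> complex) \<Rightarrow> ell2 \<Rightarrow> bool" where
  "Rep f x \<longleftrightarrow> (\<forall>\<delta>>0. \<exists>p. (\<forall>v\<in>K. cmod (f v - rpoly p v) \<le> \<delta>) \<and> norm (x - vec p) \<le> \<delta>)"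

lemma RepD:
  assumes "Rep f x" "\<delta> > 0"
  obtains p where "\<And>v. v \<in> K \<Longrightarrow> cmod (f v - rpoly p v) \<le> \<delta>" "norm (x - vec p) \<le> \<delta>"
  using assms unfolding Rep_def by blast

lemma Rep_poly: "Rep (rpoly p) (vec p)"
  unfolding Rep_def by (intro allI impI exI[of _ p]) simp

lemma Rep_cong: "Rep f x \<Longrightarrow> (\<And>v. v \<in> K \<Longrightarrow> f v = g v) \<Longrightarrow> Rep g x"
  unfolding Rep_def by simp

lemma Rep_limit:
  assumes "\<And>\<delta>. \<delta> > 0 \<Longrightarrow> \<exists>g y. Rep g y \<and> (\<forall>v\<in>K. cmod (f v - g v) \<le> \<delta>) \<and> norm (x - y) \<le> \<delta>"
  shows "Rep f x"
  unfolding Rep_def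
proof (intro allI impI)
  fix \<delta> :: real assume "\<delta> > 0"
  then have \<delta>: "\<delta> / 2 > 0" by simp
  obtain g y where g: "Rep g y" "\<forall>v\<in>K. cmod (f v - g v) \<le> \<delta> / 2" "norm (x - y) \<le> \<delta> / 2"
    using assms[OF \<delta>] by blast
  obtain p where p: "\<And>v. v \<in> K \<Longrightarrow> cmod (g v - rpoly p v) \<le> \<delta> / 2" "norm (y - vec p) \<le> \<delta> / 2"
    using RepD[OF g(1) \<delta>] by blast
  have "cmod (f v - rpoly p v) \<le> \<delta>" if "v \<in> K" for v
    using norm_triangle_ineq[of "f v - g v" "g v - rpoly p v"] g(2) p(1)[OF that] that by fastforce
  moreover have "norm (x - vec p) \<le> \<delta>"
    using norm_triangle_ineq[of "x - y" "y - vec p"] g(3) p(2) by simp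
  ultimately show "\<exists>p. (\<forall>v\<in>K. cmod (f v - rpoly p v) \<le> \<delta>) \<and> norm (x - vec p) \<le> \<delta>" by blast
qed

lemma Rep_add:
  assumes "Rep f x" "Rep g y" shows "Rep (\<lambda>v. f v + g v) (x + y)"
  unfolding Rep_def
proof (intro allI impI)
  fix \<delta> :: real assume "\<delta> > 0"
  then have \<delta>: "\<delta> / 2 > 0" by simp
  obtain p where p: "\<And>v. v \<in> K \<Longrightarrow> cmod (f v - rpoly p v) \<le> \<delta> / 2" "norm (x - vec p) \<le> \<delta> / 2"
    using RepD[OF assms(1) \<delta>] by blast
  obtain q where q: "\<And>v. v \<in> K \<Longrightarrow> cmod (g v - rpoly q v) \<le> \<delta> / 2" "norm (y - vec q) \<le> \<delta> / 2"
    using RepD[OF assms(2) \<delta>] by blast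
  have "cmod (f v + g v - rpoly (p + q) v) \<le> \<delta>" if "v \<in> K" for v
    using norm_triangle_ineq[of "f v - rpoly p v" "g v - rpoly q v"]
      p(1)[OF that] q(1)[OF that] by (simp add: algebra_simps)
  moreover have "norm (x + y - vec (p + q)) \<le> \<delta>"
    using norm_triangle_ineq[of "x - vec p" "y - vec q"] p(2) q(2) by (simp add: vec_add algebra_simps)
  ultimately show "\<exists>p. (\<forall>v\<in>K. cmod (f v + g v - rpoly p v) \<le> \<delta>) \<and> norm (x + y - vec p) \<le> \<delta>" by blast
qed

lemma Rep_poly_mult:
  assumes "Rep f x" shows "Rep (\<lambda>v. rpoly q v * f v) (poly_op q B x)"
  unfolding Rep_def
proof (intro allI impI)
  fix \<delta> :: real assume "\<delta> > 0"
  have "bounded ((rpoly q) ` K)"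
    by (intro compact_imp_bounded compact_continuous_image compact_K continuous_intros)
  then obtain M where M: "M > 0" "\<And>v. v \<in> K \<Longrightarrow> cmod (rpoly q v) \<le> M" by (auto simp: bounded_pos)
  interpret q: bounded_clinear_op "poly_op q B" by standard (rule bounded_clinear_poly_op)
  obtain M' where M': "M' > 0" "\<And>x. norm (poly_op q B x) \<le> norm x * M'" using q.pos_bounded by blast
  define e where "e = \<delta> / (M + M')"
  have e: "e > 0" "(M + M') * e = \<delta>" using \<open>\<delta> > 0\<close> M(1) M'(1) by (auto simp: e_def)
  then have Me: "M * e \<le> \<delta>" "e * M' \<le> \<delta>" using M(1) M'(1) by (auto simp: algebra_simps)
  obtain p where p: "\<And>v. v \<in> K \<Longrightarrow> cmod (f v - rpoly p v) \<le> e" "norm (x - vec p) \<le> e"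
    using RepD[OF assms e(1)] by blast
  have "cmod (rpoly q v * f v - rpoly (q * p) v) \<le> \<delta>" if "v \<in> K" for v
  proof -
    have "cmod (rpoly q v * f v - rpoly (q * p) v) =
        cmod (rpoly q v) * cmod (f v - rpoly p v)"
      by (simp add: norm_mult[symmetric] right_diff_distrib)
    also have "\<dots> \<le> M * e" using M p(1) that by (intro mult_mono) auto
    finally show ?thesis using Me(1) by linarith
  qed
  moreover have "norm (poly_op q B x - vec (q * p)) \<le> \<delta>"
  proof -
    have "norm (poly_op q B x - vec (q * p)) \<le> norm (x - vec p) * M'"
      using M'(2)[of "x - vec p"] by (simp add: vec_mult q.diff)
    also have "\<dots> \<le> e * M'" using p(2) M'(1) by (intro mult_right_mono) auto
    finally show ?thesis using Me(2) by linarith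
  qed
  ultimately show "\<exists>p. (\<forall>v\<in>K. cmod (rpoly q v * f v - rpoly p v) \<le> \<delta>) \<and>
      norm (poly_op q B x - vec p) \<le> \<delta>" by blast
qed

lemma Rep_scaleC: "Rep f x \<Longrightarrow> Rep (\<lambda>v. a * f v) (a *\<^sub>C x)"
  using Rep_poly_mult[of f x "[:a:]"] by (simp add: zero)

lemma Rep_times: "Rep f x \<Longrightarrow> Rep (\<lambda>v. complex_of_real v * f v) (B x)"
  using Rep_poly_mult[of f x "[:0, 1:]"] by (simp add: zero scaleC.zero_left)

lemma Rep_diff: "Rep f x \<Longrightarrow> Rep g y \<Longrightarrow> Rep (\<lambda>v. f v - g v) (x - y)"
  using Rep_add[of f x "\<lambda>v. - 1 * g v" "- 1 *\<^sub>C y"] Rep_scaleC[of g y "- 1"]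
  by (simp add: scaleC.minus_left)

lemma Rep_one: "Rep (\<lambda>v. 1) (ket 0)"
  using Rep_poly[of 1] by (simp add: vec_one)

lemma Rep_zero: "Rep (\<lambda>v. 0) 0"
  using Rep_poly[of 0] by (simp add: vec_def)

lemma Rep_sum:
  "finite S \<Longrightarrow> (\<And>i. i \<in> S \<Longrightarrow> Rep (f i) (x i)) \<Longrightarrow> Rep (\<lambda>v. \<Sum>i\<in>S. f i v) (\<Sum>i\<in>S. x i)"
  by (induction S rule: finite_induct) (simp_all add: Rep_zero Rep_add)

lemma Rep_unique:
  assumes "Rep f x" "Rep g y" "\<And>v. v \<in> K \<Longrightarrow> f v = g v" shows "x = y"
proof -
  have "norm (x - y) \<le> e" if "e > 0" for e
  proof -
    have \<delta>: "e / 4 > 0" using that by simp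
    obtain p where p: "\<And>v. v \<in> K \<Longrightarrow> cmod (f v - rpoly p v) \<le> e / 4" "norm (x - vec p) \<le> e / 4"
      using RepD[OF assms(1) \<delta>] by blast
    obtain q where q: "\<And>v. v \<in> K \<Longrightarrow> cmod (g v - rpoly q v) \<le> e / 4" "norm (y - vec q) \<le> e / 4"
      using RepD[OF assms(2) \<delta>] by blast
    have "norm (vec (p - q)) \<le> e / 2"
    proof (rule norm_vec_le)
      fix v assume v: "v \<in> K"
      show "cmod (rpoly (p - q) v) \<le> e / 2"
        using p(1)[OF v] q(1)[OF v] assms(3)[OF v]
          norm_triangle_ineq4[of "g v - rpoly q v" "f v - rpoly p v"] by simp
    qed (use that in simp)
    moreover have eq: "x - y = (x - vec p) + vec (p - q) - (y - vec q)" by (simp add: vec_diff)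
    ultimately show ?thesis
      unfolding eq using p(2) q(2) norm_triangle_ineq4[of "(x - vec p) + vec (p - q)" "y - vec q"]
        norm_triangle_ineq[of "x - vec p" "vec (p - q)"] by linarith
  qed
  then have "norm (x - y) \<le> 0" by (rule field_le_epsilon[of _ 0, simplified])
  then show ?thesis by simp
qed

lemma Rep_exists:
  assumes "continuous_on K f" shows "\<exists>x. Rep f x"
proof -
  have "\<exists>p. \<forall>v\<in>K. cmod (f v - rpoly p v) < inverse (real (Suc n))" for n
    by (rule Weierstrass_complex_poly[OF compact_K assms]) simp
  then obtain p where p: "\<And>n v. v \<in> K \<Longrightarrow> cmod (f v - rpoly (p n) v) < inverse (real (Suc n))" by metis
  have close: "norm (vec (p m) - vec (p n)) \<le> inverse (real (Suc m)) + inverse (real (Suc n))" for m n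
    unfolding vec_diff[symmetric]
  proof (rule norm_vec_le)
    fix v assume v: "v \<in> K"
    show "cmod (rpoly (p m - p n) v) \<le> inverse (real (Suc m)) + inverse (real (Suc n))"
      using p[OF v, of m] p[OF v, of n]
        norm_triangle_ineq4[of "f v - rpoly (p n) v" "f v - rpoly (p m) v"] by simp
  qed simp
  have inv: "\<exists>N. \<forall>n\<ge>N. inverse (real (Suc n)) < e" if "e > 0" for e
    using LIMSEQ_D[OF LIMSEQ_inverse_real_of_nat that] by auto
  have "Cauchy (\<lambda>n. vec (p n))"
  proof (rule metric_CauchyI)
    fix e :: real assume "e > 0"
    then obtain N where N: "\<forall>n\<ge>N. inverse (real (Suc n)) < e / 2" using inv[of "e / 2"] by auto
    have "dist (vec (p m)) (vec (p n)) < e" if "m \<ge> N" "n \<ge> N" for m n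
      using close[of m n] N that by (simp add: dist_norm) (smt (verit) field_sum_of_halves)
    then show "\<exists>N. \<forall>m\<ge>N. \<forall>n\<ge>N. dist (vec (p m)) (vec (p n)) < e" by blast
  qed
  then obtain x where x: "(\<lambda>n. vec (p n)) \<longlonglongrightarrow> x" by (auto simp: Cauchy_convergent_iff convergent_def)
  have "Rep f x"
    unfolding Rep_def
  proof (intro allI impI)
    fix \<delta> :: real assume \<delta>: "\<delta> > 0"
    obtain N where N: "\<forall>n\<ge>N. inverse (real (Suc n)) < \<delta>" using inv[OF \<delta>] by blast
    obtain M where M: "\<forall>n\<ge>M. norm (vec (p n) - x) < \<delta>" using LIMSEQ_D[OF x \<delta>] by blast
    show "\<exists>p. (\<forall>v\<in>K. cmod (f v - rpoly p v) \<le> \<delta>) \<and> norm (x - vec p) \<le> \<delta>"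
    proof (intro exI[of _ "p (max M N)"] conjI ballI)
      fix v assume "v \<in> K"
      then have "cmod (f v - rpoly (p (max M N)) v) < inverse (real (Suc (max M N)))" by (rule p)
      also have "\<dots> < \<delta>" using N by simp
      finally show "cmod (f v - rpoly (p (max M N)) v) \<le> \<delta>" by simp
    next
      show "norm (x - vec (p (max M N))) \<le> \<delta>" using M norm_minus_commute[of x] by (simp add: less_imp_le)
    qed
  qed
  then show ?thesis ..
qed

lemma Rep_bounded:
  assumes "Rep f x" shows "\<exists>C\<ge>0. \<forall>v\<in>K. cmod (f v) \<le> C"
proof -
  obtain p where p: "\<And>v. v \<in> K \<Longrightarrow> cmod (f v - rpoly p v) \<le> 1"
    using RepD[OF assms, of 1] by auto
  have "bounded ((rpoly p) ` K)"
    by (intro compact_imp_bounded compact_continuous_image compact_K continuous_intros)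
  then obtain M where M: "M > 0" "\<And>v. v \<in> K \<Longrightarrow> cmod (rpoly p v) \<le> M" by (auto simp: bounded_pos)
  have "cmod (f v) \<le> M + 1" if "v \<in> K" for v
    using p[OF that] M(2)[OF that] norm_triangle_ineq[of "f v - rpoly p v" "rpoly p v"] by simp
  then show ?thesis using M(1) by (intro exI[of _ "M + 1"]) auto
qed

lemma integrable_bounded:
  fixes h :: "real \<Rightarrow> 'b::{banach, second_countable_topology}"
  assumes "h \<in> borel_measurable borel" "\<And>v. v \<in> K \<Longrightarrow> norm (h v) \<le> C"
  shows "integrable \<mu> h"
  using assms AE_K by (intro integrable_const_bound[of _ C]) (auto elim: eventually_mono)

lemma Rep_sequence:
  assumes "Rep f x"
  shows "\<exists>p. (\<lambda>n. vec (p n)) \<longlonglongrightarrow> x \<and> (\<forall>v\<in>K. (\<lambda>n. rpoly (p n) v) \<longlonglongrightarrow> f v) \<and>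
    (\<forall>n. \<forall>v\<in>K. cmod (f v - rpoly (p n) v) \<le> 1)"
proof -
  have "\<exists>p. (\<forall>v\<in>K. cmod (f v - rpoly p v) \<le> inverse (real (Suc n))) \<and> norm (x - vec p) \<le> inverse (real (Suc n))" for n
    using assms unfolding Rep_def by simp
  then obtain p where p: "\<And>n v. v \<in> K \<Longrightarrow> cmod (f v - rpoly (p n) v) \<le> inverse (real (Suc n))"
    "\<And>n. norm (x - vec (p n)) \<le> inverse (real (Suc n))" by metis
  note inv = LIMSEQ_inverse_real_of_nat
  have "(\<lambda>n. x - vec (p n)) \<longlonglongrightarrow> 0"
    by (rule Lim_null_comparison[OF always_eventually inv]) (use p(2) in blast)
  then have "(\<lambda>n. vec (p n)) \<longlonglongrightarrow> x" using tendsto_diff[OF tendsto_const[of x]] by fastforce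
  moreover have "(\<lambda>n. rpoly (p n) v) \<longlonglongrightarrow> f v" if "v \<in> K" for v
  proof -
    have "(\<lambda>n. f v - rpoly (p n) v) \<longlonglongrightarrow> 0"
      by (rule Lim_null_comparison[OF always_eventually inv]) (use p(1)[OF that] in blast)
    then show ?thesis using tendsto_diff[OF tendsto_const[of "f v"]] by fastforce
  qed
  moreover have "cmod (f v - rpoly (p n) v) \<le> 1" if "v \<in> K" for n v
    using p(1)[OF that, of n] by (rule order_trans) (simp add: inverse_le_1_iff)
  ultimately show ?thesis by blast
qed

lemma Rep_cinner:
  assumes f: "Rep f x" and g: "Rep g y" and meas: "f \<in> borel_measurable borel" "g \<in> borel_measurable borel"
  shows "cinner x y = L2_inner \<mu> f g"
proof -
  obtain p where p: "(\<lambda>n. vec (p n)) \<longlonglongrightarrow> x" "\<forall>v\<in>K. (\<lambda>n. rpoly (p n) v) \<longlonglongrightarrow> f v"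
    "\<forall>n. \<forall>v\<in>K. cmod (f v - rpoly (p n) v) \<le> 1" using Rep_sequence[OF f] by blast
  obtain q where q: "(\<lambda>n. vec (q n)) \<longlonglongrightarrow> y" "\<forall>v\<in>K. (\<lambda>n. rpoly (q n) v) \<longlonglongrightarrow> g v"
    "\<forall>n. \<forall>v\<in>K. cmod (g v - rpoly (q n) v) \<le> 1" using Rep_sequence[OF g] by blast
  obtain C where C: "C \<ge> 0" "\<forall>v\<in>K. cmod (f v) \<le> C" using Rep_bounded[OF f] by blast
  obtain D where D: "D \<ge> 0" "\<forall>v\<in>K. cmod (g v) \<le> D" using Rep_bounded[OF g] by blast
  note [measurable] = meas
  have lim: "(\<lambda>n. \<integral>v. cnj (rpoly (p n) v) * rpoly (q n) v \<partial>\<mu>) \<longlonglongrightarrow> (\<integral>v. cnj (f v) * g v \<partial>\<mu>)"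
  proof (rule integral_dominated_convergence[where w = "\<lambda>v. (C + 1) * (D + 1)"])
    show "AE v in \<mu>. (\<lambda>n. cnj (rpoly (p n) v) * rpoly (q n) v) \<longlonglongrightarrow> cnj (f v) * g v"
      using AE_K by eventually_elim (use p(2) q(2) in \<open>auto intro!: tendsto_intros\<close>)
    show "AE v in \<mu>. norm (cnj (rpoly (p n) v) * rpoly (q n) v) \<le> (C + 1) * (D + 1)" for n
      using AE_K
    proof eventually_elim
      case (elim v)
      have "cmod (rpoly (p n) v) \<le> C + 1"
        using norm_triangle_ineq4[of "f v" "f v - rpoly (p n) v"] p(3)[rule_format, OF elim] C(2)[rule_format, OF elim]
        by (smt (verit) diff_diff_eq2 diff_add_cancel add_diff_cancel_left')
      moreover have "cmod (rpoly (q n) v) \<le> D + 1"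
        using norm_triangle_ineq4[of "g v" "g v - rpoly (q n) v"] q(3)[rule_format, OF elim] D(2)[rule_format, OF elim]
        by (smt (verit) diff_diff_eq2 diff_add_cancel add_diff_cancel_left')
      ultimately show ?case unfolding norm_mult complex_mod_cnj using C(1) by (intro mult_mono) auto
    qed
  qed simp_all
  have "(\<lambda>n. cinner (vec (p n)) (vec (q n))) \<longlonglongrightarrow> cinner x y" by (intro cinner.tendsto p q)
  then show ?thesis using lim unfolding cinner_vec L2_inner_def by (rule LIMSEQ_unique)
qed

lemma Rep_norm:
  assumes f: "Rep f x" and meas: "f \<in> borel_measurable borel"
  shows "(norm x)\<^sup>2 = (\<integral>v. (cmod (f v))\<^sup>2 \<partial>\<mu>)"
proof -
  have "complex_of_real ((norm x)\<^sup>2) = (\<integral>v. cnj (f v) * f v \<partial>\<mu>)"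
    using Rep_cinner[OF f f meas meas] by (simp add: cinner_self L2_inner_def)
  also have "\<dots> = complex_of_real (\<integral>v. (cmod (f v))\<^sup>2 \<partial>\<mu>)"
    unfolding of_real_cmod_square[symmetric] by (rule integral_complex_of_real)
  finally show ?thesis by (simp only: of_real_eq_iff)
qed

section \<open>Composition with \<pi> and the odd factor in the functional model\<close>

lemma B_ev: "B (ev x) = (1 / (2 * \<tau>)) *\<^sub>R \<Theta> (B x) x"
  using B_Theta[of x 0] by (simp add: Theta_ev P.zero zero)

text \<open>With z = \<Theta> x y the second component gives x = - B y, and then the first is (P -
  B^2) y = 4\<tau>(\<tau> - 1) y. Injectivity serves to cancel a factor v.\<close>

lemma B_inj: "B z = 0 \<Longrightarrow> z = 0"
proof -
  assume "B z = 0"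
  obtain x y where z: "z = \<Theta> x y" by (rule Theta_cases)
  have "\<Theta> (B x + P y) (x + B y) = 0" using \<open>B z = 0\<close> \<tau> unfolding z B_Theta by simp
  then have "ev (B x + P y) + od (\<Phi> (x + B y)) = ev 0 + od (\<Phi> 0)" by (simp add: Theta_def Phi.zero)
  then have "(B x + P y, \<Phi> (x + B y)) = (0, \<Phi> 0)" unfolding U_op_ev_od[symmetric] by simp
  then have 1: "B x + P y = 0" and "\<Phi> (x + B y) = \<Phi> 0" by simp_all
  from injD[OF bij_is_inj[OF bij_Phi] this(2)] have 2: "x + B y = 0" .
  have x: "x = - B y" using 2 by (simp add: eq_neg_iff_add_eq_0)
  have "(4 * \<tau> * (\<tau> - 1)) *\<^sub>R y = 0" using 1 by (simp add: x neg shift_sq_def)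
  then have "y = 0" using \<tau> by simp
  then show "z = 0" by (simp add: z x Theta_ev zero)
qed

text \<open>The step shows that multiplying by \<pi>(v) corresponds to x \<mapsto>
  \<open>B x\<close> inside \<open>ev\<close>. As \<pi> has a pole, the identity is first multiplied
  by v, giving v \<pi>(v) = \<tau> v^2 - (\<tau> - 1); the fixed-point equation evaluates the right
  side, and injectivity of B removes v.\<close>

lemma Rep_poly_comp: "Rep (\<lambda>v. rpoly p (ratmap \<tau> v)) (ev (vec p))"
proof (induction p)
  case 0 show ?case using Rep_zero by (simp add: vec_def)
next
  case (pCons a p)
  define g where "g v = rpoly p (ratmap \<tau> v)" for v
  define x where "x = vec p"
  have cont: "continuous_on K (\<lambda>v. complex_of_real (ratmap \<tau> v) * g v)"
    unfolding g_def by (intro continuous_intros continuous_ratmap)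
  then obtain y where y: "Rep (\<lambda>v. complex_of_real (ratmap \<tau> v) * g v) y" using Rep_exists by blast
  have g: "Rep g (ev x)" using pCons.IH by (simp add: g_def[abs_def] x_def)
  have "B y = poly_op [:- complex_of_real (\<tau> - 1), 0, complex_of_real \<tau>:] B (ev x)"
  proof (rule Rep_unique[OF Rep_times[OF y] Rep_poly_mult[OF g]])
    fix v assume "v \<in> K"
    then have "v \<noteq> 0" by (rule julia_nonzero)
    then have "v * ratmap \<tau> v = v * v * \<tau> - (\<tau> - 1)" by (simp add: ratmap_def field_simps)
    then have "complex_of_real v * complex_of_real (ratmap \<tau> v) = complex_of_real (v * v * \<tau> - (\<tau> - 1))"
      by (metis of_real_mult)
    moreover have "rpoly [:- complex_of_real (\<tau> - 1), 0, complex_of_real \<tau>:] v =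
        complex_of_real (v * v * \<tau> - (\<tau> - 1))" by simp
    ultimately show "complex_of_real v * (complex_of_real (ratmap \<tau> v) * g v) =
        rpoly [:- complex_of_real (\<tau> - 1), 0, complex_of_real \<tau>:] v * g v"
      by (simp only: mult.assoc[symmetric])
  qed
  also have "\<dots> = \<tau> *\<^sub>R B (B (ev x)) - (\<tau> - 1) *\<^sub>R ev x"
    by (rule ell2_eqI) (simp add: zero add scaleC scaleR_eq_scaleC algebra_simps)
  also have "B (B (ev x)) = (1 / (2 * \<tau>)) *\<^sub>R (1 / (2 * \<tau>)) *\<^sub>R \<Theta> (B (B x) + P x) (B x + B x)"
    by (simp only: B_ev scaleR B_Theta)
  also have "\<tau> *\<^sub>R \<dots> - (\<tau> - 1) *\<^sub>R ev x = (1 / (2 * \<tau>)) *\<^sub>R \<Theta> (B (B x)) (B x)"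
  proof -
    have "\<tau> *\<^sub>R (1 / (2 * \<tau>)) *\<^sub>R (1 / (2 * \<tau>)) *\<^sub>R \<Theta> (B (B x) + P x) (B x + B x) - (\<tau> - 1) *\<^sub>R \<Theta> x 0
       = \<Theta> (\<tau> *\<^sub>R (1 / (2 * \<tau>)) *\<^sub>R (1 / (2 * \<tau>)) *\<^sub>R (B (B x) + P x) - (\<tau> - 1) *\<^sub>R x)
          (\<tau> *\<^sub>R (1 / (2 * \<tau>)) *\<^sub>R (1 / (2 * \<tau>)) *\<^sub>R (B x + B x) - (\<tau> - 1) *\<^sub>R 0)"
      by (simp only: Theta_linear)
    also have "\<tau> *\<^sub>R (1 / (2 * \<tau>)) *\<^sub>R (1 / (2 * \<tau>)) *\<^sub>R (B (B x) + P x) - (\<tau> - 1) *\<^sub>R x = (1 / (2 * \<tau>)) *\<^sub>R B (B x)"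
      by (rule ell2_eqI) (use \<tau> in \<open>simp add: shift_sq_def field_simps\<close>)
    also have "\<tau> *\<^sub>R (1 / (2 * \<tau>)) *\<^sub>R (1 / (2 * \<tau>)) *\<^sub>R (B x + B x) - (\<tau> - 1) *\<^sub>R 0 = (1 / (2 * \<tau>)) *\<^sub>R B x"
      by (rule ell2_eqI) (use \<tau> in \<open>simp add: field_simps\<close>)
    finally show ?thesis by (simp add: Theta_ev)
  qed
  also have "\<dots> = B (ev (B x))" by (simp add: B_ev)
  finally have "B (y - ev (B x)) = 0" by (simp add: diff)
  then have "y = ev (B x)" using B_inj by fastforce
  with y have "Rep (\<lambda>v. complex_of_real (ratmap \<tau> v) * g v) (ev (B x))" by simp
  from Rep_add[OF Rep_scaleC[OF Rep_one, of a] this] show ?case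
    using ev_ket[of 0] by (simp add: g_def x_def vec_def)
qed

lemma Rep_comp:
  assumes "Rep f x" shows "Rep (\<lambda>v. f (ratmap \<tau> v)) (ev x)"
proof (rule Rep_limit)
  fix \<delta> :: real assume "\<delta> > 0"
  obtain p where p: "\<And>v. v \<in> K \<Longrightarrow> cmod (f v - rpoly p v) \<le> \<delta>" "norm (x - vec p) \<le> \<delta>"
    using RepD[OF assms \<open>\<delta> > 0\<close>] by blast
  have "norm (ev x - ev (vec p)) \<le> \<delta>" using p(2) by (simp flip: ev_od_linear)
  then show "\<exists>g y. Rep g y \<and> (\<forall>v\<in>K. cmod (f (ratmap \<tau> v) - g v) \<le> \<delta>) \<and> norm (ev x - y) \<le> \<delta>"
    using p(1) ratmap_julia[OF \<tau>] Rep_poly_comp by blast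
qed

text \<open>Combines 2\<tau> v - \<pi>(v) = \<tau> v + (\<tau> - 1)/v with 2\<tau> B(ev x) = ev(B x)
  + od(\<Phi> x).\<close>

lemma Rep_odd:
  assumes "Rep f x" shows "Rep (\<lambda>v. complex_of_real (\<tau> * v + (\<tau> - 1) / v) * f (ratmap \<tau> v)) (od (\<Phi> x))"
proof -
  have "Rep (\<lambda>v. complex_of_real (2 * \<tau>) * (complex_of_real v * f (ratmap \<tau> v)) - complex_of_real (ratmap \<tau> v) * f (ratmap \<tau> v))
      (complex_of_real (2 * \<tau>) *\<^sub>C B (ev x) - ev (B x))"
    by (intro Rep_diff Rep_scaleC Rep_times[OF Rep_comp[OF assms]] Rep_comp[OF Rep_times[OF assms]])
  moreover have "complex_of_real (2 * \<tau>) *\<^sub>C B (ev x) - ev (B x) = od (\<Phi> x)"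
  proof -
    have "complex_of_real (2 * \<tau>) *\<^sub>C B (ev x) = \<Theta> (B x) x"
      using \<tau> by (simp only: B_ev scaleR_eq_scaleC[symmetric]) simp
    then show ?thesis by (simp add: Theta_def)
  qed
  ultimately have "Rep (\<lambda>v. complex_of_real (2 * \<tau>) * (complex_of_real v * f (ratmap \<tau> v)) - complex_of_real (ratmap \<tau> v) * f (ratmap \<tau> v))
      (od (\<Phi> x))" by (simp only:)
  then show ?thesis
  proof (rule Rep_cong)
    fix v assume "v \<in> K"
    have eq: "\<tau> * v + (\<tau> - 1) / v = 2 * \<tau> * v - ratmap \<tau> v" by (simp add: ratmap_def)
    show "complex_of_real (2 * \<tau>) * (complex_of_real v * f (ratmap \<tau> v)) - complex_of_real (ratmap \<tau> v) * f (ratmap \<tau> v)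
       = complex_of_real (\<tau> * v + (\<tau> - 1) / v) * f (ratmap \<tau> v)" unfolding eq by (simp add: algebra_simps)
  qed
qed

definition coef :: "nat \<Rightarrow> nat \<Rightarrow> complex" where "coef k j = coord (inv \<Phi> (ket k)) j"

lemma coef_upper: "k < j \<Longrightarrow> coef k j = 0"
  by (simp add: coef_def inv_Phi_ket P.gs_support)

lemma inv_Phi_ket_expand: "inv \<Phi> (ket k) = (\<Sum>j\<le>k. coef k j *\<^sub>C ket j)"
  unfolding coef_def inv_Phi_ket by (rule ket_expansion_finite) (rule P.gs_support)

text \<open>The recursion for \<open>e_fun\<close> mirrors the even and odd embeddings. In the odd
  case \<Phi> meets column m of its own inverse and returns \<open>ket m\<close>.\<close>

lemma Rep_e_fun: "Rep (e_fun \<tau> coef k) (ket k)"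
proof (induction k rule: less_induct)
  case (less k)
  consider "k = 0" | m where "k = 2 * m" "m > 0" | m where "k = 2 * m + 1" by (metis evenE oddE gr0I mult_0_right)
  then show ?case
  proof cases
    case 1 then show ?thesis using Rep_one by (simp add: e_fun_rec(1)[abs_def])
  next
    case 2
    then have "Rep (e_fun \<tau> coef m) (ket m)" using less by simp
    from Rep_comp[OF this] have "Rep (\<lambda>v. e_fun \<tau> coef m (ratmap \<tau> v)) (ket (2 * m))" by (simp only: ev_ket)
    moreover have "e_fun \<tau> coef (2 * m) = (\<lambda>v. e_fun \<tau> coef m (ratmap \<tau> v))"
      by (rule ext) (simp only: e_fun_rec(2))
    ultimately show ?thesis by (simp only: 2(1))
  next
    case 3
    have "Rep (\<lambda>v. \<Sum>j\<le>m. coef m j * e_fun \<tau> coef j v) (\<Sum>j\<le>m. coef m j *\<^sub>C ket j)"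
      using less 3 by (intro Rep_sum Rep_scaleC) auto
    from Rep_odd[OF this[folded inv_Phi_ket_expand]]
    have "Rep (\<lambda>v. complex_of_real (\<tau> * v + (\<tau> - 1) / v) * (\<Sum>j\<le>m. coef m j * e_fun \<tau> coef j (ratmap \<tau> v))) (ket (2 * m + 1))"
      by (simp only: inv_Phi_ket Phi_gs od_ket)
    moreover have "e_fun \<tau> coef (2 * m + 1) =
        (\<lambda>v. complex_of_real (\<tau> * v + (\<tau> - 1) / v) * (\<Sum>j\<le>m. coef m j * e_fun \<tau> coef j (ratmap \<tau> v)))"
      by (rule ext) (simp only: e_fun_rec(3) atLeast0AtMost)
    ultimately show ?thesis by (simp only: 3)
  qed
qed

lemma measurable_ratmap [measurable]: "ratmap \<tau> \<in> borel_measurable borel"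
  unfolding ratmap_def by measurable

lemma measurable_e_fun [measurable]: "e_fun \<tau> c k \<in> borel_measurable borel"
proof (induction k rule: less_induct)
  case (less k)
  consider "k = 0" | m where "k = 2 * m" "m > 0" | m where "k = 2 * m + 1" by (metis evenE oddE gr0I mult_0_right)
  then show ?case
  proof cases
    case 1 then show ?thesis by (simp add: e_fun_rec(1)[abs_def])
  next
    case 2
    then have [measurable]: "e_fun \<tau> c m \<in> borel_measurable borel" using less by simp
    have "(\<lambda>v. e_fun \<tau> c m (ratmap \<tau> v)) \<in> borel_measurable borel" by measurable
    then show ?thesis by (simp add: 2 e_fun_rec(2)[abs_def])
  next
    case 3
    have *: "(\<lambda>v. e_fun \<tau> c j (ratmap \<tau> v)) \<in> borel_measurable borel" if "j \<le> m" for j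
      by (rule measurable_compose[OF measurable_ratmap less]) (use 3 that in simp)
    have "(\<lambda>v. complex_of_real (\<tau> * v + (\<tau> - 1) / v) * (\<Sum>j=0..m. c m j * e_fun \<tau> c j (ratmap \<tau> v)))
        \<in> borel_measurable borel"
      using * by (intro borel_measurable_times borel_measurable_sum borel_measurable_const) (measurable, auto)
    then show ?thesis by (simp only: 3 e_fun_rec(3)[abs_def])
  qed
qed

text \<open>Every basis vector represents some \<open>e_fun\<close>, hence is a limit of vectors
  p(B)|0>: the isometry has dense range.\<close>

lemma vec_dense:
  assumes "e > 0" shows "\<exists>p. norm (vec p - x) < e"
proof -
  obtain N where N: "norm ((\<Sum>k<N. coord x k *\<^sub>C ket k) - x) < e / 2"
    using LIMSEQ_D[OF ket_expansion[of x], of "e / 2"] assms by auto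
  define s where "s = (\<Sum>k<N. coord x k *\<^sub>C ket k)"
  have "Rep (\<lambda>v. \<Sum>k<N. coord x k * e_fun \<tau> coef k v) s"
    unfolding s_def by (intro Rep_sum Rep_scaleC Rep_e_fun) auto
  moreover have "e / 2 > 0" using assms by simp
  ultimately obtain p where "norm (s - vec p) \<le> e / 2" by (rule RepD)
  then have "norm (vec p - x) < e"
    using N norm_triangle_ineq[of "vec p - s" "s - x"] norm_minus_commute[of s "vec p"] by (simp add: s_def)
  then show ?thesis ..
qed

lemma cyclic: "cyclic_vector B (ket 0)"
  unfolding cyclic_vector_def
proof (intro equalityI subsetI)
  fix x :: ell2
  show "x \<in> closure (range (\<lambda>p. poly_op p B (ket 0)))"
    unfolding closure_approachable using vec_dense[of _ x] by (auto simp: vec_def dist_norm)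
qed simp

section \<open>Invertibility of q(B) and the spectrum\<close>

lemma norm_vec_sq: "(norm (vec p))\<^sup>2 = (\<integral>v. (cmod (rpoly p v))\<^sup>2 \<partial>\<mu>)"
  by (rule Rep_norm[OF Rep_poly]) simp

text \<open>In the model q(B) multiplies by q, and |q| has a positive minimum on the compact set K;
  density extends the estimate to all vectors.\<close>

lemma poly_op_bounded_below:
  assumes nz: "\<And>v. v \<in> K \<Longrightarrow> rpoly q v \<noteq> 0"
  shows "\<exists>\<delta>>0. \<forall>x. \<delta> * norm x \<le> norm (poly_op q B x)"
proof -
  interpret q: bounded_clinear_op "poly_op q B" by standard (rule bounded_clinear_poly_op)
  have "K \<noteq> {}" using coding_in_julia[OF \<tau>] by blast
  moreover have "continuous_on K (\<lambda>v. cmod (rpoly q v))" by (intro continuous_intros)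
  ultimately obtain v0 where v0: "v0 \<in> K" "\<And>v. v \<in> K \<Longrightarrow> cmod (rpoly q v0) \<le> cmod (rpoly q v)"
    using continuous_attains_inf[OF compact_K] by metis
  define \<delta> where "\<delta> = cmod (rpoly q v0)"
  have \<delta>: "\<delta> > 0" using nz[OF v0(1)] by (simp add: \<delta>_def)
  have sq_int: "integrable \<mu> (\<lambda>v. (cmod (rpoly p v))\<^sup>2)" for p
  proof -
    obtain C where C: "\<forall>v\<in>K. cmod (rpoly p v) \<le> C" using Rep_bounded[OF Rep_poly] by blast
    show ?thesis
      by (rule integrable_bounded[of _ "C\<^sup>2"]) (use C in \<open>auto intro!: power_mono\<close>)
  qed
  have poly: "\<delta> * norm (vec p) \<le> norm (poly_op q B (vec p))" for p
  proof (rule power2_le_imp_le)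
    have "(\<delta> * norm (vec p))\<^sup>2 = (\<integral>v. \<delta>\<^sup>2 * (cmod (rpoly p v))\<^sup>2 \<partial>\<mu>)"
      by (simp add: power_mult_distrib norm_vec_sq)
    also have "\<dots> \<le> (\<integral>v. (cmod (rpoly (q * p) v))\<^sup>2 \<partial>\<mu>)"
    proof (rule integral_mono_AE)
      show "AE v in \<mu>. \<delta>\<^sup>2 * (cmod (rpoly p v))\<^sup>2 \<le> (cmod (rpoly (q * p) v))\<^sup>2"
        using AE_K
      proof eventually_elim
        case (elim v)
        then have "\<delta>\<^sup>2 \<le> (cmod (rpoly q v))\<^sup>2" using v0(2) \<delta> by (intro power_mono) (auto simp: \<delta>_def)
        then show ?case by (simp add: norm_mult power_mult_distrib mult_right_mono)
      qed
    qed (use sq_int[of p] sq_int[of "q * p"] in auto)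
    also have "\<dots> = (norm (poly_op q B (vec p)))\<^sup>2" by (simp only: norm_vec_sq[symmetric] vec_mult)
    finally show "(\<delta> * norm (vec p))\<^sup>2 \<le> (norm (poly_op q B (vec p)))\<^sup>2" .
  qed simp
  have "\<delta> * norm x \<le> norm (poly_op q B x)" for x
  proof -
    have "\<exists>p. norm (vec p - x) < inverse (real (Suc n))" for n by (rule vec_dense) simp
    then obtain p where p: "\<And>n. norm (vec (p n) - x) < inverse (real (Suc n))" by metis
    have "(\<lambda>n. vec (p n) - x) \<longlonglongrightarrow> 0"
      by (rule Lim_null_comparison[OF always_eventually LIMSEQ_inverse_real_of_nat]) (use p less_imp_le in blast)
    then have p: "(\<lambda>n. vec (p n)) \<longlonglongrightarrow> x" by (simp add: LIM_zero_iff)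
    show ?thesis
      by (rule LIMSEQ_le[OF tendsto_mult[OF tendsto_const tendsto_norm[OF p]] tendsto_norm[OF q.tendsto[OF p]]])
        (use poly in auto)
  qed
  with \<delta> show ?thesis by blast
qed

lemma poly_op_invertible:
  assumes nz: "\<And>v. v \<in> K \<Longrightarrow> rpoly q v \<noteq> 0"
  shows "bij (poly_op q B)" "bounded_clinear (inv (poly_op q B))"
proof -
  let ?q = "map_poly cnj q"
  obtain \<delta> where \<delta>: "\<delta> > 0" "\<And>x. \<delta> * norm x \<le> norm (poly_op q B x)" using poly_op_bounded_below[OF nz] by blast
  \<comment> \<open>q(B) need not be coercive, but composed with its adjoint it is; since the two
    commute, surjectivity of the product gives that of q(B).\<close>
  have "bij (poly_op (?q * q) B)"
  proof (rule Lax_Milgram[OF bounded_clinear_poly_op])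
    show "\<delta>\<^sup>2 > 0" using \<delta> by simp
    fix x
    have "\<delta>\<^sup>2 * (norm x)\<^sup>2 \<le> (norm (poly_op q B x))\<^sup>2"
      using power_mono[OF \<delta>(2)[of x], of 2] \<delta>(1) by (simp add: power_mult_distrib)
    also have "\<dots> = Re (cinner x (poly_op (?q * q) B x))"
      by (simp add: Re_cinner_self[symmetric] cinner_poly_op poly_op_mult)
    finally show "\<delta>\<^sup>2 * (norm x)\<^sup>2 \<le> Re (cinner x (poly_op (?q * q) B x))" .
  qed
  then have "bij (poly_op (q * ?q) B)" by (simp add: mult.commute)
  then have surj: "surj (poly_op q B)" unfolding bij_def surj_def by (metis poly_op_mult)
  have "inj (poly_op q B)"
  proof (rule injI)
    fix x y assume "poly_op q B x = poly_op q B y"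
    then have "\<delta> * norm (x - y) \<le> 0" using \<delta>(2)[of "x - y"] by (simp add: poly_op_diff_arg)
    then show "x = y" using \<delta>(1) by (simp add: mult_le_0_iff)
  qed
  with surj show bij: "bij (poly_op q B)" by (simp add: bij_def)
  show "bounded_clinear (inv (poly_op q B))" by (rule bounded_clinear_inv[OF bounded_clinear_poly_op bij \<delta>])
qed

lemma op_spectrum_subset: "op_spectrum B \<subseteq> complex_of_real ` K"
proof
  fix z assume z: "z \<in> op_spectrum B"
  show "z \<in> complex_of_real ` K"
  proof (rule ccontr)
    assume "z \<notin> complex_of_real ` K"
    then have "\<And>v. v \<in> K \<Longrightarrow> rpoly [:- z, 1:] v \<noteq> 0" by auto
    from poly_op_invertible[OF this] have inv: "bij (poly_op [:- z, 1:] B)" "bounded_clinear (inv (poly_op [:- z, 1:] B))" by auto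
    have eq: "B x - z *\<^sub>C x = poly_op [:- z, 1:] B x" for x by (simp add: zero scaleC.minus_left)
    have "inv (poly_op [:- z, 1:] B) (poly_op [:- z, 1:] B x) = x" "poly_op [:- z, 1:] B (inv (poly_op [:- z, 1:] B) x) = x" for x
      using inv(1) by (auto simp del: poly_op_pCons simp: bij_is_inj bij_is_surj surj_f_inv_f)
    with inv(2) have "\<exists>R. bounded_clinear R \<and> (\<forall>x. R (B x - z *\<^sub>C x) = x) \<and> (\<forall>x. B (R x) - z *\<^sub>C R x = x)"
      unfolding eq by (intro exI[of _ "inv (poly_op [:- z, 1:] B)"] conjI allI)
    then have "z \<notin> op_spectrum B" unfolding op_spectrum_def by blast
    with z show False by blast
  qed
qed

lemma admissible_B: "admissible B"
  unfolding admissible_def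
proof (intro conjI)
  show "selfadjoint B" using selfadj F by (simp add: selfadjoint_def)
  show "cyclic_vector B (ket 0)" by (rule cyclic)
  show "op_spectrum B \<subseteq> complex_of_real ` {- 1..1}"
    using op_spectrum_subset julia_subset[OF \<tau>] E1_subset[OF \<tau>] by (meson image_mono order_trans)
qed

end

section \<open>Spectral measure, orthonormal basis and rational functions\<close>

context compact_prob
begin

text \<open>Extended values let smallness of a distance include its finiteness, so no integrability
  conditions are carried along.\<close>

definition L2sq :: "(real \<Rightarrow> complex) \<Rightarrow> ennreal" where
  "L2sq f = (\<integral>\<^sup>+v. ennreal ((cmod (f v))\<^sup>2) \<partial>\<mu>)"

lemma norm_add_sq_le: "(norm (a + b))\<^sup>2 \<le> 2 * (norm a)\<^sup>2 + 2 * (norm b)\<^sup>2" for a b :: "'b::real_normed_vector"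
proof -
  have "(norm (a + b))\<^sup>2 \<le> (norm a + norm b)\<^sup>2" by (intro power_mono norm_triangle_ineq) auto
  also have "\<dots> \<le> 2 * (norm a)\<^sup>2 + 2 * (norm b)\<^sup>2"
    using sum_squares_bound[of "norm a" "norm b"] by (simp add: power2_sum)
  finally show ?thesis .
qed

lemma L2sq_add_le:
  assumes [measurable]: "f \<in> borel_measurable borel" "g \<in> borel_measurable borel"
  shows "L2sq (\<lambda>v. f v + g v) \<le> 2 * L2sq f + 2 * L2sq g"
proof -
  have "L2sq (\<lambda>v. f v + g v) \<le> (\<integral>\<^sup>+v. 2 * ennreal ((cmod (f v))\<^sup>2) + 2 * ennreal ((cmod (g v))\<^sup>2) \<partial>\<mu>)"
    unfolding L2sq_def
  proof (intro nn_integral_mono)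
    fix v
    have "ennreal ((cmod (f v + g v))\<^sup>2) \<le> ennreal (2 * (cmod (f v))\<^sup>2 + 2 * (cmod (g v))\<^sup>2)"
      by (intro ennreal_leI norm_add_sq_le)
    then show "ennreal ((cmod (f v + g v))\<^sup>2) \<le> 2 * ennreal ((cmod (f v))\<^sup>2) + 2 * ennreal ((cmod (g v))\<^sup>2)"
      by (simp add: ennreal_mult)
  qed
  also have "\<dots> = 2 * L2sq f + 2 * L2sq g"
    unfolding L2sq_def by (simp add: nn_integral_add nn_integral_cmult)
  finally show ?thesis .
qed

lemma L2sq_add_less:
  assumes "f \<in> borel_measurable borel" "g \<in> borel_measurable borel"
    and "L2sq f < ennreal (e / 4)" "L2sq g < ennreal (e / 4)"
  shows "L2sq (\<lambda>v. f v + g v) < ennreal e"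
proof -
  have e: "e > 0" using assms(3) by (metis ennreal_neg not_less_zero not_less divide_nonpos_pos zero_less_numeral)
  have "L2sq (\<lambda>v. f v + g v) \<le> 2 * L2sq f + 2 * L2sq g" by (rule L2sq_add_le) fact+
  also have "\<dots> < 2 * ennreal (e / 4) + 2 * ennreal (e / 4)"
    using assms(3,4) by (intro add_strict_mono ennreal_mult_strict_left_mono) (auto simp: less_top[symmetric])
  also have "2 * ennreal (e / 4) = ennreal (e / 2)" using ennreal_mult'[of 2 "e / 4"] e by simp
  also have "ennreal (e / 2) + ennreal (e / 2) = ennreal e" using e by (subst ennreal_plus[symmetric]) auto
  finally show ?thesis .
qed

definition approximable :: "(real \<Rightarrow> complex) \<Rightarrow> bool" where
  "approximable f \<longleftrightarrow> f \<in> borel_measurable borel \<and>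
    (\<forall>e>0. \<exists>g. continuous_on UNIV g \<and> L2sq (\<lambda>v. f v - g v) < ennreal e)"

lemma approximable_limit:
  assumes f: "f \<in> borel_measurable borel"
    and lim: "\<And>e. e > 0 \<Longrightarrow> \<exists>g. approximable g \<and> L2sq (\<lambda>v. f v - g v) < ennreal e"
  shows "approximable f"
  unfolding approximable_def
proof (intro conjI allI impI f)
  fix e :: real assume "e > 0"
  then have e: "e / 4 > 0" by simp
  obtain g where g: "approximable g" "L2sq (\<lambda>v. f v - g v) < ennreal (e / 4)" using lim[OF e] by blast
  obtain h where h: "continuous_on UNIV h" "L2sq (\<lambda>v. g v - h v) < ennreal (e / 4)"
    using g(1) e unfolding approximable_def by blast
  have [measurable]: "g \<in> borel_measurable borel" "h \<in> borel_measurable borel" "f \<in> borel_measurable borel"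
    using g(1) h(1) f by (auto simp: approximable_def intro: borel_measurable_continuous_onI)
  have "L2sq (\<lambda>v. (f v - g v) + (g v - h v)) < ennreal e" by (rule L2sq_add_less) (use g(2) h(2) in auto)
  then show "\<exists>g. continuous_on UNIV g \<and> L2sq (\<lambda>v. f v - g v) < ennreal e" using h(1) by auto
qed

lemma approximable_add:
  assumes "approximable f" "approximable g" shows "approximable (\<lambda>v. f v + g v)"
  unfolding approximable_def
proof (intro conjI allI impI)
  have [measurable]: "f \<in> borel_measurable borel" "g \<in> borel_measurable borel" using assms by (auto simp: approximable_def)
  show "(\<lambda>v. f v + g v) \<in> borel_measurable borel" by simp
  fix e :: real assume "e > 0"
  then have e: "e / 4 > 0" by simp
  obtain f' where f': "continuous_on UNIV f'" "L2sq (\<lambda>v. f v - f' v) < ennreal (e / 4)" using assms(1) e unfolding approximable_def by blast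
  obtain g' where g': "continuous_on UNIV g'" "L2sq (\<lambda>v. g v - g' v) < ennreal (e / 4)" using assms(2) e unfolding approximable_def by blast
  have [measurable]: "f' \<in> borel_measurable borel" "g' \<in> borel_measurable borel"
    using f'(1) g'(1) by (auto intro: borel_measurable_continuous_onI)
  have "L2sq (\<lambda>v. (f v - f' v) + (g v - g' v)) < ennreal e" by (rule L2sq_add_less) (use f'(2) g'(2) in auto)
  then have "L2sq (\<lambda>v. f v + g v - (f' v + g' v)) < ennreal e" by (simp add: algebra_simps)
  moreover have "continuous_on UNIV (\<lambda>v. f' v + g' v)" by (intro continuous_intros f' g')
  ultimately show "\<exists>h. continuous_on UNIV h \<and> L2sq (\<lambda>v. f v + g v - h v) < ennreal e" by blast
qed

lemma approximable_const: "approximable (\<lambda>v. a)"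
  unfolding approximable_def L2sq_def by (auto intro!: exI[of _ "\<lambda>v. a"])

lemma approximable_sum:
  "finite S \<Longrightarrow> (\<And>i. i \<in> S \<Longrightarrow> approximable (f i)) \<Longrightarrow> approximable (\<lambda>v. \<Sum>i\<in>S. f i v)"
  by (induction S rule: finite_induct) (simp_all add: approximable_const approximable_add)

text \<open>By regularity \<open>S\<close> is squeezed between a compact and an open set of nearly the same measure;
  a Urysohn function for these two approximates the indicator function.\<close>

lemma approximable_indicator:
  assumes S: "S \<in> sets borel" shows "approximable (\<lambda>v. indicator S v * a)"
  unfolding approximable_def
proof (intro conjI allI impI)
  note [measurable] = S
  show "(\<lambda>v. indicator S v * a) \<in> borel_measurable borel" by measurable
  fix e :: real assume "e > 0"
  \<comment> \<open>The squeezing sets will differ by measure less than 2d. The summand 1 covers a =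
    0 and makes the final inequality strict.\<close>
  define d where "d = e / (2 * ((cmod a)\<^sup>2 + 1))"
  have den: "(cmod a)\<^sup>2 + 1 > 0" by (simp add: add_nonneg_pos)
  have d: "d > 0" using \<open>e > 0\<close> den by (simp add: d_def)
  have fin: "emeasure \<mu> (space \<mu>) \<noteq> \<infinity>" by simp
  have "emeasure \<mu> S < emeasure \<mu> S + ennreal d" using d
    by (simp add: emeasure_eq_measure ennreal_plus[symmetric] ennreal_less_iff del: ennreal_plus)
  then have "(INF U \<in> {U. S \<subseteq> U \<and> open U}. emeasure \<mu> U) < emeasure \<mu> S + ennreal d"
    using outer_regular[OF sets_mu fin S] by simp
  then obtain U where U: "S \<subseteq> U" "open U" "emeasure \<mu> U < emeasure \<mu> S + ennreal d" by (auto simp: INF_less_iff)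
  have "\<exists>C. C \<subseteq> S \<and> compact C \<and> emeasure \<mu> S < emeasure \<mu> C + ennreal d"
  proof (rule ccontr)
    assume no: "\<not> ?thesis"
    have "emeasure \<mu> C + ennreal d \<le> emeasure \<mu> S" if "C \<subseteq> S" "compact C" for C
      using no that by (auto simp: not_less)
    then have *: "emeasure \<mu> C \<le> emeasure \<mu> S - ennreal d" if "C \<subseteq> S" "compact C" for C
      using that by (metis ennreal_add_diff_cancel_right ennreal_minus_mono ennreal_neq_top order_refl)
    have "emeasure \<mu> S = (SUP C \<in> {C. C \<subseteq> S \<and> compact C}. emeasure \<mu> C)" by (rule inner_regular[OF sets_mu fin S])
    also have "\<dots> \<le> emeasure \<mu> S - ennreal d" by (rule SUP_least) (use * in auto)
    finally have le: "emeasure \<mu> S \<le> emeasure \<mu> S - ennreal d" .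
    \<comment> \<open>The empty set is a competitor among the compact sets. Without this bound,
      truncated subtraction would leave the case of measure 0 consistent.\<close>
    have "ennreal d \<le> emeasure \<mu> S" using no[simplified, rule_format, of "{}"] by (simp add: not_less)
    then show False
      using le d by (simp add: emeasure_eq_measure ennreal_minus)
  qed
  then obtain C where C: "C \<subseteq> S" "compact C" "emeasure \<mu> S < emeasure \<mu> C + ennreal d" by blast
  have [measurable]: "U \<in> sets borel" "C \<in> sets borel" using U C by (auto intro: borel_open borel_compact)
  have "measure \<mu> U < measure \<mu> S + d" "measure \<mu> S < measure \<mu> C + d"
    using U(3) C(3) d by (simp_all add: emeasure_eq_measure ennreal_plus[symmetric] ennreal_less_iff del: ennreal_plus)
  moreover have "measure \<mu> (U - C) = measure \<mu> U - measure \<mu> C"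
    using U C by (intro finite_measure_Diff) auto
  ultimately have UC: "measure \<mu> (U - C) < 2 * d" by linarith
  obtain g :: "real \<Rightarrow> real" where g: "continuous_on UNIV g" "\<And>v. g v \<in> closed_segment 1 0"
      "\<And>v. v \<in> C \<Longrightarrow> g v = 1" "\<And>v. v \<in> - U \<Longrightarrow> g v = 0"
    using Urysohn[of C "- U" "1::real" "0::real"] U C by (auto simp: compact_imp_closed)
  have g01: "0 \<le> g v" "g v \<le> 1" for v using g(2)[of v] by (auto simp: closed_segment_eq_real_ivl split: if_splits)
  have "L2sq (\<lambda>v. indicator S v * a - of_real (g v) * a) \<le> (\<integral>\<^sup>+v. ennreal ((cmod a)\<^sup>2) * indicator (U - C) v \<partial>\<mu>)"
    unfolding L2sq_def
  proof (intro nn_integral_mono)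
    fix v
    have "cmod (indicator S v - of_real (g v)) = \<bar>indicator S v - g v\<bar>"
      by (metis norm_of_real of_real_diff of_real_indicator)
    moreover have "\<bar>indicator S v - g v\<bar> \<le> indicator (U - C) v"
      using g(3,4)[of v] g01[of v] U(1) C(1) by (auto simp: indicator_def)
    ultimately have "(cmod ((indicator S v - of_real (g v)) * a))\<^sup>2 \<le> (indicator (U - C) v * cmod a)\<^sup>2"
      unfolding norm_mult by (intro power_mono mult_right_mono) auto
    then show "ennreal ((cmod (indicator S v * a - of_real (g v) * a))\<^sup>2) \<le> ennreal ((cmod a)\<^sup>2) * indicator (U - C) v"
      by (auto simp: left_diff_distrib[symmetric] indicator_def power_mult_distrib intro!: ennreal_leI split: if_splits)
  qed
  also have "\<dots> = ennreal ((cmod a)\<^sup>2) * emeasure \<mu> (U - C)" by (rule nn_integral_cmult_indicator) simp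
  also have "\<dots> = ennreal ((cmod a)\<^sup>2 * measure \<mu> (U - C))" by (simp add: emeasure_eq_measure ennreal_mult)
  also have "\<dots> < ennreal e"
  proof (rule ennreal_lessI)
    have "(cmod a)\<^sup>2 * measure \<mu> (U - C) \<le> (cmod a)\<^sup>2 * (2 * d)" using UC by (intro mult_left_mono) auto
    also have "\<dots> < ((cmod a)\<^sup>2 + 1) * (2 * d)" using d by simp
    also have "\<dots> = e" unfolding d_def using den by (simp add: field_simps)
    finally show "(cmod a)\<^sup>2 * measure \<mu> (U - C) < e" .
  qed fact
  finally show "\<exists>g. continuous_on UNIV g \<and> L2sq (\<lambda>v. indicator S v * a - g v) < ennreal e"
    by (intro exI[of _ "\<lambda>v. of_real (g v) * a"] conjI continuous_intros g)
qed

lemma approximable_simple: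
  assumes "simple_function \<mu> f" shows "approximable f"
proof -
  have sp: "space \<mu> = UNIV" using sets_eq_imp_space_eq[OF sets_mu] by simp
  have fin: "finite (range f)" and meas: "f -` {y} \<in> sets borel" if "y \<in> range f" for y
    using assms that unfolding simple_function_def sp by auto
  have fin: "finite (range f)" using assms unfolding simple_function_def sp by auto
  have "approximable (\<lambda>v. \<Sum>y\<in>range f. indicator (f -` {y}) v * y)"
    by (intro approximable_sum fin approximable_indicator meas)
  moreover have "(\<Sum>y\<in>range f. indicator (f -` {y}) v * y) = f v" for v
  proof -
    have "(\<Sum>y\<in>range f. indicator (f -` {y}) v * y) = (\<Sum>y\<in>range f. if f v = y then y else 0)"
      by (intro sum.cong) (auto simp: indicator_def)
    also have "\<dots> = f v" using fin by simp
    finally show ?thesis .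
  qed
  ultimately show ?thesis by simp
qed

lemma approximable_square_integrable:
  assumes "square_integrable \<mu> f" shows "approximable f"
proof (rule approximable_limit)
  have sp: "space \<mu> = UNIV" using sets_eq_imp_space_eq[OF sets_mu] by simp
  have f: "f \<in> borel_measurable \<mu>" and int: "integrable \<mu> (\<lambda>v. (cmod (f v))\<^sup>2)"
    using assms by (auto simp: square_integrable_def)
  then show [measurable]: "f \<in> borel_measurable borel" by simp
  fix e :: real assume e: "e > 0"
  obtain F where F: "\<And>i. simple_function \<mu> (F i)" "\<And>v. (\<lambda>i. F i v) \<longlonglongrightarrow> f v"
    "\<And>i v. cmod (F i v) \<le> 2 * cmod (f v)"
    using borel_measurable_implies_sequence_metric[OF f, of 0] unfolding sp by auto
  have [measurable]: "F i \<in> borel_measurable borel" for i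
    using approximable_simple[OF F(1)] by (simp add: approximable_def)
  have le: "(cmod (f v - F i v))\<^sup>2 \<le> 9 * (cmod (f v))\<^sup>2" for i v
  proof -
    have "cmod (f v - F i v) \<le> 3 * cmod (f v)" using norm_triangle_ineq4[of "f v" "F i v"] F(3)[of i v] by linarith
    then have "(cmod (f v - F i v))\<^sup>2 \<le> (3 * cmod (f v))\<^sup>2" by (intro power_mono) auto
    then show ?thesis by (simp add: power_mult_distrib)
  qed
  have "(\<lambda>i. \<integral>v. (cmod (f v - F i v))\<^sup>2 \<partial>\<mu>) \<longlonglongrightarrow> (\<integral>v. 0 \<partial>\<mu>)"
  proof (rule integral_dominated_convergence[where w = "\<lambda>v. 9 * (cmod (f v))\<^sup>2"])
    show "AE v in \<mu>. (\<lambda>i. (cmod (f v - F i v))\<^sup>2) \<longlonglongrightarrow> 0"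
    proof (rule AE_I2)
      fix v
      have "(\<lambda>i. (cmod (f v - F i v))\<^sup>2) \<longlonglongrightarrow> (cmod (f v - f v))\<^sup>2" by (intro tendsto_intros F(2))
      then show "(\<lambda>i. (cmod (f v - F i v))\<^sup>2) \<longlonglongrightarrow> 0" by simp
    qed
    show "AE v in \<mu>. norm ((cmod (f v - F i v))\<^sup>2) \<le> 9 * (cmod (f v))\<^sup>2" for i using le by simp
  qed (use int in auto)
  then have "(\<lambda>i. \<integral>v. (cmod (f v - F i v))\<^sup>2 \<partial>\<mu>) \<longlonglongrightarrow> 0" by simp
  from LIMSEQ_D[OF this e] obtain i where i: "(\<integral>v. (cmod (f v - F i v))\<^sup>2 \<partial>\<mu>) < e" by fastforce
  have "integrable \<mu> (\<lambda>v. (cmod (f v - F i v))\<^sup>2)"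
    by (rule Bochner_Integration.integrable_bound[of _ "\<lambda>v. 9 * (cmod (f v))\<^sup>2"]) (use int le in auto)
  then have "L2sq (\<lambda>v. f v - F i v) = ennreal (\<integral>v. (cmod (f v - F i v))\<^sup>2 \<partial>\<mu>)"
    unfolding L2sq_def by (rule nn_integral_eq_integral) auto
  also have "\<dots> < ennreal e" using i e by (intro ennreal_lessI)
  finally show "\<exists>g. approximable g \<and> L2sq (\<lambda>v. f v - g v) < ennreal e"
    using approximable_simple[OF F(1)] by blast
qed

end

context fixed_op
begin

lemma Rep_square_integrable:
  assumes "Rep f x" and [measurable]: "f \<in> borel_measurable borel"
  shows "square_integrable \<mu> f"
proof -
  obtain C where C: "\<forall>v\<in>K. cmod (f v) \<le> C" using Rep_bounded[OF assms(1)] by blast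
  have "integrable \<mu> (\<lambda>v. (cmod (f v))\<^sup>2)"
    by (rule integrable_bounded[of _ "C\<^sup>2"]) (use C in \<open>auto intro!: power_mono\<close>)
  then show ?thesis by (simp add: square_integrable_def)
qed

lemma L2sq_Rep:
  assumes f: "Rep f x" and meas: "f \<in> borel_measurable borel"
  shows "L2sq f = ennreal ((norm x)\<^sup>2)"
  unfolding L2sq_def Rep_norm[OF assms]
  by (rule nn_integral_eq_integral) (use Rep_square_integrable[OF assms] in \<open>auto simp: square_integrable_def\<close>)

text \<open>Orthonormality is transported from the vectors \<open>ket k\<close>. For totality, f is
  approximated by a continuous g, and the vector representing g by its coordinate expansion, which
  in the model is a combination of the \<open>e_fun\<close>.\<close>

lemma orthonormal_basis_e_fun: "orthonormal_basis \<mu> (e_fun \<tau> coef)"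
  unfolding orthonormal_basis_def
proof (intro conjI allI impI)
  show "square_integrable \<mu> (e_fun \<tau> coef k)" for k by (rule Rep_square_integrable[OF Rep_e_fun]) simp
  show "L2_inner \<mu> (e_fun \<tau> coef j) (e_fun \<tau> coef k) = (if j = k then 1 else 0)" for j k
    using Rep_cinner[OF Rep_e_fun[of j] Rep_e_fun[of k]] by (cases "j = k") (auto simp: coord_ket)
  fix f and \<epsilon> :: real assume f: "square_integrable \<mu> f" and "\<epsilon> > 0"
  then have e: "\<epsilon> / 4 > 0" "\<epsilon> / 4 / 4 > 0" by simp_all
  have [measurable]: "f \<in> borel_measurable borel"
    using approximable_square_integrable[OF f] by (simp add: approximable_def)
  obtain g where g: "continuous_on UNIV g" "L2sq (\<lambda>v. f v - g v) < ennreal (\<epsilon> / 4)"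
    using approximable_square_integrable[OF f] e unfolding approximable_def by blast
  have [measurable]: "g \<in> borel_measurable borel" by (rule borel_measurable_continuous_onI) fact
  obtain x where x: "Rep g x" using Rep_exists continuous_on_subset[OF g(1)] by blast
  have "sqrt (\<epsilon> / 4) > 0" using e by simp
  from LIMSEQ_D[OF ket_expansion[of x] this] obtain N where N: "norm ((\<Sum>k<N. coord x k *\<^sub>C ket k) - x) < sqrt (\<epsilon> / 4)" by blast
  define h where "h v = (\<Sum>k<N. coord x k * e_fun \<tau> coef k v)" for v
  have h: "Rep h (\<Sum>k<N. coord x k *\<^sub>C ket k)"
    unfolding h_def[abs_def] by (intro Rep_sum Rep_scaleC Rep_e_fun) auto
  have [measurable]: "h \<in> borel_measurable borel" unfolding h_def[abs_def] by measurable
  have "L2sq (\<lambda>v. g v - h v) = ennreal ((norm (x - (\<Sum>k<N. coord x k *\<^sub>C ket k)))\<^sup>2)"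
    by (rule L2sq_Rep[OF Rep_diff[OF x h]]) simp
  also have "\<dots> < ennreal (\<epsilon> / 4)"
  proof (rule ennreal_lessI)
    have "(norm (x - (\<Sum>k<N. coord x k *\<^sub>C ket k)))\<^sup>2 < (sqrt (\<epsilon> / 4))\<^sup>2"
      using N by (intro power_strict_mono) (auto simp: norm_minus_commute)
    then show "(norm (x - (\<Sum>k<N. coord x k *\<^sub>C ket k)))\<^sup>2 < \<epsilon> / 4" using e by simp
  qed (use e in simp)
  finally have "L2sq (\<lambda>v. (f v - g v) + (g v - h v)) < ennreal \<epsilon>" using g(2) by (intro L2sq_add_less) auto
  then have less: "(\<integral>\<^sup>+v. ennreal ((cmod (f v - h v))\<^sup>2) \<partial>\<mu>) < ennreal \<epsilon>" by (simp add: L2sq_def)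
  have "(\<integral>v. (cmod (f v - h v))\<^sup>2 \<partial>\<mu>) = enn2real (\<integral>\<^sup>+v. ennreal ((cmod (f v - h v))\<^sup>2) \<partial>\<mu>)"
    by (rule integral_eq_nn_integral) auto
  also have "\<dots> < \<epsilon>" using less \<open>\<epsilon> > 0\<close>
    by (cases "\<integral>\<^sup>+v. ennreal ((cmod (f v - h v))\<^sup>2) \<partial>\<mu>") (auto simp: ennreal_less_iff)
  finally show "\<exists>N a. (\<integral>v. (cmod (f v - (\<Sum>k<N. a k * e_fun \<tau> coef k v)))\<^sup>2 \<partial>\<mu>) < \<epsilon>"
    unfolding h_def by blast
qed

lemma matrix_entries:
  "cinner (ket j) (B (ket k)) = L2_inner \<mu> (e_fun \<tau> coef j) (\<lambda>v. complex_of_real v * e_fun \<tau> coef k v)"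
  by (rule Rep_cinner[OF Rep_e_fun Rep_times[OF Rep_e_fun]]) simp_all

text \<open>The spectrum has been shown to lie in K, so a point z of K could still lie outside the
  spectrum; then \<mu> must not charge a neighbourhood of z. The lower bound is tested on a bump
  supported in that neighbourhood, where multiplication by v - z would shrink norms too
  much.\<close>

lemma AE_resolvent:
  assumes "\<delta> > 0" and below: "\<And>x. \<delta> * norm x \<le> norm (B x - z *\<^sub>C x)"
  shows "AE v in \<mu>. \<delta> \<le> cmod (complex_of_real v - z)"
proof -
  define h where "h v = max 0 (\<delta> - cmod (complex_of_real v - z))" for v
  have cont: "continuous_on S h" for S unfolding h_def by (intro continuous_intros)
  then have [measurable]: "h \<in> borel_measurable borel" by (intro borel_measurable_continuous_onI)
  obtain x where x: "Rep (\<lambda>v. complex_of_real (h v)) x"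
    using Rep_exists[of "\<lambda>v. complex_of_real (h v)"] cont by (auto intro: continuous_intros)
  have x': "Rep (\<lambda>v. complex_of_real v * complex_of_real (h v) - z * complex_of_real (h v)) (B x - z *\<^sub>C x)"
    by (intro Rep_diff Rep_times Rep_scaleC x)
  have eq: "(cmod (complex_of_real v * complex_of_real (h v) - z * complex_of_real (h v)))\<^sup>2
      = (cmod (complex_of_real v - z))\<^sup>2 * (h v)\<^sup>2" for v
  proof -
    have "complex_of_real v * complex_of_real (h v) - z * complex_of_real (h v) = (complex_of_real v - z) * complex_of_real (h v)"
      by (simp add: algebra_simps)
    then show ?thesis by (simp add: norm_mult power_mult_distrib)
  qed
  have int: "integrable \<mu> (\<lambda>v. (h v)\<^sup>2)" "integrable \<mu> (\<lambda>v. (cmod (complex_of_real v - z))\<^sup>2 * (h v)\<^sup>2)"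
    using Rep_square_integrable[OF x] Rep_square_integrable[OF x'] by (simp_all add: square_integrable_def eq)
  define g where "g v = (\<delta>\<^sup>2 - (cmod (complex_of_real v - z))\<^sup>2) * (h v)\<^sup>2" for v
  have g0: "0 \<le> g v" for v
  proof (cases "cmod (complex_of_real v - z) < \<delta>")
    case True
    then have "(cmod (complex_of_real v - z))\<^sup>2 \<le> \<delta>\<^sup>2" by (intro power_mono) auto
    then show ?thesis by (simp add: g_def)
  qed (simp add: g_def h_def)
  have intg: "integrable \<mu> g" using int unfolding g_def left_diff_distrib by simp
  have "(\<delta> * norm x)\<^sup>2 \<le> (norm (B x - z *\<^sub>C x))\<^sup>2" using below[of x] \<open>\<delta> > 0\<close> by (intro power_mono) auto
  moreover have "(norm x)\<^sup>2 = (\<integral>v. (h v)\<^sup>2 \<partial>\<mu>)" using Rep_norm[OF x] by simp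
  moreover have "(norm (B x - z *\<^sub>C x))\<^sup>2 = (\<integral>v. (cmod (complex_of_real v - z))\<^sup>2 * (h v)\<^sup>2 \<partial>\<mu>)"
    using Rep_norm[OF x'] unfolding eq by simp
  ultimately have "(\<integral>v. g v \<partial>\<mu>) \<le> 0"
    using int unfolding g_def left_diff_distrib by (simp add: power_mult_distrib)
  moreover have "(\<integral>v. g v \<partial>\<mu>) \<ge> 0" using g0 by simp
  ultimately have "(\<integral>v. g v \<partial>\<mu>) = 0" by linarith
  then have "AE v in \<mu>. g v = 0" using integral_nonneg_eq_0_iff_AE[OF intg] g0 by simp
  then show ?thesis
  proof eventually_elim
    case (elim v)
    show ?case
    proof (rule ccontr)
      assume less: "\<not> ?case"
      then have "(cmod (complex_of_real v - z))\<^sup>2 < \<delta>\<^sup>2" by (intro power_strict_mono) auto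
      moreover have "h v > 0" using less by (simp add: h_def)
      ultimately show False using elim by (simp add: g_def)
    qed
  qed
qed

lemma spectral_measure: "is_spectral_measure B \<mu>"
  unfolding is_spectral_measure_def
proof (intro conjI allI impI)
  show "sets \<mu> = sets borel" by simp
  show "finite_measure \<mu>" by (rule finite_measure_axioms)
  fix z assume "z \<notin> op_spectrum B"
  then obtain R where R: "bounded_clinear R" "\<And>x. R (B x - z *\<^sub>C x) = x" "\<And>x. B (R x) - z *\<^sub>C R x = x"
    unfolding op_spectrum_def by blast
  interpret R: bounded_clinear_op R by standard (rule R)
  obtain M where M: "M > 0" "\<And>x. norm (R x) \<le> norm x * M" using R.pos_bounded by blast
  define \<delta> where "\<delta> = 1 / M"
  have \<delta>: "\<delta> > 0" using M by (simp add: \<delta>_def)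
  have "\<delta> * norm x \<le> norm (B x - z *\<^sub>C x)" for x
    using M(2)[of "B x - z *\<^sub>C x"] M(1) by (simp add: R(2) \<delta>_def field_simps)
  then have AE: "AE v in \<mu>. \<delta> \<le> cmod (complex_of_real v - z)" by (rule AE_resolvent[OF \<delta>])
  show "integrable \<mu> (\<lambda>x. 1 / (complex_of_real x - z))"
  proof (rule integrable_const_bound[of _ "1 / \<delta>"])
    show "AE x in \<mu>. cmod (1 / (complex_of_real x - z)) \<le> 1 / \<delta>"
      using AE by eventually_elim (use \<delta> in \<open>auto simp: norm_divide intro!: divide_left_mono mult_pos_pos\<close>)
  qed simp
  \<comment> \<open>A continuous function on the whole line that equals 1/(v - z) where |v - z|
    \<ge> \<delta>, hence almost everywhere; continuity makes it representable.\<close>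
  define h where "h v = cnj (complex_of_real v - z) / complex_of_real (max (\<delta>\<^sup>2) ((cmod (complex_of_real v - z))\<^sup>2))" for v
  have pos: "max (\<delta>\<^sup>2) r > 0" for r using \<delta> by (simp add: less_max_iff_disj)
  have cont: "continuous_on S h" for S
    unfolding h_def using pos less_imp_neq[OF pos] by (intro continuous_intros) (metis of_real_eq_0_iff order_less_irrefl)
  then have [measurable]: "h \<in> borel_measurable borel" by (intro borel_measurable_continuous_onI)
  have AE_h: "AE v in \<mu>. h v = 1 / (complex_of_real v - z)"
    using AE
  proof eventually_elim
    case (elim v)
    define w where "w = complex_of_real v - z"
    have "\<delta>\<^sup>2 \<le> (cmod w)\<^sup>2" using elim \<delta> by (intro power_mono) (auto simp: w_def)
    then have "h v = cnj w / complex_of_real ((cmod w)\<^sup>2)" by (simp add: h_def w_def max_def)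
    also have "\<dots> = cnj w / (cnj w * w)" unfolding of_real_cmod_square ..
    also have "\<dots> = 1 / w"
    proof -
      have "cmod w > 0" using elim \<delta> unfolding w_def by linarith
      then show ?thesis by simp
    qed
    finally show ?case by (simp add: w_def)
  qed
  obtain y where y: "Rep h y" using Rep_exists[OF cont] by blast
  have "Rep (\<lambda>v. (complex_of_real v * h v - z * h v) - 1) ((B y - z *\<^sub>C y) - ket 0)"
    by (intro Rep_diff Rep_times Rep_scaleC y Rep_one)
  then have "(norm ((B y - z *\<^sub>C y) - ket 0))\<^sup>2 = (\<integral>v. (cmod ((complex_of_real v * h v - z * h v) - 1))\<^sup>2 \<partial>\<mu>)"
    by (rule Rep_norm) simp
  also have "\<dots> = (\<integral>v. 0 \<partial>\<mu>)"
  proof (rule integral_cong_AE)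
    show "AE v in \<mu>. (cmod ((complex_of_real v * h v - z * h v) - 1))\<^sup>2 = 0"
      using AE_h AE
    proof eventually_elim
      case (elim v)
      then have "complex_of_real v - z \<noteq> 0" using \<delta> by auto
      then have "(complex_of_real v - z) * h v = 1" using elim(1) by simp
      then show ?case by (simp add: algebra_simps)
    qed
  qed simp_all
  finally have "B y - z *\<^sub>C y = ket 0" by simp
  moreover have "inj (\<lambda>x. B x - z *\<^sub>C x)" by (rule injI) (metis R(2))
  ultimately have inv: "inv (\<lambda>x. B x - z *\<^sub>C x) (ket 0) = y" by (intro inv_f_eq)
  have "cinner (ket 0) y = L2_inner \<mu> (\<lambda>v. 1) h" by (rule Rep_cinner[OF Rep_one y]) simp_all
  also have "\<dots> = (\<integral>v. h v \<partial>\<mu>)" by (simp add: L2_inner_def)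
  also have "\<dots> = (\<integral>v. 1 / (complex_of_real v - z) \<partial>\<mu>)" by (rule integral_cong_AE) (use AE_h in auto)
  finally show "(\<integral>x. 1 / (complex_of_real x - z) \<partial>\<mu>) = cinner (ket 0) (inv (\<lambda>x. B x - z *\<^sub>C x) (ket 0))"
    by (simp only: inv)
qed

text \<open>Equality is required only off the zeros of q, so values that arise from division by zero
  can be excluded by giving q extra zeros.\<close>

definition rational_on_julia :: "(real \<Rightarrow> complex) \<Rightarrow> bool" where
  "rational_on_julia f \<longleftrightarrow> (\<exists>p q. (\<forall>v\<in>K. rpoly q v \<noteq> 0) \<and>
    (\<forall>v. rpoly q v \<noteq> 0 \<longrightarrow> f v = rpoly p v / rpoly q v))"

lemma rational_add:
  assumes "rational_on_julia f" "rational_on_julia g" shows "rational_on_julia (\<lambda>v. f v + g v)"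
proof -
  obtain p q p' q' where "\<forall>v\<in>K. rpoly q v \<noteq> 0" "\<forall>v\<in>K. rpoly q' v \<noteq> 0"
    "\<forall>v. rpoly q v \<noteq> 0 \<longrightarrow> f v = rpoly p v / rpoly q v"
    "\<forall>v. rpoly q' v \<noteq> 0 \<longrightarrow> g v = rpoly p' v / rpoly q' v"
    using assms unfolding rational_on_julia_def by blast
  then show ?thesis
    unfolding rational_on_julia_def
    by (intro exI[of _ "p * q' + p' * q"] exI[of _ "q * q'"]) (auto simp: add_frac_eq)
qed

lemma rational_mult:
  assumes "rational_on_julia f" "rational_on_julia g" shows "rational_on_julia (\<lambda>v. f v * g v)"
proof -
  obtain p q p' q' where "\<forall>v\<in>K. rpoly q v \<noteq> 0" "\<forall>v\<in>K. rpoly q' v \<noteq> 0"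
    "\<forall>v. rpoly q v \<noteq> 0 \<longrightarrow> f v = rpoly p v / rpoly q v"
    "\<forall>v. rpoly q' v \<noteq> 0 \<longrightarrow> g v = rpoly p' v / rpoly q' v"
    using assms unfolding rational_on_julia_def by blast
  then show ?thesis
    unfolding rational_on_julia_def by (intro exI[of _ "p * p'"] exI[of _ "q * q'"]) auto
qed

lemma rational_const: "rational_on_julia (\<lambda>v. a)"
  unfolding rational_on_julia_def by (rule exI[of _ "[:a:]"], rule exI[of _ 1]) simp

lemma rational_sum:
  "finite S \<Longrightarrow> (\<And>i. i \<in> S \<Longrightarrow> rational_on_julia (f i)) \<Longrightarrow> rational_on_julia (\<lambda>v. \<Sum>i\<in>S. f i v)"
  by (induction S rule: finite_induct) (simp_all add: rational_const rational_add)

lemma rational_odd_factor: "rational_on_julia (\<lambda>v. complex_of_real (\<tau> * v + (\<tau> - 1) / v))"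
  unfolding rational_on_julia_def
proof (rule exI[of _ "[:complex_of_real (\<tau> - 1), 0, complex_of_real \<tau>:]"], rule exI[of _ "[:0, 1:]"],
    intro conjI ballI allI impI)
  fix v
  show "v \<in> K \<Longrightarrow> rpoly [:0, 1:] v \<noteq> 0" using julia_nonzero by simp
  assume "rpoly [:0, 1:] v \<noteq> 0"
  then have "v \<noteq> 0" by simp
  then show "complex_of_real (\<tau> * v + (\<tau> - 1) / v) =
      rpoly [:complex_of_real (\<tau> - 1), 0, complex_of_real \<tau>:] v / rpoly [:0, 1:] v"
    by (simp add: field_simps)
qed

text \<open>Clears denominators in p(\<pi>(v)) by a power of v; the equation says nothing about the
  pole v = 0.\<close>

lemma poly_ratmap: "\<exists>P d. \<forall>v. v \<noteq> 0 \<longrightarrow> poly P (complex_of_real v) = complex_of_real v ^ d * rpoly p (ratmap \<tau> v)"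
proof (induction p)
  case 0 show ?case by (intro exI[of _ 0]) simp
next
  case (pCons a p)
  then obtain P d where P: "\<And>v. v \<noteq> 0 \<Longrightarrow> poly P (complex_of_real v) = complex_of_real v ^ d * rpoly p (ratmap \<tau> v)"
    by blast
  have "rpoly (monom a (Suc d) + [:- complex_of_real (\<tau> - 1), 0, complex_of_real \<tau>:] * P) v =
      complex_of_real v ^ Suc d * rpoly (pCons a p) (ratmap \<tau> v)" if "v \<noteq> 0" for v
  proof -
    have "v * ratmap \<tau> v = v * v * \<tau> - (\<tau> - 1)" using that by (simp add: ratmap_def field_simps)
    then have "complex_of_real v * complex_of_real (ratmap \<tau> v) = complex_of_real (v * v * \<tau> - (\<tau> - 1))"
      by (metis of_real_mult)
    moreover have "rpoly [:- complex_of_real (\<tau> - 1), 0, complex_of_real \<tau>:] v =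
        complex_of_real (v * v * \<tau> - (\<tau> - 1))" by simp
    ultimately have r: "rpoly [:- complex_of_real (\<tau> - 1), 0, complex_of_real \<tau>:] v =
        complex_of_real v * complex_of_real (ratmap \<tau> v)" by simp
    show ?thesis
      unfolding poly_add poly_mult r P[OF that] poly_monom by (simp add: algebra_simps)
  qed
  then show ?case by blast
qed

lemma rational_comp:
  assumes "rational_on_julia f" shows "rational_on_julia (\<lambda>v. f (ratmap \<tau> v))"
proof -
  obtain p q where q: "\<forall>v\<in>K. rpoly q v \<noteq> 0"
    and f: "\<forall>v. rpoly q v \<noteq> 0 \<longrightarrow> f v = rpoly p v / rpoly q v"
    using assms unfolding rational_on_julia_def by blast
  obtain P d where P: "\<And>v. v \<noteq> 0 \<Longrightarrow> poly P (complex_of_real v) = complex_of_real v ^ d * rpoly p (ratmap \<tau> v)"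
    using poly_ratmap by blast
  obtain Q e where Q: "\<And>v. v \<noteq> 0 \<Longrightarrow> poly Q (complex_of_real v) = complex_of_real v ^ e * rpoly q (ratmap \<tau> v)"
    using poly_ratmap by blast
  show ?thesis
    unfolding rational_on_julia_def
  \<comment> \<open>The crossed powers balance the denominators cleared from p and q. The successor
    adds a common factor v, so the pole becomes a zero of the new denominator and is
    excluded.\<close>
  proof (rule exI[of _ "P * monom 1 (Suc e)"], rule exI[of _ "Q * monom 1 (Suc d)"], intro conjI ballI allI impI)
    fix v assume "v \<in> K"
    then show "rpoly (Q * monom 1 (Suc d)) v \<noteq> 0"
      using q ratmap_julia[OF \<tau>] julia_nonzero by (simp add: Q poly_monom)
  next
    fix v assume nz: "rpoly (Q * monom 1 (Suc d)) v \<noteq> 0"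
    then have v: "v \<noteq> 0" by (auto simp: poly_monom)
    then have "rpoly q (ratmap \<tau> v) \<noteq> 0" using nz by (auto simp: Q)
    then have "f (ratmap \<tau> v) = rpoly p (ratmap \<tau> v) / rpoly q (ratmap \<tau> v)" using f by blast
    then show "f (ratmap \<tau> v) = rpoly (P * monom 1 (Suc e)) v / rpoly (Q * monom 1 (Suc d)) v"
      using v by (simp add: P Q poly_monom)
  qed
qed

lemma rational_e_fun: "rational_on_julia (e_fun \<tau> c k)"
proof (induction k rule: less_induct)
  case (less k)
  consider "k = 0" | m where "k = 2 * m" "m > 0" | m where "k = 2 * m + 1" by (metis evenE oddE gr0I mult_0_right)
  then show ?case
  proof cases
    case 1 then show ?thesis using rational_const[of 1] by (simp add: e_fun_rec(1)[abs_def])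
  next
    case 2
    then have "rational_on_julia (e_fun \<tau> c m)" using less by simp
    from rational_comp[OF this] show ?thesis by (simp only: 2(1) e_fun_rec(2)[abs_def])
  next
    case 3
    have "rational_on_julia (\<lambda>v. complex_of_real (\<tau> * v + (\<tau> - 1) / v) * (\<Sum>j=0..m. c m j * e_fun \<tau> c j (ratmap \<tau> v)))"
      using less 3 by (intro rational_mult rational_odd_factor rational_sum rational_const rational_comp) auto
    then show ?thesis by (simp only: 3 e_fun_rec(3)[abs_def])
  qed
qed

text \<open>From p = q f on K follows p(B)|0> = q(B) x, and q(B) is invertible and commutes with
  p(B).\<close>

lemma rational_calculus_Rep:
  assumes "rational_on_julia f" and f: "Rep f x"
  shows "rational_calculus B f (ket 0) x"
proof -
  obtain p q where q: "\<forall>v\<in>K. rpoly q v \<noteq> 0"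
    and pq: "\<forall>v. rpoly q v \<noteq> 0 \<longrightarrow> f v = rpoly p v / rpoly q v"
    using assms(1) unfolding rational_on_julia_def by blast
  have bij: "bij (poly_op q B)" using poly_op_invertible(1) q by blast
  define u where "u = inv (poly_op q B) (ket 0)"
  have u: "poly_op q B u = ket 0" using bij by (simp add: u_def bij_is_surj surj_f_inv_f)
  have "vec p = poly_op q B x"
    by (rule Rep_unique[OF Rep_poly Rep_poly_mult[OF f]]) (use q pq in simp)
  moreover have "poly_op q B (poly_op p B u) = vec p"
    by (simp add: poly_op_mult[symmetric] mult.commute[of q] vec_def u[symmetric])
  ultimately have "poly_op p B u = x" using bij by (metis bij_is_inj injD)
  moreover have "\<forall>z\<in>op_spectrum B. poly q z \<noteq> 0" using q op_spectrum_subset by blast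
  ultimately show ?thesis
    unfolding rational_calculus_def using bij pq u_def by blast
qed

lemma coef_diag: "coef k k = complex_of_real (1 / P.gs_norm k)"
  by (simp add: coef_def inv_Phi_ket P.gs_diag)

text \<open>Locality of the recursion, which lets uniqueness of the coefficients be proved one row
  at a time.\<close>

lemma e_fun_cong: "(\<And>i. 2 * i + 1 \<le> l \<Longrightarrow> c i = c' i) \<Longrightarrow> e_fun \<tau> c l = e_fun \<tau> c' l"
proof (induction l rule: less_induct)
  case (less l)
  consider "l = 0" | m where "l = 2 * m" "m > 0" | m where "l = 2 * m + 1" by (metis evenE oddE gr0I mult_0_right)
  then show ?case
  proof cases
    case 1 then show ?thesis by (simp add: e_fun_rec(1)[abs_def])
  next
    case 2
    have "e_fun \<tau> c m = e_fun \<tau> c' m" using 2 by (intro less) auto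
    then show ?thesis by (simp only: 2(1) e_fun_rec(2)[abs_def])
  next
    case 3
    have "e_fun \<tau> c j = e_fun \<tau> c' j" if "j \<le> m" for j using 3 that by (intro less) auto
    moreover have "c m = c' m" using 3 less.prems by simp
    ultimately show ?thesis by (simp add: 3 e_fun_rec(3)[abs_def] cong: sum.cong_simp)
  qed
qed

text \<open>For uniqueness let y have the coordinates \<open>c k j\<close>, so that e_{2k+1} is
  represented by od(\<Phi> y). Triangularity kills coordinates of \<Phi> y above k, orthogonality to
  the earlier odd functions those below, and norm one with c^k_k > 0 leaves \<open>ket k\<close>.
  Hence y is column k of the inverse of \<Phi>.\<close>

lemma orthogonality_coeffs_iff: "orthogonality_coeffs \<tau> \<mu> c \<longleftrightarrow> c = coef"
proof
  assume "c = coef"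
  moreover have "orthogonality_coeffs \<tau> \<mu> coef"
    unfolding orthogonality_coeffs_def
  proof (intro conjI allI impI)
    show "k < j \<Longrightarrow> coef k j = 0" for k j by (rule coef_upper)
    show "\<exists>r>0. coef k k = complex_of_real r" for k
      using P.gs_norm_pos[of k] by (intro exI[of _ "1 / P.gs_norm k"]) (simp add: coef_diag)
    show "L2_inner \<mu> (e_fun \<tau> coef (2 * k + 1)) (e_fun \<tau> coef l) = (if l = 2 * k + 1 then 1 else 0)" for k l
      using Rep_cinner[OF Rep_e_fun[of "2 * k + 1"] Rep_e_fun[of l]]
      by (cases "l = 2 * k + 1") (auto simp: coord_ket)
  qed
  ultimately show "orthogonality_coeffs \<tau> \<mu> c" by simp
next
  assume c: "orthogonality_coeffs \<tau> \<mu> c"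
  have "c k = coef k" for k
  proof (induction k rule: less_induct)
    case (less k)
    \<comment> \<open>Up to index 2k only rows below k occur, and these agree by induction; row k
      first enters at 2k + 1.\<close>
    have e: "e_fun \<tau> c l = e_fun \<tau> coef l" if "l \<le> 2 * k" for l
      using that less by (intro e_fun_cong) auto
    define y where "y = (\<Sum>j\<le>k. c k j *\<^sub>C ket j)"
    have coord_y: "coord y j = c k j" for j
      using c by (simp add: y_def coord_ket if_distrib[of "\<lambda>a. _ * a"] sum.delta orthogonality_coeffs_def cong: if_cong)
    have "Rep (\<lambda>v. \<Sum>j\<le>k. c k j * e_fun \<tau> c j v) y"
      unfolding y_def
    proof (intro Rep_sum Rep_scaleC)
      fix j assume "j \<in> {..k}"
      then show "Rep (e_fun \<tau> c j) (ket j)" using e[of j] Rep_e_fun[of j] by simp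
    qed simp
    from Rep_odd[OF this] have R: "Rep (e_fun \<tau> c (2 * k + 1)) (od (\<Phi> y))"
      by (simp only: e_fun_rec(3)[abs_def] atLeast0AtMost)
    obtain r where r: "r > 0" "c k k = complex_of_real r" using c unfolding orthogonality_coeffs_def by blast
    have Phi_y: "coord (\<Phi> y) i = (\<Sum>j\<le>k. c k j * coord (\<Phi> (ket j)) i)" for i
      by (simp add: y_def Phi.sum Phi.scaleC)
    have above: "coord (\<Phi> y) i = 0" if "i > k" for i
      unfolding Phi_y using that by (intro sum.neutral) (auto simp: Phi_upper)
    have below: "coord (\<Phi> y) i = 0" if "i < k" for i
    proof -
      have "Rep (e_fun \<tau> c (2 * i + 1)) (ket (2 * i + 1))" using e[of "2 * i + 1"] Rep_e_fun[of "2 * i + 1"] that by simp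
      from Rep_cinner[OF R this]
      have "cinner (od (\<Phi> y)) (ket (2 * i + 1)) = 0"
        using c that unfolding orthogonality_coeffs_def by simp
      then show ?thesis by (simp add: coord_od)
    qed
    have "coord (\<Phi> y) k = c k k * coord (\<Phi> (ket k)) k"
      unfolding Phi_y by (rule sum.remove[THEN trans, of _ k]) (auto intro!: sum.neutral simp: Phi_upper)
    then obtain s where s: "s > 0" "coord (\<Phi> y) k = complex_of_real s"
      using r P.gs_norm_pos[of k] by (auto simp: Phi_diag intro!: that[of "r * P.gs_norm k"])
    have eq: "\<Phi> y = complex_of_real s *\<^sub>C ket k"
      by (rule ell2_eqI) (metis above below s(2) coord_ket coord_scaleC linorder_neqE_nat mult.right_neutral mult_zero_right)
    have "cinner (od (\<Phi> y)) (od (\<Phi> y)) = 1"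
      using Rep_cinner[OF R R] c unfolding orthogonality_coeffs_def by simp
    then have "complex_of_real (s * s) = complex_of_real 1" unfolding eq by (simp add: coord_ket del: ev_od_linear)
    then have "s * s = 1" by (simp only: of_real_eq_iff)
    then have "s = 1" using s(1) by (metis abs_of_pos power2_eq_1_iff power2_eq_square less_minus_one_simps(1) less_asym zero_less_one)
    then have "\<Phi> y = ket k" using eq by simp
    then have "y = inv \<Phi> (ket k)" using inv_f_f[OF bij_is_inj[OF bij_Phi], of y] by simp
    then show "c k = coef k" by (intro ext) (simp add: coef_def coord_y[symmetric])
  qed
  then show "c = coef" by (rule ext)
qed

end

theorem theorem8p8:
  fixes \<tau> :: real and A :: "nat \<Rightarrow> ell2 \<Rightarrow> ell2"
  assumes "\<tau> > 1"
    and "admissible (A 0)"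
    and "\<And>n. A (Suc n) = pi_star \<tau> (A n)"
  shows "\<exists>B \<mu> c.
    weakly_converges A B \<and> admissible B \<and>
    (\<forall>\<mu>'. is_eigen_measure \<tau> \<mu>' \<longleftrightarrow> \<mu>' = \<mu>) \<and>
    is_spectral_measure B \<mu> \<and>
    (\<forall>c'. orthogonality_coeffs \<tau> \<mu> c' \<longleftrightarrow> c' = c) \<and>
    orthonormal_basis \<mu> (e_fun \<tau> c) \<and>
    (\<forall>j k. cinner (ket j) (B (ket k))
       = L2_inner \<mu> (e_fun \<tau> c j) (\<lambda>v. complex_of_real v * e_fun \<tau> c k v)) \<and>
    (\<forall>k. rational_calculus B (e_fun \<tau> c k) (ket 0) (ket k)) \<and>
    (\<forall>\<Phi>. is_Phi \<tau> B \<Phi> \<longleftrightarrow> \<Phi> = Phi \<tau> B) \<and> bij (Phi \<tau> B) \<and>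
    (\<forall>j k. cinner (ket j) (inv (Phi \<tau> B) (ket k)) = c k j)"
proof -
  interpret pi_star_iteration \<tau> A
    using assms by unfold_locales (auto simp: admissible_def)
  interpret fixed_op B \<tau>
    by unfold_locales (rule B_Theta B_moments)+
  show ?thesis
  proof (intro exI[of _ B] exI[of _ "eigen \<tau>"] exI[of _ coef] conjI allI)
    show "weakly_converges A B" by (rule weakly_converges_B)
    show "admissible B" by (rule admissible_B)
    show "is_eigen_measure \<tau> \<mu>' \<longleftrightarrow> \<mu>' = eigen \<tau>" for \<mu>'
      using is_eigen_measure_eigen[OF \<tau>] eigen_measure_unique[OF \<tau>] by blast
    show "is_spectral_measure B (eigen \<tau>)" by (rule spectral_measure)
    show "orthogonality_coeffs \<tau> (eigen \<tau>) c' \<longleftrightarrow> c' = coef" for c' by (rule orthogonality_coeffs_iff)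
    show "orthonormal_basis (eigen \<tau>) (e_fun \<tau> coef)" by (rule orthonormal_basis_e_fun)
    show "cinner (ket j) (B (ket k)) = L2_inner (eigen \<tau>) (e_fun \<tau> coef j) (\<lambda>v. complex_of_real v * e_fun \<tau> coef k v)" for j k
      by (rule matrix_entries)
    show "rational_calculus B (e_fun \<tau> coef k) (ket 0) (ket k)" for k
      by (rule rational_calculus_Rep[OF rational_e_fun Rep_e_fun])
    show "is_Phi \<tau> B \<Phi> \<longleftrightarrow> \<Phi> = Phi \<tau> B" for \<Phi> by (rule B.is_Phi_iff)
    show "bij (Phi \<tau> B)" by (rule B.bij_Phi)
    show "cinner (ket j) (inv (Phi \<tau> B) (ket k)) = coef k j" for j k by (simp add: coef_def)
  qed
qed

end
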